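(* Let $c\geq 1$ be an odd integer. Given a polynomial time algorithm for one of the following computational problems, we can construct a polynomial time algorithm for the other. (i) Given upset decomposable modules $M\ncong N$ with $|B(M)|= |B(N)|$, return a number in the interval $[d_I(M,N), (c+2)d_I(M,N))$. (ii) Given a CI problem $\mathcal{P}$, decide either that $\mathcal{P}$ does not have a solution or that the $c$-weakening of $\mathcal{P}$ has a solution. (The two alternatives need not be mutually exclusive; any correct assertion is a valid output.)
   Context: Fix a field $k$ and an integer $d\ge2$. Modules. $\mathbb{R}^d$ has the product partial order. A module is a functor $M\colon\mathbb{R}^d\to\mathbf{Vec}_k$; morphisms are natural transformations. Write $\vec\epsilon=(\epsilon,\dots,\epsilon)$. $M(\epsilon)_p=M_{p+\vec\epsilon}$ with the corresponding maps; $f(\epsilon)_p=f_{p+\vec\epsilon}$; $M_{0\to\epsilon}\colon M\to M(\epsilon)$ has components $M_{p\to p+\vec\epsilon}$. $M,N$ are $\epsilon$-interleaved ($\epsilon\ge0$) if there are morphisms $\phi\colon M\to N(\epsilon)$, $\psi\colon N\to M(\epsilon)$ with $\psi(\epsilon)\circ\phi=M_{0\to2\epsilon}$, $\phi(\epsilon)\circ\psi=N_{0\to2\epsilon}$; $d_I(M,N)=\inf\{\epsilon\mid M,N\text{ are }\epsilon\text{-interleaved}\}$. An upset is a set $U\subseteq\mathbb{R}^d$ with $p\le q$, $p\in U$ implying $q\in U$; the associated upset module has $U_p=k$ for $p\in U$, $U_p=0$ otherwise, and identity maps within $U$. A module is upset decomposable if it is isomorphic to a direct sum of upset modules; $B(M)$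 is the multiset of isomorphism classes of its nonzero indecomposable summands (here, the upset modules). CI problems. A CI problem of size $n$ is a pair $(P,Q)$ of $n\times n$-matrices with entries in $\{0,*\}$. A solution is a pair $(A,B)$ of $n\times n$-matrices over $k$ such that $AB$ is the identity, $A$ is zero wherever $P$ is $0$, and $B$ is zero wherever $Q$ is $0$. To $(P,Q)$ associate the directed bipartite graph on vertices $u_1,\dots,u_n,v_1,\dots,v_n$ with an edge $u_i\to v_j$ iff $P_{j,i}=*$ and an edge $v_j\to u_i$ iff $Q_{i,j}=*$; the graph determines $(P,Q)$. For odd $c\ge1$, the $c$-weakening of $(P,Q)$ is the CI problem whose graph has an edge $u_i\to v_j$ (resp. $v_j\to u_i$) iff the graph of $(P,Q)$ has a directed path from $u_i$ to $v_j$ (resp. $v_j$ to $u_i$) of length at most $c$. Input size. A CI problem of size $n$ is described in space $O(n^2)$. In problem (i), $M$ and $N$ are finite direct sums of upsets, each upset $U$ being described as a finite list of points $p_1,\dots,p_m$ with $U=\bigcup_{i=1}^m\{q\in\mathbb{R}^d\mid q\ge p_i\}$. *)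

theory Defs
  imports
    "Jordan_Normal_Form.Matrix"
    "HOL-Computational_Algebra.Polynomial"
    "HOL-Library.Extended_Real"
    "HOL-Library.Function_Algebras"
    "HOL-Library.Log_Nat"
    "HOL-Library.Multiset"
begin

section \<open>Persistence modules over the poset of real vectors\<close>

text \<open>
  The poset is \<^term>\<open>carrier_vec d :: real vec set\<close> with the componentwise order on vectors.
  A vector space over the field \<^typ>\<open>'k\<close> is represented as a linear subspace of a
  space \<^typ>\<open>'i \<Rightarrow> 'k\<close> of functions with pointwise operations. Every vector space whose dimension is
  at most the cardinality of \<^typ>\<open>'i\<close> has such a representation (choose a basis).
\<close>

definition fscale :: "'k::field \<Rightarrow> ('i \<Rightarrow> 'k) \<Rightarrow> ('i \<Rightarrow> 'k)" where
  "fscale a f = (\<lambda>i. a * f i)"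

lemma vector_space_fscale: "vector_space fscale"
  by unfold_locales (auto simp: fscale_def plus_fun_def fun_eq_iff algebra_simps)

record ('k, 'i) pmod =
  sp :: "real vec \<Rightarrow> ('i \<Rightarrow> 'k) set"
  tr :: "real vec \<Rightarrow> real vec \<Rightarrow> ('i \<Rightarrow> 'k) \<Rightarrow> ('i \<Rightarrow> 'k)"

definition linear_between ::
  "('i \<Rightarrow> 'k::field) set \<Rightarrow> ('j \<Rightarrow> 'k) set \<Rightarrow> (('i \<Rightarrow> 'k) \<Rightarrow> ('j \<Rightarrow> 'k)) \<Rightarrow> bool" where
  "linear_between V W f \<longleftrightarrow>
     (\<forall>x\<in>V. f x \<in> W) \<and>
     (\<forall>x\<in>V. \<forall>y\<in>V. f (x + y) = f x + f y) \<and>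
     (\<forall>a. \<forall>x\<in>V. f (fscale a x) = fscale a (f x))"

definition pmodule :: "nat \<Rightarrow> ('k::field, 'i) pmod \<Rightarrow> bool" where
  "pmodule d M \<longleftrightarrow>
     (\<forall>p\<in>carrier_vec d. Modules.module.subspace fscale (sp M p)) \<and>
     (\<forall>p\<in>carrier_vec d. \<forall>q\<in>carrier_vec d. p \<le> q \<longrightarrow> linear_between (sp M p) (sp M q) (tr M p q)) \<and>
     (\<forall>p\<in>carrier_vec d. \<forall>x\<in>sp M p. tr M p p x = x) \<and>
     (\<forall>p\<in>carrier_vec d. \<forall>q\<in>carrier_vec d. \<forall>r\<in>carrier_vec d. p \<le> q \<longrightarrow> q \<le> r \<longrightarrow>
        (\<forall>x\<in>sp M p. tr M q r (tr M p q x) = tr M p r x))"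

definition morphism ::
  "nat \<Rightarrow> ('k::field, 'i) pmod \<Rightarrow> ('k, 'j) pmod \<Rightarrow>
   (real vec \<Rightarrow> ('i \<Rightarrow> 'k) \<Rightarrow> ('j \<Rightarrow> 'k)) \<Rightarrow> bool" where
  "morphism d M N f \<longleftrightarrow>
     (\<forall>p\<in>carrier_vec d. linear_between (sp M p) (sp N p) (f p)) \<and>
     (\<forall>p\<in>carrier_vec d. \<forall>q\<in>carrier_vec d. p \<le> q \<longrightarrow>
        (\<forall>x\<in>sp M p. f q (tr M p q x) = tr N p q (f p x)))"

definition isomorphic :: "nat \<Rightarrow> ('k::field, 'i) pmod \<Rightarrow> ('k, 'j) pmod \<Rightarrow> bool" where
  "isomorphic d M N \<longleftrightarrow>
     (\<exists>f g. morphism d M N f \<and> morphism d N M g \<and>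
        (\<forall>p\<in>carrier_vec d. (\<forall>x\<in>sp M p. g p (f p x) = x) \<and> (\<forall>y\<in>sp N p. f p (g p y) = y)))"

definition diag :: "nat \<Rightarrow> real \<Rightarrow> real vec" where
  "diag d \<epsilon> = vec d (\<lambda>_. \<epsilon>)"

definition shift :: "nat \<Rightarrow> real \<Rightarrow> ('k, 'i) pmod \<Rightarrow> ('k, 'i) pmod" where
  "shift d \<epsilon> M =
     \<lparr>sp = (\<lambda>p. sp M (p + diag d \<epsilon>)), tr = (\<lambda>p q. tr M (p + diag d \<epsilon>) (q + diag d \<epsilon>))\<rparr>"

definition interleaved ::
  "nat \<Rightarrow> real \<Rightarrow> ('k::field, 'i) pmod \<Rightarrow> ('k, 'j) pmod \<Rightarrow> bool" where
  "interleaved d \<epsilon> M N \<longleftrightarrow> 0 \<le> \<epsilon> \<and>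
     (\<exists>\<phi> \<psi>. morphism d M (shift d \<epsilon> N) \<phi> \<and> morphism d N (shift d \<epsilon> M) \<psi> \<and>
        (\<forall>p\<in>carrier_vec d.
           (\<forall>x\<in>sp M p. \<psi> (p + diag d \<epsilon>) (\<phi> p x) = tr M p (p + diag d (2 * \<epsilon>)) x) \<and>
           (\<forall>y\<in>sp N p. \<phi> (p + diag d \<epsilon>) (\<psi> p y) = tr N p (p + diag d (2 * \<epsilon>)) y)))"

definition interleaving_distance ::
  "nat \<Rightarrow> ('k::field, 'i) pmod \<Rightarrow> ('k, 'j) pmod \<Rightarrow> ereal" where
  "interleaving_distance d M N = Inf {ereal \<epsilon> | \<epsilon>. interleaved d \<epsilon> M N}"

definition zero_module :: "nat \<Rightarrow> ('k::field, 'i) pmod \<Rightarrow> bool" where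
  "zero_module d M \<longleftrightarrow> (\<forall>p\<in>carrier_vec d. sp M p = {0})"

definition direct_sum :: "('k::field, 'i) pmod list \<Rightarrow> ('k, nat \<times> 'i) pmod" where
  "direct_sum Ms =
     \<lparr>sp = (\<lambda>p. {f. (\<forall>j<length Ms. (\<lambda>i. f (j, i)) \<in> sp (Ms ! j) p) \<and>
                    (\<forall>j\<ge>length Ms. \<forall>i. f (j, i) = 0)}),
      tr = (\<lambda>p q f. \<lambda>(j, i). if j < length Ms then tr (Ms ! j) p q (\<lambda>i. f (j, i)) i else 0)\<rparr>"

text \<open>
  In the next two definitions the summands may be taken over the same index type as the module
  itself, since every summand is isomorphic to a submodule.
\<close>

definition indecomposable :: "nat \<Rightarrow> ('k::field, 'i) pmod \<Rightarrow> bool" where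
  "indecomposable d M \<longleftrightarrow> \<not> zero_module d M \<and>
     (\<forall>X Y :: ('k, 'i) pmod. pmodule d X \<longrightarrow> pmodule d Y \<longrightarrow>
        isomorphic d M (direct_sum [X, Y]) \<longrightarrow> zero_module d X \<or> zero_module d Y)"

definition iso_class :: "nat \<Rightarrow> ('k::field, 'i) pmod \<Rightarrow> ('k, 'i) pmod set" where
  "iso_class d M = {N. pmodule d N \<and> isomorphic d M N}"

definition is_barcode ::
  "nat \<Rightarrow> ('k::field, 'i) pmod \<Rightarrow> ('k, 'i) pmod set multiset \<Rightarrow> bool" where
  "is_barcode d M \<BB> \<longleftrightarrow>
     (\<exists>Xs :: ('k, 'i) pmod list. (\<forall>X\<in>set Xs. pmodule d X \<and> indecomposable d X) \<and>
        isomorphic d M (direct_sum Xs) \<and> \<BB> = mset (map (iso_class d) Xs))"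

text \<open>
  For a finite direct sum of upset modules, which is the only case needed, the multiset exists and
  is unique by the Krull--Remak--Schmidt--Azumaya theorem: nonempty upsets are directed, so their
  upset modules have only scalar endomorphisms.
\<close>

definition barcode :: "nat \<Rightarrow> ('k::field, 'i) pmod \<Rightarrow> ('k, 'i) pmod set multiset" where
  "barcode d M = (THE \<BB>. is_barcode d M \<BB>)"

definition upset :: "nat \<Rightarrow> real vec set \<Rightarrow> bool" where
  "upset d U \<longleftrightarrow> U \<subseteq> carrier_vec d \<and> (\<forall>p\<in>U. \<forall>q\<in>carrier_vec d. p \<le> q \<longrightarrow> q \<in> U)"

definition upset_module :: "real vec set \<Rightarrow> ('k::field, unit) pmod" where
  "upset_module U = \<lparr>sp = (\<lambda>p. if p \<in> U then UNIV else {0}), tr = (\<lambda>p q x. if p \<in> U then x else 0)\<rparr>"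

definition generated_upset :: "nat \<Rightarrow> real vec list \<Rightarrow> real vec set" where
  "generated_upset d ps = (\<Union>p\<in>set ps. {q \<in> carrier_vec d. p \<le> q})"

definition upset_sum :: "nat \<Rightarrow> real vec list list \<Rightarrow> ('k::field, nat \<times> unit) pmod" where
  "upset_sum d Us = direct_sum (map (\<lambda>ps. upset_module (generated_upset d ps)) Us)"

lemma upset_generated_upset: "upset d (generated_upset d ps)"
  unfolding upset_def generated_upset_def by (auto intro: order_trans)

lemma pmodule_upset_module:
  assumes "upset d U"
  shows "pmodule d (upset_module U)"
proof -
  interpret V: vector_space "fscale :: 'a \<Rightarrow> (unit \<Rightarrow> 'a) \<Rightarrow> unit \<Rightarrow> 'a"
    by (rule vector_space_fscale)
  show ?thesis
    using assms unfolding pmodule_def upset_def linear_between_def upset_module_def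
    by (auto simp: V.subspace_def)
qed

lemma pmodule_direct_sum:
  fixes Ms :: "('k::field, 'i) pmod list"
  assumes "\<And>M. M \<in> set Ms \<Longrightarrow> pmodule d M"
  shows "pmodule d (direct_sum Ms)"
proof -
  interpret V: vector_space "fscale :: 'k \<Rightarrow> ('i \<Rightarrow> 'k) \<Rightarrow> 'i \<Rightarrow> 'k" by (rule vector_space_fscale)
  interpret W: vector_space "fscale :: 'k \<Rightarrow> (nat \<times> 'i \<Rightarrow> 'k) \<Rightarrow> nat \<times> 'i \<Rightarrow> 'k"
    by (rule vector_space_fscale)
  have M: "pmodule d (Ms ! j)" if "j < length Ms" for j using assms that by simp
  have p: "(\<lambda>i. (f + g) (j, i)) = (\<lambda>i. f (j, i)) + (\<lambda>i. g (j, i))"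
    and s: "(\<lambda>i. fscale a f (j, i)) = fscale a (\<lambda>i. f (j, i))"
    and z: "(\<lambda>i. (0 :: nat \<times> 'i \<Rightarrow> 'k) (j, i)) = 0"
    for f g :: "nat \<times> 'i \<Rightarrow> 'k" and j a
    by (auto simp: fscale_def)
  let ?S = "direct_sum Ms"
  show ?thesis
    unfolding pmodule_def
  proof (intro conjI ballI impI)
    fix q :: "real vec" assume "q \<in> carrier_vec d"
    then have "V.subspace (sp (Ms ! j) q)" if "j < length Ms" for j
      using M[OF that] by (auto simp: pmodule_def)
    then show "W.subspace (sp ?S q)"
      unfolding W.subspace_def V.subspace_def
      by (auto simp: direct_sum_def p s z simp del: plus_fun_apply zero_fun_apply)
         (auto simp: fscale_def)
  next
    fix q r :: "real vec" assume "q \<in> carrier_vec d" "r \<in> carrier_vec d" "q \<le> r"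
    then have L: "linear_between (sp (Ms ! j) q) (sp (Ms ! j) r) (tr (Ms ! j) q r)"
      if "j < length Ms" for j
      using M[OF that] by (auto simp: pmodule_def)
    show "linear_between (sp ?S q) (sp ?S r) (tr ?S q r)"
      unfolding linear_between_def
    proof (intro conjI ballI allI)
      fix x assume "x \<in> sp ?S q"
      then show "tr ?S q r x \<in> sp ?S r"
        using L by (auto simp: direct_sum_def linear_between_def)
    next
      fix x y assume "x \<in> sp ?S q" "y \<in> sp ?S q"
      then show "tr ?S q r (x + y) = tr ?S q r x + tr ?S q r y"
        using L by (auto simp: direct_sum_def linear_between_def p fun_eq_iff simp del: plus_fun_apply)
          (auto simp: fun_eq_iff)
    next
      fix a x assume "x \<in> sp ?S q"
      then show "tr ?S q r (fscale a x) = fscale a (tr ?S q r x)"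
        using L by (auto simp: direct_sum_def linear_between_def s fun_eq_iff)
          (auto simp: fscale_def)
    qed
  next
    fix q :: "real vec" and x assume "q \<in> carrier_vec d" "x \<in> sp ?S q"
    then show "tr ?S q q x = x"
      using M by (auto simp: direct_sum_def pmodule_def fun_eq_iff)
  next
    fix q r t :: "real vec" and x
    assume "q \<in> carrier_vec d" "r \<in> carrier_vec d" "t \<in> carrier_vec d" "q \<le> r" "r \<le> t"
      "x \<in> sp ?S q"
    then show "tr ?S r t (tr ?S q r x) = tr ?S q t x"
      using M by (auto simp: direct_sum_def pmodule_def fun_eq_iff)
  qed
qed

lemma pmodule_upset_sum: "pmodule d (upset_sum d Us)"
  unfolding upset_sum_def
  by (rule pmodule_direct_sum) (auto intro: pmodule_upset_module upset_generated_upset)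


section \<open>CI problems\<close>

datatype entry = Zero | Star

type_synonym ci_problem = "entry mat \<times> entry mat"

definition ci_problems :: "ci_problem set" where
  "ci_problems = (\<Union>n. carrier_mat n n \<times> carrier_mat n n)"

definition ci_size :: "ci_problem \<Rightarrow> nat" where
  "ci_size C = dim_row (fst C)"

definition ci_solution :: "ci_problem \<Rightarrow> 'k::field mat \<Rightarrow> 'k mat \<Rightarrow> bool" where
  "ci_solution C A B \<longleftrightarrow>
     (let n = ci_size C; P = fst C; Q = snd C in
        A \<in> carrier_mat n n \<and> B \<in> carrier_mat n n \<and> A * B = 1\<^sub>m n \<and>
        (\<forall>i<n. \<forall>j<n. P $$ (i, j) = Zero \<longrightarrow> A $$ (i, j) = 0) \<and>
        (\<forall>i<n. \<forall>j<n. Q $$ (i, j) = Zero \<longrightarrow> B $$ (i, j) = 0))"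

definition ci_solvable :: "'k::field itself \<Rightarrow> ci_problem \<Rightarrow> bool" where
  "ci_solvable _ C \<longleftrightarrow> (\<exists>A B :: 'k mat. ci_solution C A B)"

text \<open>
  In the graph of a CI problem, \<^term>\<open>Inl i\<close> and \<^term>\<open>Inr j\<close> stand for the vertices
  $u_{i+1}$ and $v_{j+1}$ (matrix indices start at 0).
\<close>

definition ci_graph :: "ci_problem \<Rightarrow> (nat + nat) rel" where
  "ci_graph C =
     {(Inl i, Inr j) | i j. i < ci_size C \<and> j < ci_size C \<and> fst C $$ (j, i) = Star} \<union>
     {(Inr j, Inl i) | i j. i < ci_size C \<and> j < ci_size C \<and> snd C $$ (i, j) = Star}"

definition path_upto :: "'v rel \<Rightarrow> nat \<Rightarrow> 'v \<Rightarrow> 'v \<Rightarrow> bool" where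
  "path_upto E c x y \<longleftrightarrow> (\<exists>l\<le>c. (x, y) \<in> E ^^ l)"

definition weakening :: "nat \<Rightarrow> ci_problem \<Rightarrow> ci_problem" where
  "weakening c C =
     (let n = ci_size C; E = ci_graph C in
       (mat n n (\<lambda>(j, i). if path_upto E c (Inl i) (Inr j) then Star else Zero),
        mat n n (\<lambda>(i, j). if path_upto E c (Inr j) (Inl i) then Star else Zero)))"

lemma ci_graph_weakening:
  assumes "i < ci_size C" and "j < ci_size C"
  shows "(Inl i, Inr j) \<in> ci_graph (weakening c C) \<longleftrightarrow> path_upto (ci_graph C) c (Inl i) (Inr j)"
    and "(Inr j, Inl i) \<in> ci_graph (weakening c C) \<longleftrightarrow> path_upto (ci_graph C) c (Inr j) (Inl i)"
proof -
  have "ci_size (weakening c C) = ci_size C"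
    by (simp add: weakening_def ci_size_def Let_def)
  moreover have "fst (weakening c C) $$ (j, i) = Star \<longleftrightarrow> path_upto (ci_graph C) c (Inl i) (Inr j)"
    and "snd (weakening c C) $$ (i, j) = Star \<longleftrightarrow> path_upto (ci_graph C) c (Inr j) (Inl i)"
    using assms by (simp_all add: weakening_def Let_def)
  ultimately show "(Inl i, Inr j) \<in> ci_graph (weakening c C) \<longleftrightarrow> path_upto (ci_graph C) c (Inl i) (Inr j)"
    and "(Inr j, Inl i) \<in> ci_graph (weakening c C) \<longleftrightarrow> path_upto (ci_graph C) c (Inr j) (Inl i)"
    using assms unfolding ci_graph_def[of "weakening c C"] by auto
qed


section \<open>Polynomial-time algorithms\<close>

text \<open>
  The machine model is the imperative language WHILE of Jones, extended by numbers:
  a program has finitely many variables, which hold binary trees (built from cons cells, passed by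
  reference) whose leaves are \<open>nil\<close> or numbers from an ordered field. The model is
  parametrised by the bit size \<open>\<beta>\<close> of a number, which enters both the input size and the
  running time. It is used with two choices of numbers and \<open>\<beta>\<close>:

  \<^item> rational numbers, \<open>\<beta>\<close> the length of the binary representation (logarithmic cost); polynomial
    time is then polynomially equivalent to polynomial time on Turing machines;
  \<^item> real numbers, \<open>\<beta> = 0\<close> (unit cost); this is the real RAM, where a real number occupies
    one memory cell.

  Only integers are available as constants in programs. A tree operation applied to a leaf yields
  \<open>nil\<close>, and anything which is not a number counts as 0 in arithmetic.
\<close>

datatype 'a val = Nil | Num 'a | Pair "'a val" "'a val"

fun val_size :: "('a \<Rightarrow> nat) \<Rightarrow> 'a val \<Rightarrow> nat" where
  "val_size \<beta> Nil = 1"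
| "val_size \<beta> (Num a) = 1 + \<beta> a"
| "val_size \<beta> (Pair v w) = 1 + val_size \<beta> v + val_size \<beta> w"

fun head :: "'a val \<Rightarrow> 'a val" where
  "head (Pair v w) = v"
| "head _ = Nil"

fun tail :: "'a val \<Rightarrow> 'a val" where
  "tail (Pair v w) = w"
| "tail _ = Nil"

fun num_of :: "'a::zero val \<Rightarrow> 'a" where
  "num_of (Num a) = a"
| "num_of _ = 0"

datatype arith = Plus | Minus | Times | Divide

fun arith_op :: "arith \<Rightarrow> 'a::linordered_field \<Rightarrow> 'a \<Rightarrow> 'a" where
  "arith_op Plus a b = a + b"
| "arith_op Minus a b = a - b"
| "arith_op Times a b = a * b"
| "arith_op Divide a b = a / b"

type_synonym var = nat
type_synonym 'a state = "var \<Rightarrow> 'a val"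

datatype test = IsNil var | IsPair var | Less var var

datatype com =
    SetNil var
  | SetInt var int
  | Copy var var
  | Cons var var var
  | Head var var
  | Tail var var
  | Arith arith var var var
  | Seq com com
  | If test com com
  | While test com

fun holds :: "test \<Rightarrow> 'a::linordered_field state \<Rightarrow> bool" where
  "holds (IsNil x) s \<longleftrightarrow> (case s x of Nil \<Rightarrow> True | _ \<Rightarrow> False)"
| "holds (IsPair x) s \<longleftrightarrow> (case s x of Pair _ _ \<Rightarrow> True | _ \<Rightarrow> False)"
| "holds (Less x y) s \<longleftrightarrow> num_of (s x) < num_of (s y)"

fun test_cost :: "('a::linordered_field \<Rightarrow> nat) \<Rightarrow> test \<Rightarrow> 'a state \<Rightarrow> nat" where
  "test_cost \<beta> (Less x y) s = 1 + \<beta> (num_of (s x)) + \<beta> (num_of (s y))"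
| "test_cost \<beta> _ s = 1"

text \<open>\<open>exec \<beta> C s t s'\<close>: program \<open>C\<close>, started in state \<open>s\<close>, halts in state \<open>s'\<close> after time \<open>t\<close>.\<close>

inductive exec :: "('a::linordered_field \<Rightarrow> nat) \<Rightarrow> com \<Rightarrow> 'a state \<Rightarrow> nat \<Rightarrow> 'a state \<Rightarrow> bool"
  for \<beta> :: "'a::linordered_field \<Rightarrow> nat" where
  exec_SetNil: "exec \<beta> (SetNil x) s 1 (s(x := Nil))"
| exec_SetInt: "exec \<beta> (SetInt x m) s 1 (s(x := Num (of_int m)))"
| exec_Copy: "exec \<beta> (Copy x y) s 1 (s(x := s y))"
| exec_Cons: "exec \<beta> (Cons x y z) s 1 (s(x := Pair (s y) (s z)))"
| exec_Head: "exec \<beta> (Head x y) s 1 (s(x := head (s y)))"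
| exec_Tail: "exec \<beta> (Tail x y) s 1 (s(x := tail (s y)))"
| exec_Arith: "exec \<beta> (Arith f x y z) s (1 + \<beta> (num_of (s y)) + \<beta> (num_of (s z)))
     (s(x := Num (arith_op f (num_of (s y)) (num_of (s z)))))"
| exec_Seq: "exec \<beta> C1 s t1 s' \<Longrightarrow> exec \<beta> C2 s' t2 s'' \<Longrightarrow> exec \<beta> (Seq C1 C2) s (t1 + t2) s''"
| exec_IfTrue: "holds b s \<Longrightarrow> exec \<beta> C1 s t s' \<Longrightarrow> exec \<beta> (If b C1 C2) s (test_cost \<beta> b s + t) s'"
| exec_IfFalse: "\<not> holds b s \<Longrightarrow> exec \<beta> C2 s t s' \<Longrightarrow>
     exec \<beta> (If b C1 C2) s (test_cost \<beta> b s + t) s'"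
| exec_WhileFalse: "\<not> holds b s \<Longrightarrow> exec \<beta> (While b C) s (test_cost \<beta> b s) s"
| exec_WhileTrue: "holds b s \<Longrightarrow> exec \<beta> C s t1 s' \<Longrightarrow> exec \<beta> (While b C) s' t2 s'' \<Longrightarrow>
     exec \<beta> (While b C) s (test_cost \<beta> b s + t1 + t2) s''"

inductive_cases exec_elims:
  "exec \<beta> (SetNil x) s t s'"
  "exec \<beta> (SetInt x m) s t s'"
  "exec \<beta> (Copy x y) s t s'"
  "exec \<beta> (Cons x y z) s t s'"
  "exec \<beta> (Head x y) s t s'"
  "exec \<beta> (Tail x y) s t s'"
  "exec \<beta> (Arith f x y z) s t s'"
  "exec \<beta> (Seq C1 C2) s t s'"
  "exec \<beta> (If b C1 C2) s t s'"
  "exec \<beta> (While b C) s t s'"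

lemma exec_deterministic:
  "exec \<beta> C s t s' \<Longrightarrow> exec \<beta> C s u s'' \<Longrightarrow> u = t \<and> s'' = s'"
proof (induction arbitrary: u s'' rule: exec.induct)
  case exec_Seq
  from exec_Seq.prems show ?case by cases (use exec_Seq.IH in blast)+
next
  case exec_IfTrue
  from exec_IfTrue.prems show ?case
    by cases (use exec_IfTrue.IH exec_IfTrue.hyps in blast)+
next
  case exec_IfFalse
  from exec_IfFalse.prems show ?case
    by cases (use exec_IfFalse.IH exec_IfFalse.hyps in blast)+
next
  case exec_WhileFalse
  from exec_WhileFalse.prems show ?case
    by cases (use exec_WhileFalse.hyps in blast)+
next
  case exec_WhileTrue
  from exec_WhileTrue.prems show ?case
    by cases (use exec_WhileTrue.IH exec_WhileTrue.hyps in blast)+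
qed (auto elim: exec_elims)

text \<open>The input is passed in variable 0, and the output is returned in variable 0.\<close>

definition initial :: "'a val \<Rightarrow> 'a state" where
  "initial v = (\<lambda>_. Nil)(0 := v)"

text \<open>
  A computational problem: the admissible inputs, their encoding as trees, and the relation
  between inputs and valid outputs. Nothing is required of an algorithm on other inputs.
\<close>

record ('a, 'b) problem =
  inputs :: "'b set"
  encode :: "'b \<Rightarrow> 'a val"
  valid_output :: "'b \<Rightarrow> 'a val \<Rightarrow> bool"

definition poly_time_algorithm ::
  "('a::linordered_field \<Rightarrow> nat) \<Rightarrow> ('a, 'b) problem \<Rightarrow> com \<Rightarrow> bool" where
  "poly_time_algorithm \<beta> X C \<longleftrightarrow>
     (\<exists>b :: nat poly. \<forall>x\<in>inputs X. \<exists>t s.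
        exec \<beta> C (initial (encode X x)) t s \<and>
        t \<le> poly b (val_size \<beta> (encode X x)) \<and>
        valid_output X x (s 0))"

definition poly_time_solvable :: "('a::linordered_field \<Rightarrow> nat) \<Rightarrow> ('a, 'b) problem \<Rightarrow> bool" where
  "poly_time_solvable \<beta> X \<longleftrightarrow> (\<exists>C. poly_time_algorithm \<beta> X C)"

definition rat_bits :: "rat \<Rightarrow> nat" where
  "rat_bits r = (case quotient_of r of (a, b) \<Rightarrow> nat (bitlen \<bar>a\<bar> + bitlen b))"

definition real_bits :: "real \<Rightarrow> nat" where
  "real_bits r = 0"


section \<open>The two computational problems\<close>

fun enc_list :: "('b \<Rightarrow> 'a val) \<Rightarrow> 'b list \<Rightarrow> 'a val" where
  "enc_list e [] = Nil"
| "enc_list e (x # xs) = Pair (e x) (enc_list e xs)"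

definition enc_vec :: "'a vec \<Rightarrow> 'a val" where
  "enc_vec v = enc_list Num (list_of_vec v)"

fun enc_entry :: "entry \<Rightarrow> 'a::zero_neq_one val" where
  "enc_entry Zero = Num 0"
| "enc_entry Star = Num 1"

definition enc_mat :: "entry mat \<Rightarrow> 'a::zero_neq_one val" where
  "enc_mat P = enc_list (enc_list enc_entry) (mat_to_list P)"

text \<open>
  Approximation of the interleaving distance. An input consists of two lists of upsets, each upset
  given by a list of generating points; \<open>\<iota>\<close> is the embedding of the numbers of the machine into
  the real numbers.
\<close>

definition distance_approximation ::
  "'k::field itself \<Rightarrow> nat \<Rightarrow> nat \<Rightarrow> ('a::linordered_field \<Rightarrow> real) \<Rightarrow>
   ('a, 'a vec list list \<times> 'a vec list list) problem" where
  "distance_approximation _ d c \<iota> =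
     (let module = (\<lambda>Us. upset_sum d (map (map (map_vec \<iota>)) Us) :: ('k, nat \<times> unit) pmod) in
      \<lparr>inputs = {(Us, Vs).
         (\<forall>U \<in> set Us \<union> set Vs. set U \<subseteq> carrier_vec d) \<and>
         \<not> isomorphic d (module Us) (module Vs) \<and>
         size (barcode d (module Us)) = size (barcode d (module Vs))},
       encode = (\<lambda>(Us, Vs). Pair (enc_list (enc_list enc_vec) Us) (enc_list (enc_list enc_vec) Vs)),
       valid_output = (\<lambda>(Us, Vs) v. \<exists>r. v = Num r \<and>
         interleaving_distance d (module Us) (module Vs) \<le> ereal (\<iota> r) \<and>
         ereal (\<iota> r) < ereal (real (c + 2)) * interleaving_distance d (module Us) (module Vs))\<rparr>)"

text \<open>Output 0 asserts that the given CI problem has no solution, and output 1 asserts that its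
  \<open>c\<close>-weakening has one. Both outputs can be valid.\<close>

definition weakening_decision ::
  "'k::field itself \<Rightarrow> nat \<Rightarrow> ('a::linordered_field, ci_problem) problem" where
  "weakening_decision K c =
     \<lparr>inputs = ci_problems,
      encode = (\<lambda>(P, Q). Pair (enc_mat P) (enc_mat Q)),
      valid_output = (\<lambda>C v.
        v = Num 0 \<and> \<not> ci_solvable K C \<or> v = Num 1 \<and> ci_solvable K (weakening c C))\<rparr>"

end

theory Submission
  imports Defs "Jordan_Normal_Form.Determinant"
begin

text \<open>
  Every linear map between upset modules of nonempty upsets that commutes with the structure maps is
  a scalar, because any two points of the poset have a common upper bound. Homomorphisms from a sum
  of \<open>n\<close> nonempty upset modules \<open>U\<^sub>i\<close> to a shifted sum of modules \<open>V\<^sub>j\<close> are therefore matrices,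
  where the entry at \<open>(j, i)\<close> can be nonzero iff the translate of \<open>U\<^sub>i\<close> by the shift is contained in
  \<open>V\<^sub>j\<close>. An \<open>\<epsilon>\<close>-interleaving is thus the same as a solution of a CI problem whose graph records
  the inclusions of \<open>\<epsilon>\<close>-translates (\<open>interleaved_iff_ci_solvable\<close>). A walk of length \<open>l\<close> in this
  graph is an inclusion of an \<open>l \<epsilon>\<close>-translate, so a solution of the \<open>c\<close>-weakening is a
  \<open>c \<epsilon>\<close>-interleaving (\<open>weakening_solvable_imp\<close>).

  Deciding CI problems suffices for approximating the distance. The inclusions change only at
  polynomially many thresholds \<open>\<epsilon>\<close>, and the distance \<open>\<delta>\<close> is one of them (\<open>optimal_threshold\<close>).
  The solver is asked about every threshold, and \<open>c\<close> times the least threshold \<open>x\<close> with a positive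
  answer is returned. A positive answer gives a \<open>c x\<close>-interleaving, so \<open>\<delta> \<le> c x\<close>; the answer at
  \<open>\<delta>\<close> itself is positive, so \<open>x \<le> \<delta>\<close>. As \<open>\<delta> > 0\<close>, the number \<open>c x\<close> is below \<open>(c + 2) \<delta>\<close>
  (\<open>distance_approximation_reduction\<close>). Here equality of the sizes of the barcodes has to be turned
  into equality of the numbers of nonempty upsets, which is the Krull--Remak--Schmidt theorem for
  these modules (\<open>size_barcode_usum\<close>).

  Conversely, the graph of a CI problem is embedded into the upsets of the plane. The upset of a
  vertex \<open>x\<close> has one corner for each vertex \<open>z\<close>, at a place on an antidiagonal that belongs to \<open>z\<close>,
  and this corner lies the higher the longer it takes to walk from \<open>z\<close> to \<open>x\<close>, up to the length
  \<open>c + 2\<close>. Places are far apart, so that corners of different places do not interfere. Then an edge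
  from \<open>x\<close> to \<open>y\<close> is an inclusion of a \<open>1\<close>-translate (\<open>edge_imp_inclusion\<close>), and an inclusion of an
  \<open>\<epsilon>\<close>-translate with \<open>\<epsilon> < c + 2\<close> yields a walk of length at most \<open>\<epsilon>\<close> (\<open>inclusion_imp_walk\<close>). If
  the two vertices lie on different sides of the bipartite graph, the length of the walk is odd,
  hence at most \<open>c\<close>. So the distance is at most \<open>1\<close> if the problem has a solution, and at least
  \<open>c + 2\<close> if the weakening has none; a number in \<open>[\<delta>, (c + 2) \<delta>)\<close> tells these cases apart by
  comparison with \<open>c + 2\<close> (\<open>weakening_decision_reduction\<close>).

  Both reductions are written in a small expression language over lists, in which the given
  algorithm can be called. The results of one round of its only loop are not available in the next
  round, so sizes cannot grow faster than polynomially, and every program of the language runs in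
  polynomial time (\<open>expr_runs_in_poly_time\<close>). It remains to bound the number returned by the given
  algorithm; its bit size is linear in the running time because arithmetic is charged by the size of
  the operands (\<open>exec_number_size\<close>). All this is done for an arbitrary ordered field of machine
  numbers embedded into the real numbers, with rational numbers under logarithmic cost and real
  numbers under unit cost as instances.
\<close>

section \<open>Polynomial bounds\<close>

definition poly_bound :: "(nat \<Rightarrow> nat) \<Rightarrow> bool" where
  "poly_bound f \<longleftrightarrow> (\<exists>p :: nat poly. f = poly p)"

lemma poly_bound_const [intro!]: "poly_bound (\<lambda>_. a)"
  unfolding poly_bound_def by (rule exI[of _ "[:a:]"]) (simp add: fun_eq_iff)

lemma poly_bound_id [intro!]: "poly_bound (\<lambda>n. n)"
  unfolding poly_bound_def by (rule exI[of _ "[:0, 1:]"]) (simp add: fun_eq_iff)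

lemma poly_bound_add [intro!]: "poly_bound f \<Longrightarrow> poly_bound g \<Longrightarrow> poly_bound (\<lambda>n. f n + g n)"
  unfolding poly_bound_def by (auto simp flip: poly_add)

lemma poly_bound_mult [intro!]: "poly_bound f \<Longrightarrow> poly_bound g \<Longrightarrow> poly_bound (\<lambda>n. f n * g n)"
  unfolding poly_bound_def by (auto simp flip: poly_mult)

lemma poly_bound_Suc [intro!]: "poly_bound f \<Longrightarrow> poly_bound (\<lambda>n. Suc (f n))"
  using poly_bound_add[OF poly_bound_const[of 1]] by simp

lemma poly_bound_comp [intro]: "poly_bound f \<Longrightarrow> poly_bound g \<Longrightarrow> poly_bound (\<lambda>n. f (g n))"
  unfolding poly_bound_def by (auto simp flip: poly_pcompose)

lemma poly_bound_mono: "poly_bound f \<Longrightarrow> m \<le> n \<Longrightarrow> f m \<le> f n"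
proof -
  have "poly p m \<le> poly p n" if "m \<le> n" for p :: "nat poly"
    by (induction p) (use that in \<open>auto intro: mult_mono\<close>)
  then show "poly_bound f \<Longrightarrow> m \<le> n \<Longrightarrow> f m \<le> f n"
    unfolding poly_bound_def by auto
qed

section \<open>Moving programs to fresh variables\<close>

fun shift_test :: "nat \<Rightarrow> test \<Rightarrow> test" where
  "shift_test k (IsNil x) = IsNil (x + k)"
| "shift_test k (IsPair x) = IsPair (x + k)"
| "shift_test k (Less x y) = Less (x + k) (y + k)"

fun shift_com :: "nat \<Rightarrow> com \<Rightarrow> com" where
  "shift_com k (SetNil x) = SetNil (x + k)"
| "shift_com k (SetInt x m) = SetInt (x + k) m"
| "shift_com k (Copy x y) = Copy (x + k) (y + k)"
| "shift_com k (Cons x y z) = Cons (x + k) (y + k) (z + k)"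
| "shift_com k (Head x y) = Head (x + k) (y + k)"
| "shift_com k (Tail x y) = Tail (x + k) (y + k)"
| "shift_com k (Arith f x y z) = Arith f (x + k) (y + k) (z + k)"
| "shift_com k (Seq C D) = Seq (shift_com k C) (shift_com k D)"
| "shift_com k (If b C D) = If (shift_test k b) (shift_com k C) (shift_com k D)"
| "shift_com k (While b C) = While (shift_test k b) (shift_com k C)"

fun test_vars :: "test \<Rightarrow> nat set" where
  "test_vars (IsNil x) = {x}"
| "test_vars (IsPair x) = {x}"
| "test_vars (Less x y) = {x, y}"

fun com_vars :: "com \<Rightarrow> nat set" where
  "com_vars (SetNil x) = {x}"
| "com_vars (SetInt x m) = {x}"
| "com_vars (Copy x y) = {x, y}"
| "com_vars (Cons x y z) = {x, y, z}"
| "com_vars (Head x y) = {x, y}"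
| "com_vars (Tail x y) = {x, y}"
| "com_vars (Arith f x y z) = {x, y, z}"
| "com_vars (Seq C D) = com_vars C \<union> com_vars D"
| "com_vars (If b C D) = test_vars b \<union> com_vars C \<union> com_vars D"
| "com_vars (While b C) = test_vars b \<union> com_vars C"

lemma finite_com_vars: "finite (com_vars C)"
proof -
  have "finite (test_vars b)" for b by (cases b) auto
  then show ?thesis by (induction C) auto
qed

lemma shift_test_cong:
  assumes "test_vars b \<subseteq> V" "\<forall>x\<in>V. r (x + k) = s x"
  shows "holds (shift_test k b) r = holds b s" "test_cost \<beta> (shift_test k b) r = test_cost \<beta> b s"
  using assms by (cases b; auto)+

text \<open>A given algorithm expects its input in variable 0 and may overwrite any variable. Adding \<open>k\<close> to
  its variables protects those of the calling program. Only agreement on the variables \<open>V\<close> of the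
  program can be required, since the calling program has used the others.\<close>

lemma exec_shift:
  "exec \<beta> C s t s' \<Longrightarrow> com_vars C \<subseteq> V \<Longrightarrow> \<forall>x\<in>V. r (x + k) = s x \<Longrightarrow>
    \<exists>r'. exec \<beta> (shift_com k C) r t r' \<and> (\<forall>x\<in>V. r' (x + k) = s' x) \<and> (\<forall>x<k. r' x = r x)"
proof (induction arbitrary: r rule: exec.induct)
  case (exec_SetNil x s)
  show ?case
    using exec.exec_SetNil[of \<beta> "x + k" r] exec_SetNil.prems
    by - (intro exI conjI ballI, simp, auto)
next
  case (exec_SetInt x m s)
  show ?case
    using exec.exec_SetInt[of \<beta> "x + k" m r] exec_SetInt.prems
    by - (intro exI conjI ballI, simp, auto)
next
  case (exec_Copy x y s)
  show ?case
    using exec.exec_Copy[of \<beta> "x + k" "y + k" r] exec_Copy.prems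
    by - (intro exI conjI ballI, simp, auto)
next
  case (exec_Cons x y z s)
  show ?case
    using exec.exec_Cons[of \<beta> "x + k" "y + k" "z + k" r] exec_Cons.prems
    by - (intro exI conjI ballI, simp, auto)
next
  case (exec_Head x y s)
  show ?case
    using exec.exec_Head[of \<beta> "x + k" "y + k" r] exec_Head.prems
    by - (intro exI conjI ballI, simp, auto)
next
  case (exec_Tail x y s)
  show ?case
    using exec.exec_Tail[of \<beta> "x + k" "y + k" r] exec_Tail.prems
    by - (intro exI conjI ballI, simp, auto)
next
  case (exec_Arith f x y z s)
  then have "r (y + k) = s y" "r (z + k) = s z" by auto
  then show ?case
    using exec.exec_Arith[of \<beta> f "x + k" "y + k" "z + k" r] exec_Arith.prems
    by - (intro exI conjI ballI, simp, auto)
next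
  case (exec_Seq C1 s t1 s' C2 t2 s'')
  obtain r' where r': "exec \<beta> (shift_com k C1) r t1 r'" "\<forall>x\<in>V. r' (x + k) = s' x" "\<forall>x<k. r' x = r x"
    using exec_Seq.IH(1)[of r] exec_Seq.prems by auto
  obtain r'' where r'': "exec \<beta> (shift_com k C2) r' t2 r''" "\<forall>x\<in>V. r'' (x + k) = s'' x" "\<forall>x<k. r'' x = r' x"
    using exec_Seq.IH(2)[of r'] exec_Seq.prems r'(2) by auto
  show ?case
    using exec.exec_Seq[OF r'(1) r''(1)] r'(3) r''(2,3) by (intro exI[of _ r'']) simp
next
  case (exec_IfTrue b s C1 t s' C2)
  note b = shift_test_cong[of b V r k s]
  obtain r' where "exec \<beta> (shift_com k C1) r t r'" "\<forall>x\<in>V. r' (x + k) = s' x" "\<forall>x<k. r' x = r x"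
    using exec_IfTrue.IH[of r] exec_IfTrue.prems by auto
  then show ?case
    using exec.exec_IfTrue[of "shift_test k b" r \<beta> "shift_com k C1" t r' "shift_com k C2"]
      exec_IfTrue.hyps(1) exec_IfTrue.prems b(1) b(2)[of \<beta>] by auto
next
  case (exec_IfFalse b s C2 t s' C1)
  note b = shift_test_cong[of b V r k s]
  obtain r' where "exec \<beta> (shift_com k C2) r t r'" "\<forall>x\<in>V. r' (x + k) = s' x" "\<forall>x<k. r' x = r x"
    using exec_IfFalse.IH[of r] exec_IfFalse.prems by auto
  then show ?case
    using exec.exec_IfFalse[of "shift_test k b" r \<beta> "shift_com k C2" t r' "shift_com k C1"]
      exec_IfFalse.hyps(1) exec_IfFalse.prems b(1) b(2)[of \<beta>] by auto
next
  case (exec_WhileFalse b s C)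
  note b = shift_test_cong[of b V r k s]
  have "exec \<beta> (shift_com k (While b C)) r (test_cost \<beta> b s) r"
    using exec.exec_WhileFalse[of "shift_test k b" r \<beta> "shift_com k C"]
      exec_WhileFalse.hyps(1) exec_WhileFalse.prems b(1) b(2)[of \<beta>] by simp
  then show ?case using exec_WhileFalse.prems by blast
next
  case (exec_WhileTrue b s C t1 s' t2 s'')
  note b = shift_test_cong[of b V r k s]
  obtain r' where r': "exec \<beta> (shift_com k C) r t1 r'" "\<forall>x\<in>V. r' (x + k) = s' x" "\<forall>x<k. r' x = r x"
    using exec_WhileTrue.IH(1)[of r] exec_WhileTrue.prems by auto
  obtain r'' where r'': "exec \<beta> (shift_com k (While b C)) r' t2 r''" "\<forall>x\<in>V. r'' (x + k) = s'' x"
    "\<forall>x<k. r'' x = r' x"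
    using exec_WhileTrue.IH(2)[of r'] exec_WhileTrue.prems r'(2) by auto
  have "exec \<beta> (shift_com k (While b C)) r (test_cost \<beta> b s + t1 + t2) r''"
    using exec.exec_WhileTrue[OF _ r'(1), of "shift_test k b" t2 r''] r''(1)
      exec_WhileTrue.hyps(1) exec_WhileTrue.prems b(1) b(2)[of \<beta>] by simp
  then show ?case using r'(3) r''(2,3) by auto
qed

fun clear :: "nat \<Rightarrow> nat \<Rightarrow> com" where
  "clear k 0 = SetNil (Suc k)"
| "clear k (Suc m) = Seq (SetNil (Suc (Suc m) + k)) (clear k m)"

lemma exec_clear:
  "exec \<beta> (clear k m) s (Suc m) (\<lambda>x. if k < x \<and> x \<le> Suc m + k then Nil else s x)"
proof (induction m arbitrary: s)
  case 0
  have "(\<lambda>x. if k < x \<and> x \<le> Suc 0 + k then Nil else s x) = s(Suc k := Nil)"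
    by (auto simp: fun_eq_iff)
  then show ?case using exec_SetNil[of \<beta> "Suc k" s] by simp
next
  case (Suc m)
  have "(\<lambda>x. if k < x \<and> x \<le> Suc m + k then Nil else (s(Suc (Suc m) + k := Nil)) x) =
      (\<lambda>x. if k < x \<and> x \<le> Suc (Suc m) + k then Nil else s x)"
    by (auto simp: fun_eq_iff)
  then show ?case
    using exec_Seq[OF exec_SetNil[of \<beta> "Suc (Suc m) + k" s] Suc[of "s(Suc (Suc m) + k := Nil)"]]
    by simp
qed

text \<open>Variable \<open>k\<close> holds the argument and afterwards the result. The other variables of the moved
  program may contain values left over from earlier calls, whereas the program expects \<open>nil\<close>.\<close>

definition subroutine :: "com \<Rightarrow> nat \<Rightarrow> com" where
  "subroutine C k = Seq (clear k (Max (com_vars C \<union> {0}))) (shift_com k C)"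

lemma exec_subroutine:
  assumes "exec \<beta> C (initial (s k)) t s'"
  shows "\<exists>s''. exec \<beta> (subroutine C k) s (Suc (Max (com_vars C \<union> {0})) + t) s'' \<and>
    s'' k = s' 0 \<and> (\<forall>x<k. s'' x = s x)"
proof -
  define m where "m = Max (com_vars C \<union> {0})"
  define r where "r = (\<lambda>x. if k < x \<and> x \<le> Suc m + k then Nil else s x)"
  have "x \<le> m" if "x \<in> com_vars C" for x
    unfolding m_def using that by (intro Max_ge) (auto intro: finite_com_vars)
  then have "\<forall>x\<in>insert 0 (com_vars C). r (x + k) = initial (s k) x"
    by (force simp: r_def initial_def)
  with exec_shift[OF assms, of "insert 0 (com_vars C)" r k] obtain r' where r':
    "exec \<beta> (shift_com k C) r t r'" "r' (0 + k) = s' 0" "\<forall>x<k. r' x = r x" by auto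
  from exec_Seq[OF exec_clear[of \<beta> k m s, folded r_def] r'(1)]
  have "exec \<beta> (subroutine C k) s (Suc m + t) r'" unfolding subroutine_def m_def .
  then show ?thesis using r'(2,3) unfolding m_def[symmetric] by (auto simp: r_def)
qed

section \<open>A list language and its compiler\<close>

text \<open>Variables are names, which the compiler maps to machine variables. \<open>EGather x l e\<close> concatenates
  the lists \<open>e\<close> over all entries of the list \<open>l\<close>. Here \<open>x\<close> is bound to the part of \<open>l\<close> that starts
  with the current entry: its head is the entry, and its length identifies the position. No loop
  passes an accumulator to the next round, which keeps all sizes polynomial. \<open>ECall\<close> calls the
  algorithm that is given in a reduction.\<close>

datatype expr =
    EVar nat | ENil | EInt int | ECons expr expr | EHead expr | ETail expr
  | EArith arith expr expr
  | EIfLess expr expr expr expr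
  | EIfPair expr expr expr
  | ELet nat expr expr
  | ELen expr
  | EGather nat expr expr
  | ECall expr

fun suffixes :: "'a val \<Rightarrow> 'a val list" where
  "suffixes (Pair v w) = Pair v w # suffixes w"
| "suffixes _ = []"

fun elems :: "'a val \<Rightarrow> 'a val list" where
  "elems (Pair v w) = v # elems w"
| "elems _ = []"

definition gather :: "('a val \<Rightarrow> 'a val list) \<Rightarrow> 'a val \<Rightarrow> 'a val" where
  "gather f v = enc_list (\<lambda>x. x) (concat (map f (suffixes v)))"

text \<open>\<open>G\<close> is the input-output function of the given algorithm.\<close>

fun eval :: "('a::linordered_field val \<Rightarrow> 'a val) \<Rightarrow> (nat \<Rightarrow> 'a val) \<Rightarrow> expr \<Rightarrow> 'a val" where
  "eval G \<eta> (EVar x) = \<eta> x"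
| "eval G \<eta> ENil = Nil"
| "eval G \<eta> (EInt m) = Num (of_int m)"
| "eval G \<eta> (ECons a b) = Pair (eval G \<eta> a) (eval G \<eta> b)"
| "eval G \<eta> (EHead a) = head (eval G \<eta> a)"
| "eval G \<eta> (ETail a) = tail (eval G \<eta> a)"
| "eval G \<eta> (EArith f a b) = Num (arith_op f (num_of (eval G \<eta> a)) (num_of (eval G \<eta> b)))"
| "eval G \<eta> (EIfLess a b e e') =
     (if num_of (eval G \<eta> a) < num_of (eval G \<eta> b) then eval G \<eta> e else eval G \<eta> e')"
| "eval G \<eta> (EIfPair a e e') =
     (case eval G \<eta> a of Pair _ _ \<Rightarrow> eval G \<eta> e | _ \<Rightarrow> eval G \<eta> e')"
| "eval G \<eta> (ELet x a e) = eval G (\<eta>(x := eval G \<eta> a)) e"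
| "eval G \<eta> (ELen a) = Num (of_nat (length (elems (eval G \<eta> a))))"
| "eval G \<eta> (EGather x a e) = gather (\<lambda>v. elems (eval G (\<eta>(x := v)) e)) (eval G \<eta> a)"
| "eval G \<eta> (ECall a) = G (eval G \<eta> a)"

text \<open>Nothing is known about the given algorithm outside a set \<open>D\<close> of encodings of admissible inputs,
  where it may not even halt.\<close>

fun safe :: "('a::linordered_field val \<Rightarrow> 'a val) \<Rightarrow> 'a val set \<Rightarrow> (nat \<Rightarrow> 'a val) \<Rightarrow> expr \<Rightarrow> bool" where
  "safe G D \<eta> (EVar x) \<longleftrightarrow> True"
| "safe G D \<eta> ENil \<longleftrightarrow> True"
| "safe G D \<eta> (EInt m) \<longleftrightarrow> True"
| "safe G D \<eta> (ECons a b) \<longleftrightarrow> safe G D \<eta> a \<and> safe G D \<eta> b"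
| "safe G D \<eta> (EHead a) \<longleftrightarrow> safe G D \<eta> a"
| "safe G D \<eta> (ETail a) \<longleftrightarrow> safe G D \<eta> a"
| "safe G D \<eta> (EArith f a b) \<longleftrightarrow> safe G D \<eta> a \<and> safe G D \<eta> b"
| "safe G D \<eta> (EIfLess a b e e') \<longleftrightarrow> safe G D \<eta> a \<and> safe G D \<eta> b \<and>
     (if num_of (eval G \<eta> a) < num_of (eval G \<eta> b) then safe G D \<eta> e else safe G D \<eta> e')"
| "safe G D \<eta> (EIfPair a e e') \<longleftrightarrow> safe G D \<eta> a \<and>
     (case eval G \<eta> a of Pair _ _ \<Rightarrow> safe G D \<eta> e | _ \<Rightarrow> safe G D \<eta> e')"
| "safe G D \<eta> (ELet x a e) \<longleftrightarrow> safe G D \<eta> a \<and> safe G D (\<eta>(x := eval G \<eta> a)) e"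
| "safe G D \<eta> (ELen a) \<longleftrightarrow> safe G D \<eta> a"
| "safe G D \<eta> (EGather x a e) \<longleftrightarrow> safe G D \<eta> a \<and>
     (\<forall>v\<in>set (suffixes (eval G \<eta> a)). safe G D (\<eta>(x := v)) e)"
| "safe G D \<eta> (ECall a) \<longleftrightarrow> safe G D \<eta> a \<and> eval G \<eta> a \<in> D"

text \<open>The entries are moved one at a time, so the list arrives in reverse order.\<close>

definition push :: "nat \<Rightarrow> nat \<Rightarrow> nat \<Rightarrow> com" where
  "push a r h = While (IsPair r) (Seq (Seq (Head h r) (Cons a h a)) (Tail r r))"

text \<open>The value is left in variable \<open>k\<close>; variables below \<open>k\<close> keep their values, and those above \<open>k\<close>
  are scratch space. In the loop of \<open>EGather\<close>, variable \<open>k\<close> holds the rest of the list and thereby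
  also the value of the bound name. The results are collected in reverse order in \<open>k + 1\<close> and
  finally pushed back to \<open>k\<close>.\<close>

fun compile :: "com \<Rightarrow> (nat \<Rightarrow> nat) \<Rightarrow> nat \<Rightarrow> expr \<Rightarrow> com" where
  "compile C \<rho> k (EVar x) = Copy k (\<rho> x)"
| "compile C \<rho> k ENil = SetNil k"
| "compile C \<rho> k (EInt m) = SetInt k m"
| "compile C \<rho> k (ECons a b) =
     Seq (compile C \<rho> k a) (Seq (compile C \<rho> (k + 1) b) (Cons k k (k + 1)))"
| "compile C \<rho> k (EHead a) = Seq (compile C \<rho> k a) (Head k k)"
| "compile C \<rho> k (ETail a) = Seq (compile C \<rho> k a) (Tail k k)"
| "compile C \<rho> k (EArith f a b) =
     Seq (compile C \<rho> k a) (Seq (compile C \<rho> (k + 1) b) (Arith f k k (k + 1)))"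
| "compile C \<rho> k (EIfLess a b e e') =
     Seq (compile C \<rho> k a) (Seq (compile C \<rho> (k + 1) b)
       (If (Less k (k + 1)) (compile C \<rho> k e) (compile C \<rho> k e')))"
| "compile C \<rho> k (EIfPair a e e') =
     Seq (compile C \<rho> k a) (If (IsPair k) (compile C \<rho> k e) (compile C \<rho> k e'))"
| "compile C \<rho> k (ELet x a e) =
     Seq (compile C \<rho> k a) (Seq (compile C (\<rho>(x := k)) (k + 1) e) (Copy k (k + 1)))"
| "compile C \<rho> k (ELen a) =
     Seq (compile C \<rho> (k + 1) a) (Seq (SetInt k 0) (Seq (SetInt (k + 2) 1)
       (While (IsPair (k + 1)) (Seq (Arith Plus k k (k + 2)) (Tail (k + 1) (k + 1))))))"
| "compile C \<rho> k (EGather x a e) =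
     Seq (compile C \<rho> k a) (Seq (SetNil (k + 1))
       (Seq (While (IsPair k)
               (Seq (Seq (compile C (\<rho>(x := k)) (k + 2) e) (push (k + 1) (k + 2) (k + 3))) (Tail k k)))
            (Seq (SetNil k) (push k (k + 1) (k + 2)))))"
| "compile C \<rho> k (ECall a) = Seq (compile C \<rho> k a) (subroutine C k)"

section \<open>Polynomial running time of compiled programs\<close>

lemma val_size_pos: "1 \<le> val_size \<beta> v"
  by (cases v) auto

lemma val_size_elems: "1 + (\<Sum>x\<leftarrow>elems v. 1 + val_size \<beta> x) \<le> val_size \<beta> v"
  by (induction v rule: elems.induct) (auto simp: val_size_pos[simplified])

lemma length_elems: "length (elems v) \<le> val_size \<beta> v"
  by (induction v rule: elems.induct) auto

lemma length_suffixes: "length (suffixes v) \<le> val_size \<beta> v"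
  by (induction v rule: suffixes.induct) auto

lemma val_size_suffix: "u \<in> set (suffixes v) \<Longrightarrow> val_size \<beta> u \<le> val_size \<beta> v"
  by (induction v rule: suffixes.induct) auto

lemma val_size_head: "val_size \<beta> (head v) \<le> val_size \<beta> v"
  by (cases v) auto

lemma val_size_tail: "val_size \<beta> (tail v) \<le> val_size \<beta> v"
  by (cases v) auto

lemma elems_enc_list [simp]: "elems (enc_list e xs) = map e xs"
  by (induction xs) auto

lemma val_size_enc_list: "val_size \<beta> (enc_list (\<lambda>x. x) xs) = 1 + (\<Sum>x\<leftarrow>xs. 1 + val_size \<beta> x)"
  by (induction xs) auto

text \<open>The entries of a list are disjoint parts of it, so their sizes add up to at most the size of the list.\<close>

lemma val_size_gather:
  assumes "\<And>u. u \<in> set (suffixes v) \<Longrightarrow> val_size \<beta> (f u) \<le> M"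
  shows "val_size \<beta> (gather (\<lambda>u. elems (f u)) v) \<le> 1 + val_size \<beta> v * M"
proof -
  have "(\<Sum>x\<leftarrow>concat (map (\<lambda>u. elems (f u)) us). 1 + val_size \<beta> x) \<le> length us * M"
    if "\<And>u. u \<in> set us \<Longrightarrow> val_size \<beta> (f u) \<le> M" for us
    using that
  proof (induction us)
    case (Cons u us)
    have "(\<Sum>x\<leftarrow>elems (f u). 1 + val_size \<beta> x) \<le> M"
      using val_size_elems[of \<beta> "f u"] Cons.prems[of u] by simp
    moreover have "(\<Sum>x\<leftarrow>concat (map (\<lambda>u. elems (f u)) us). 1 + val_size \<beta> x) \<le> length us * M"
      using Cons by simp
    ultimately show ?case by simp
  qed simp
  from this[of "suffixes v"] assms
  have "val_size \<beta> (gather (\<lambda>u. elems (f u)) v) \<le> 1 + length (suffixes v) * M"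
    unfolding gather_def val_size_enc_list by simp
  also have "\<dots> \<le> 1 + val_size \<beta> v * M"
    using length_suffixes[of v \<beta>] by simp
  finally show ?thesis .
qed

lemma fold_Pair: "fold Pair xs (enc_list (\<lambda>x. x) ys) = enc_list (\<lambda>x. x) (rev xs @ ys)"
proof (induction xs arbitrary: ys)
  case (Cons x xs)
  then show ?case using Cons[of "x # ys"] by simp
qed simp

lemma exec_push:
  assumes "a \<noteq> r" "h \<noteq> a" "h \<noteq> r" "s r = v"
  shows "\<exists>s'. exec \<beta> (push a r h) s (1 + 4 * length (elems v)) s' \<and>
    s' a = fold Pair (elems v) (s a) \<and> (\<forall>x. x \<noteq> a \<longrightarrow> x \<noteq> r \<longrightarrow> x \<noteq> h \<longrightarrow> s' x = s x)"
  using assms(4)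
proof (induction v arbitrary: s)
  case Nil
  then have "\<not> holds (IsPair r) s" by simp
  from exec_WhileFalse[OF this] show ?case unfolding push_def by fastforce
next
  case (Num n)
  then have "\<not> holds (IsPair r) s" by simp
  from exec_WhileFalse[OF this] show ?case unfolding push_def by fastforce
next
  case (Pair v w)
  define s1 where "s1 = s(h := v)"
  define s2 where "s2 = s1(a := Pair (s1 h) (s1 a))"
  define s3 where "s3 = s2(r := w)"
  have "exec \<beta> (Head h r) s 1 s1" "exec \<beta> (Cons a h a) s1 1 s2" "exec \<beta> (Tail r r) s2 1 s3"
    using exec_Head[of \<beta> h r s] exec_Cons[of \<beta> a h a s1] exec_Tail[of \<beta> r r s2] Pair.prems assms(1-3)
    by (simp_all add: s1_def s2_def s3_def)
  then have B: "exec \<beta> (Seq (Seq (Head h r) (Cons a h a)) (Tail r r)) s (1 + 1 + 1) s3"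
    by (blast intro: exec_Seq)
  have "s3 r = w" by (simp add: s3_def)
  then obtain s' where s': "exec \<beta> (push a r h) s3 (1 + 4 * length (elems w)) s'"
    "s' a = fold Pair (elems w) (s3 a)" "\<forall>x. x \<noteq> a \<longrightarrow> x \<noteq> r \<longrightarrow> x \<noteq> h \<longrightarrow> s' x = s3 x"
    using Pair.IH(2)[of s3] by blast
  have b: "holds (IsPair r) s" using Pair.prems by simp
  have "exec \<beta> (push a r h) s (1 + (1 + 1 + 1) + (1 + 4 * length (elems w))) s'"
    using exec_WhileTrue[OF b B s'(1)[unfolded push_def]] unfolding push_def by simp
  then have "exec \<beta> (push a r h) s (1 + 4 * length (elems (Pair v w))) s'" by (simp add: numeral_eq_Suc)
  moreover have "s3 a = Pair v (s a)" "\<forall>x. x \<noteq> a \<longrightarrow> x \<noteq> r \<longrightarrow> x \<noteq> h \<longrightarrow> s3 x = s x"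
    using assms by (auto simp: s3_def s2_def s1_def)
  ultimately show ?case using s'(2,3) by (intro exI[of _ s']) auto
qed

text \<open>The invariant is that pushing all results still to come onto the accumulator \<open>k + 1\<close> gives its
  final value; it is the statement itself, for an arbitrary rest \<open>v\<close> of the list.\<close>

lemma exec_gather_loop:
  assumes body: "\<And>u st. u \<in> set (suffixes v) \<Longrightarrow> st k = u \<Longrightarrow> \<forall>x<k. st x = s x \<Longrightarrow>
      \<exists>t st'. exec \<beta> E st t st' \<and> t \<le> T \<and> elems (st' (k + 2)) = F u \<and> (\<forall>x<k + 2. st' x = st x)"
    and len: "\<And>u. u \<in> set (suffixes v) \<Longrightarrow> length (F u) \<le> M"
    and "st k = v" "\<forall>x<k. st x = s x"
  shows "\<exists>t st'. exec \<beta> (While (IsPair k) (Seq (Seq E (push (k + 1) (k + 2) (k + 3))) (Tail k k))) st t st' \<and>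
    t \<le> (T + 4 * M + 3) * length (suffixes v) + 1 \<and>
    st' (k + 1) = fold Pair (concat (map F (suffixes v))) (st (k + 1)) \<and> (\<forall>x<k. st' x = s x)"
  using assms
proof (induction v arbitrary: st)
  case Nil
  then have "\<not> holds (IsPair k) st" by simp
  from exec_WhileFalse[OF this] show ?case using Nil by fastforce
next
  case (Num n)
  then have "\<not> holds (IsPair k) st" by simp
  from exec_WhileFalse[OF this] show ?case using Num by fastforce
next
  case (Pair v w)
  let ?W = "While (IsPair k) (Seq (Seq E (push (k + 1) (k + 2) (k + 3))) (Tail k k))"
  obtain t1 s1 where s1: "exec \<beta> E st t1 s1" "t1 \<le> T" "elems (s1 (k + 2)) = F (Pair v w)"
      "\<forall>x<k + 2. s1 x = st x"
    using Pair.prems(1)[of "Pair v w" st] Pair.prems(3,4) by auto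
  obtain s2 where s2: "exec \<beta> (push (k + 1) (k + 2) (k + 3)) s1 (1 + 4 * length (F (Pair v w))) s2"
    "s2 (k + 1) = fold Pair (F (Pair v w)) (s1 (k + 1))"
    "\<forall>x. x \<noteq> k + 1 \<longrightarrow> x \<noteq> k + 2 \<longrightarrow> x \<noteq> k + 3 \<longrightarrow> s2 x = s1 x"
    using exec_push[of "k + 1" "k + 2" "k + 3" s1 _ \<beta>, OF _ _ _ refl] s1(3) by auto
  define s3 where "s3 = s2(k := w)"
  have "s2 k = Pair v w" using s2(3) s1(4) Pair.prems(3) by simp
  then have s3: "exec \<beta> (Tail k k) s2 1 s3"
    using exec_Tail[of \<beta> k k s2] by (simp add: s3_def)
  have s3s: "s3 k = w" "\<forall>x<k. s3 x = s x" "s3 (k + 1) = fold Pair (F (Pair v w)) (st (k + 1))"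
    using s2(2,3) s1(4) Pair.prems(4) by (auto simp: s3_def)
  have "\<exists>t st'. exec \<beta> ?W s3 t st' \<and> t \<le> (T + 4 * M + 3) * length (suffixes w) + 1 \<and>
      st' (k + 1) = fold Pair (concat (map F (suffixes w))) (s3 (k + 1)) \<and> (\<forall>x<k. st' x = s x)"
    by (rule Pair.IH(2)) (use Pair.prems(1,2) s3s in auto)
  then obtain t4 s4 where s4: "exec \<beta> ?W s3 t4 s4" "t4 \<le> (T + 4 * M + 3) * length (suffixes w) + 1"
      "s4 (k + 1) = fold Pair (concat (map F (suffixes w))) (s3 (k + 1))" "\<forall>x<k. s4 x = s x"
    by blast
  have b: "holds (IsPair k) st" using Pair.prems(3) by simp
  have B: "exec \<beta> (Seq (Seq E (push (k + 1) (k + 2) (k + 3))) (Tail k k)) st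
      ((t1 + (1 + 4 * length (F (Pair v w)))) + 1) s3"
    by (intro exec_Seq) (rule s1(1) s2(1) s3)+
  have "exec \<beta> ?W st (1 + ((t1 + (1 + 4 * length (F (Pair v w)))) + 1) + t4) s4"
    using exec_WhileTrue[OF b B s4(1)] by simp
  moreover have "length (F (Pair v w)) \<le> M" using Pair.prems(2) by simp
  then have "1 + ((t1 + (1 + 4 * length (F (Pair v w)))) + 1) + t4
      \<le> (T + 4 * M + 3) * length (suffixes (Pair v w)) + 1"
    using s1(2) s4(2) by simp
  ultimately show ?case using s4(3,4) s3s(3) by (intro exI[of _ s4] exI) auto
qed

lemma exec_len_loop:
  assumes "st (k + 1) = v" "st (k + 2) = Num 1" "st k = Num (of_nat n)"
    "\<And>m. \<beta> (of_nat m :: 'a::linordered_field) \<le> m + 1"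
  shows "\<exists>t st'. exec \<beta> (While (IsPair (k + 1)) (Seq (Arith Plus k k (k + 2)) (Tail (k + 1) (k + 1))))
      (st :: 'a state) t st' \<and> t \<le> (n + length (elems v) + 6) * length (elems v) + 1 \<and>
    st' k = Num (of_nat (n + length (elems v))) \<and> (\<forall>x<k. st' x = st x)"
  using assms(1-3)
proof (induction v arbitrary: st n)
  case Nil
  then have "\<not> holds (IsPair (k + 1)) st" by simp
  from exec_WhileFalse[OF this] show ?case using Nil by fastforce
next
  case (Num m)
  then have "\<not> holds (IsPair (k + 1)) st" by simp
  from exec_WhileFalse[OF this] show ?case using Num by fastforce
next
  case (Pair v w)
  let ?W = "While (IsPair (k + 1)) (Seq (Arith Plus k k (k + 2)) (Tail (k + 1) (k + 1)))"
  let ?t = "1 + \<beta> (of_nat n) + \<beta> 1"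
  define s1 where "s1 = st(k := Num (of_nat (Suc n)))"
  define s2 where "s2 = s1(k + 1 := w)"
  have "exec \<beta> (Arith Plus k k (k + 2)) st ?t s1"
    using exec_Arith[of \<beta> Plus k k "k + 2" st] Pair.prems by (simp add: s1_def add.commute)
  moreover have "exec \<beta> (Tail (k + 1) (k + 1)) s1 1 s2"
    using exec_Tail[of \<beta> "k + 1" "k + 1" s1] Pair.prems by (simp add: s1_def s2_def)
  ultimately have B: "exec \<beta> (Seq (Arith Plus k k (k + 2)) (Tail (k + 1) (k + 1))) st (?t + 1) s2"
    by (rule exec_Seq)
  have s2: "s2 (k + 1) = w" "s2 (k + 2) = Num 1" "s2 k = Num (of_nat (Suc n))"
    using Pair.prems(2) by (simp_all add: s1_def s2_def)
  obtain t3 s3 where s3: "exec \<beta> ?W s2 t3 s3"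
      "t3 \<le> (Suc n + length (elems w) + 6) * length (elems w) + 1"
      "s3 k = Num (of_nat (Suc n + length (elems w)))" "\<forall>x<k. s3 x = s2 x"
    using Pair.IH(2)[of s2 "Suc n"] s2 by blast
  have b: "holds (IsPair (k + 1)) st" using Pair.prems by simp
  have "exec \<beta> ?W st (1 + (?t + 1) + t3) s3"
    using exec_WhileTrue[OF b B s3(1)] by simp
  moreover have "1 + (?t + 1) + t3 \<le> (n + length (elems (Pair v w)) + 6) * length (elems (Pair v w)) + 1"
    using s3(2) assms(4)[of n] assms(4)[of 1] by (simp add: algebra_simps)
  ultimately show ?case
    using s3(3,4) by (intro exI[of _ s3] exI) (auto simp: s1_def s2_def)
qed

text \<open>A sum of fractions contains each denominator twice, whence the factor 2.\<close>

locale bit_size =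
  fixes \<beta> :: "'a::linordered_field \<Rightarrow> nat"
  assumes bits_arith: "\<beta> (arith_op f a b) \<le> 2 * (\<beta> a + \<beta> b) + 2"
    and bits_of_nat: "\<beta> (of_nat n) \<le> n + 1"
begin

lemma bits_num_of: "\<beta> (num_of v) \<le> val_size \<beta> v"
  using bits_of_nat[of 0] by (cases v) auto

text \<open>The variables of the machine realise the environment \<open>\<eta>\<close> below \<open>k\<close>, and \<open>N\<close> bounds all values.\<close>

definition fits :: "(nat \<Rightarrow> 'a val) \<Rightarrow> nat \<Rightarrow> (nat \<Rightarrow> nat) \<Rightarrow> nat \<Rightarrow> 'a state \<Rightarrow> bool" where
  "fits \<eta> N \<rho> k s \<longleftrightarrow> (\<forall>y. \<rho> y < k \<and> s (\<rho> y) = \<eta> y \<and> val_size \<beta> (\<eta> y) \<le> N)"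

definition evaluates ::
  "('a val \<Rightarrow> 'a val) \<Rightarrow> com \<Rightarrow> expr \<Rightarrow> (nat \<Rightarrow> 'a val) \<Rightarrow> (nat \<Rightarrow> nat) \<Rightarrow> nat \<Rightarrow> 'a state \<Rightarrow> nat \<Rightarrow> bool" where
  "evaluates G C e \<eta> \<rho> k s T \<longleftrightarrow>
     (\<exists>t s'. exec \<beta> (compile C \<rho> k e) s t s' \<and> t \<le> T \<and> s' k = eval G \<eta> e \<and> (\<forall>x<k. s' x = s x))"

definition runs_within ::
  "('a val \<Rightarrow> 'a val) \<Rightarrow> 'a val set \<Rightarrow> com \<Rightarrow> expr \<Rightarrow> (nat \<Rightarrow> nat) \<Rightarrow> bool" where
  "runs_within G D C e f \<longleftrightarrow> (\<forall>\<eta> N \<rho> k s. fits \<eta> N \<rho> k s \<longrightarrow> safe G D \<eta> e \<longrightarrow>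
     val_size \<beta> (eval G \<eta> e) \<le> f N \<and> evaluates G C e \<eta> \<rho> k s (f N))"

lemma fits_weaken: "fits \<eta> N \<rho> k s \<Longrightarrow> k \<le> k' \<Longrightarrow> \<forall>x<k. s' x = s x \<Longrightarrow> fits \<eta> N \<rho> k' s'"
  unfolding fits_def by (metis order_less_le_trans)

text \<open>Binding a name to the value in variable \<open>k\<close> only requires that the scratch space now starts above \<open>k\<close>.\<close>

lemma fits_bind:
  assumes "fits \<eta> N \<rho> k s" "k < k'" "\<forall>x<k. s' x = s x" "s' k = v" "val_size \<beta> v \<le> M" "N \<le> M"
  shows "fits (\<eta>(x := v)) M (\<rho>(x := k)) k' s'"
  unfolding fits_def
proof
  fix y
  show "(\<rho>(x := k)) y < k' \<and> s' ((\<rho>(x := k)) y) = (\<eta>(x := v)) y \<and> val_size \<beta> ((\<eta>(x := v)) y) \<le> M"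
    using assms(1)[unfolded fits_def, rule_format, of y] assms(2-6) by auto
qed

lemma runs_withinD:
  assumes "runs_within G D C e f" "fits \<eta> N \<rho> k s" "safe G D \<eta> e"
  shows "val_size \<beta> (eval G \<eta> e) \<le> f N" "evaluates G C e \<eta> \<rho> k s (f N)"
  using assms unfolding runs_within_def by blast+

lemma evaluatesE:
  assumes "evaluates G C e \<eta> \<rho> k s T"
  obtains t s' where "exec \<beta> (compile C \<rho> k e) s t s'" "t \<le> T" "s' k = eval G \<eta> e" "\<forall>x<k. s' x = s x"
  using assms unfolding evaluates_def by blast

lemma evaluatesI:
  assumes "exec \<beta> (compile C \<rho> k e) s t s'" "t \<le> T" "s' k = eval G \<eta> e" "\<And>x. x < k \<Longrightarrow> s' x = s x"
  shows "evaluates G C e \<eta> \<rho> k s T"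
  using assms unfolding evaluates_def by blast

lemma runs_withinI:
  assumes "\<And>\<eta> N \<rho> k s. fits \<eta> N \<rho> k s \<Longrightarrow> safe G D \<eta> e \<Longrightarrow> val_size \<beta> (eval G \<eta> e) \<le> f N"
    and "\<And>\<eta> N \<rho> k s. fits \<eta> N \<rho> k s \<Longrightarrow> safe G D \<eta> e \<Longrightarrow> evaluates G C e \<eta> \<rho> k s (f N)"
  shows "runs_within G D C e f"
  using assms unfolding runs_within_def by blast

lemma runs_EVar: "runs_within G D C (EVar x) (\<lambda>N. N + 1)"
proof (rule runs_withinI)
  fix \<eta> N \<rho> k s assume f: "fits \<eta> N \<rho> k s"
  then show "val_size \<beta> (eval G \<eta> (EVar x)) \<le> N + 1" by (simp add: fits_def le_SucI)
  show "evaluates G C (EVar x) \<eta> \<rho> k s (N + 1)"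
    by (rule evaluatesI, unfold compile.simps, rule exec_Copy)
      (use f in \<open>auto simp: fits_def\<close>)
qed

lemma runs_ENil: "runs_within G D C ENil (\<lambda>N. 1)"
proof (rule runs_withinI)
  fix \<eta> N \<rho> k s assume f: "fits \<eta> N \<rho> k s"
  show "evaluates G C ENil \<eta> \<rho> k s 1"
    by (rule evaluatesI, unfold compile.simps, rule exec_SetNil) simp_all
qed simp

lemma runs_EInt: "runs_within G D C (EInt m) (\<lambda>N. 1 + \<beta> (of_int m))"
proof (rule runs_withinI)
  fix \<eta> N \<rho> k s assume f: "fits \<eta> N \<rho> k s"
  show "evaluates G C (EInt m) \<eta> \<rho> k s (1 + \<beta> (of_int m))"
    by (rule evaluatesI, unfold compile.simps, rule exec_SetInt) simp_all
qed simp

lemma runs_unary: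
  assumes "runs_within G D C a f"
    and "\<And>\<rho> k. compile C \<rho> k e = Seq (compile C \<rho> k a) (op k)"
    and "\<And>\<eta>. safe G D \<eta> e \<Longrightarrow> safe G D \<eta> a"
    and "\<And>\<eta>. eval G \<eta> e = F (eval G \<eta> a)"
    and "\<And>k s. exec \<beta> (op k) s 1 (s(k := F (s k)))"
    and "\<And>v. val_size \<beta> (F v) \<le> val_size \<beta> v"
  shows "runs_within G D C e (\<lambda>N. f N + 1)"
proof (rule runs_withinI)
  fix \<eta> N \<rho> k s assume f: "fits \<eta> N \<rho> k s" and s: "safe G D \<eta> e"
  note a = runs_withinD[OF assms(1) f assms(3)[OF s]]
  show "val_size \<beta> (eval G \<eta> e) \<le> f N + 1"
    using a(1) assms(6)[of "eval G \<eta> a"] by (simp add: assms(4))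
  from a(2) obtain t s1 where s1: "exec \<beta> (compile C \<rho> k a) s t s1" "t \<le> f N"
    "s1 k = eval G \<eta> a" "\<forall>x<k. s1 x = s x" by (rule evaluatesE)
  show "evaluates G C e \<eta> \<rho> k s (f N + 1)"
  proof (rule evaluatesI)
    show "exec \<beta> (compile C \<rho> k e) s (t + 1) (s1(k := F (s1 k)))"
      unfolding assms(2) by (rule exec_Seq[OF s1(1) assms(5)])
  qed (use s1 in \<open>auto simp: assms(4)\<close>)
qed

lemma runs_EHead: "runs_within G D C a f \<Longrightarrow> runs_within G D C (EHead a) (\<lambda>N. f N + 1)"
  by (rule runs_unary[of G D C a f _ "\<lambda>k. Head k k" head])
     (simp_all only: exec_Head val_size_head compile.simps eval.simps safe.simps)

lemma runs_ETail: "runs_within G D C a f \<Longrightarrow> runs_within G D C (ETail a) (\<lambda>N. f N + 1)"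
  by (rule runs_unary[of G D C a f _ "\<lambda>k. Tail k k" tail])
     (simp_all only: exec_Tail val_size_tail compile.simps eval.simps safe.simps)

lemma evaluates_two:
  assumes "runs_within G D C a f" "runs_within G D C b g" "fits \<eta> N \<rho> k s"
    "safe G D \<eta> a" "safe G D \<eta> b"
  obtains t s' where
    "\<And>P t' s''. exec \<beta> P s' t' s'' \<Longrightarrow>
       exec \<beta> (Seq (compile C \<rho> k a) (Seq (compile C \<rho> (k + 1) b) P)) s (t + t') s''"
    "t \<le> f N + g N" "s' k = eval G \<eta> a" "s' (k + 1) = eval G \<eta> b" "\<forall>x<k. s' x = s x"
    "val_size \<beta> (eval G \<eta> a) \<le> f N" "val_size \<beta> (eval G \<eta> b) \<le> g N"
proof -
  note a = runs_withinD[OF assms(1,3,4)]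
  from a(2) obtain t1 s1 where s1: "exec \<beta> (compile C \<rho> k a) s t1 s1" "t1 \<le> f N"
    "s1 k = eval G \<eta> a" "\<forall>x<k. s1 x = s x" by (rule evaluatesE)
  have "fits \<eta> N \<rho> (k + 1) s1" by (rule fits_weaken[OF assms(3) _ s1(4)]) simp
  note b = runs_withinD[OF assms(2) this assms(5)]
  from b(2) obtain t2 s2 where s2: "exec \<beta> (compile C \<rho> (k + 1) b) s1 t2 s2" "t2 \<le> g N"
    "s2 (k + 1) = eval G \<eta> b" "\<forall>x<k + 1. s2 x = s1 x" by (rule evaluatesE)
  show ?thesis
  proof (rule that[of s2 "t1 + t2"])
    show "exec \<beta> (Seq (compile C \<rho> k a) (Seq (compile C \<rho> (k + 1) b) P)) s (t1 + t2 + t') s''"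
      if "exec \<beta> P s2 t' s''" for P t' s''
      using exec_Seq[OF s1(1) exec_Seq[OF s2(1) that]] by (simp only: add.assoc)
  qed (use s1 s2 a(1) b(1) in auto)
qed

lemma runs_ECons:
  assumes "runs_within G D C a f" "runs_within G D C b g"
  shows "runs_within G D C (ECons a b) (\<lambda>N. f N + g N + 1)"
proof (rule runs_withinI)
  fix \<eta> N \<rho> k s assume fi: "fits \<eta> N \<rho> k s" and s: "safe G D \<eta> (ECons a b)"
  from s have sab: "safe G D \<eta> a" "safe G D \<eta> b" by auto
  obtain t s' where e:
    "\<And>P t' s''. exec \<beta> P s' t' s'' \<Longrightarrow>
       exec \<beta> (Seq (compile C \<rho> k a) (Seq (compile C \<rho> (k + 1) b) P)) s (t + t') s''"
    "t \<le> f N + g N" "s' k = eval G \<eta> a" "s' (k + 1) = eval G \<eta> b" "\<forall>x<k. s' x = s x"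
    "val_size \<beta> (eval G \<eta> a) \<le> f N" "val_size \<beta> (eval G \<eta> b) \<le> g N"
    by (rule evaluates_two[OF assms(1,2) fi sab]) (rule that; assumption)
  show "val_size \<beta> (eval G \<eta> (ECons a b)) \<le> f N + g N + 1" using e(6,7) by simp
  show "evaluates G C (ECons a b) \<eta> \<rho> k s (f N + g N + 1)"
    by (rule evaluatesI, unfold compile.simps, rule e(1), rule exec_Cons)
       (use e(2-5) in auto)
qed

lemma runs_EArith:
  assumes "runs_within G D C a f" "runs_within G D C b g"
  shows "runs_within G D C (EArith h a b) (\<lambda>N. 3 * (f N + g N) + 3)"
proof (rule runs_withinI)
  fix \<eta> N \<rho> k s assume fi: "fits \<eta> N \<rho> k s" and s: "safe G D \<eta> (EArith h a b)"
  from s have sab: "safe G D \<eta> a" "safe G D \<eta> b" by auto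
  obtain t s' where e:
    "\<And>P t' s''. exec \<beta> P s' t' s'' \<Longrightarrow>
       exec \<beta> (Seq (compile C \<rho> k a) (Seq (compile C \<rho> (k + 1) b) P)) s (t + t') s''"
    "t \<le> f N + g N" "s' k = eval G \<eta> a" "s' (k + 1) = eval G \<eta> b" "\<forall>x<k. s' x = s x"
    "val_size \<beta> (eval G \<eta> a) \<le> f N" "val_size \<beta> (eval G \<eta> b) \<le> g N"
    by (rule evaluates_two[OF assms(1,2) fi sab]) (rule that; assumption)
  have b: "\<beta> (num_of (eval G \<eta> a)) \<le> f N" "\<beta> (num_of (eval G \<eta> b)) \<le> g N"
    using order_trans[OF bits_num_of e(6)] order_trans[OF bits_num_of e(7)] by simp_all
  show "val_size \<beta> (eval G \<eta> (EArith h a b)) \<le> 3 * (f N + g N) + 3"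
    using b bits_arith[of h "num_of (eval G \<eta> a)" "num_of (eval G \<eta> b)"] by simp
  show "evaluates G C (EArith h a b) \<eta> \<rho> k s (3 * (f N + g N) + 3)"
    by (rule evaluatesI, unfold compile.simps, rule e(1), rule exec_Arith)
       (use e(2-5) b in auto)
qed

lemma runs_EIfLess:
  assumes "runs_within G D C a f" "runs_within G D C b g"
    "runs_within G D C e1 h1" "runs_within G D C e2 h2"
  shows "runs_within G D C (EIfLess a b e1 e2) (\<lambda>N. 2 * (f N + g N) + h1 N + h2 N + 1)"
proof (rule runs_withinI)
  fix \<eta> N \<rho> k s assume fi: "fits \<eta> N \<rho> k s" and s: "safe G D \<eta> (EIfLess a b e1 e2)"
  from s have sab: "safe G D \<eta> a" "safe G D \<eta> b" by auto
  obtain t s' where e: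
    "\<And>P t' s''. exec \<beta> P s' t' s'' \<Longrightarrow>
       exec \<beta> (Seq (compile C \<rho> k a) (Seq (compile C \<rho> (k + 1) b) P)) s (t + t') s''"
    "t \<le> f N + g N" "s' k = eval G \<eta> a" "s' (k + 1) = eval G \<eta> b" "\<forall>x<k. s' x = s x"
    "val_size \<beta> (eval G \<eta> a) \<le> f N" "val_size \<beta> (eval G \<eta> b) \<le> g N"
    by (rule evaluates_two[OF assms(1,2) fi sab]) (rule that; assumption)
  have b: "\<beta> (num_of (eval G \<eta> a)) \<le> f N" "\<beta> (num_of (eval G \<eta> b)) \<le> g N"
    using order_trans[OF bits_num_of e(6)] order_trans[OF bits_num_of e(7)] by simp_all
  define less where "less \<longleftrightarrow> num_of (eval G \<eta> a) < num_of (eval G \<eta> b)"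
  define c where "c = (if less then e1 else e2)"
  have ev: "eval G \<eta> (EIfLess a b e1 e2) = eval G \<eta> c" by (simp add: c_def less_def)
  have sc: "safe G D \<eta> c" using s by (auto simp: c_def less_def split: if_splits)
  have rc: "runs_within G D C c (\<lambda>N. h1 N + h2 N)"
    using assms(3,4) unfolding c_def runs_within_def evaluates_def
    by (auto intro: le_trans[OF _ le_add1] le_trans[OF _ le_add2]) (meson trans_le_add1 trans_le_add2)+
  have "fits \<eta> N \<rho> k s'" by (rule fits_weaken[OF fi _ e(5)]) simp
  note c = runs_withinD[OF rc this sc]
  show "val_size \<beta> (eval G \<eta> (EIfLess a b e1 e2)) \<le> 2 * (f N + g N) + h1 N + h2 N + 1"
    unfolding ev using c(1) by simp
  from c(2) obtain t2 s2 where s2: "exec \<beta> (compile C \<rho> k c) s' t2 s2" "t2 \<le> h1 N + h2 N"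
    "s2 k = eval G \<eta> c" "\<forall>x<k. s2 x = s' x" by (rule evaluatesE)
  have h: "holds (Less k (k + 1)) s' = less" using e(3,4) by (simp add: less_def)
  have "exec \<beta> (If (Less k (k + 1)) (compile C \<rho> k e1) (compile C \<rho> k e2)) s'
      (test_cost \<beta> (Less k (k + 1)) s' + t2) s2"
    using exec_IfTrue[of "Less k (k + 1)" s' \<beta> "compile C \<rho> k e1" t2 s2 "compile C \<rho> k e2"]
      exec_IfFalse[of "Less k (k + 1)" s' \<beta> "compile C \<rho> k e2" t2 s2 "compile C \<rho> k e1"]
      s2(1) unfolding h c_def by (cases less) auto
  from e(1)[OF this, folded compile.simps] show "evaluates G C (EIfLess a b e1 e2) \<eta> \<rho> k s (2 * (f N + g N) + h1 N + h2 N + 1)"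
    by (rule evaluatesI) (use e(2-5) b s2 in \<open>auto simp: ev c_def less_def\<close>)
qed

lemma runs_EIfPair:
  assumes "runs_within G D C a f" "runs_within G D C e1 h1" "runs_within G D C e2 h2"
  shows "runs_within G D C (EIfPair a e1 e2) (\<lambda>N. f N + h1 N + h2 N + 1)"
proof (rule runs_withinI)
  fix \<eta> N \<rho> k s assume fi: "fits \<eta> N \<rho> k s" and s: "safe G D \<eta> (EIfPair a e1 e2)"
  from s have "safe G D \<eta> a" by auto
  note a = runs_withinD[OF assms(1) fi this]
  from a(2) obtain t s' where e: "exec \<beta> (compile C \<rho> k a) s t s'" "t \<le> f N"
    "s' k = eval G \<eta> a" "\<forall>x<k. s' x = s x" by (rule evaluatesE)
  define pair where "pair \<longleftrightarrow> (case eval G \<eta> a of Pair _ _ \<Rightarrow> True | _ \<Rightarrow> False)"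
  define c where "c = (if pair then e1 else e2)"
  have ev: "eval G \<eta> (EIfPair a e1 e2) = eval G \<eta> c" by (simp add: c_def pair_def split: val.split)
  have sc: "safe G D \<eta> c" using s by (auto simp: c_def pair_def split: if_splits val.splits)
  have rc: "runs_within G D C c (\<lambda>N. h1 N + h2 N)"
    using assms(2,3) unfolding c_def runs_within_def evaluates_def
    by (auto intro: le_trans[OF _ le_add1] le_trans[OF _ le_add2]) (meson trans_le_add1 trans_le_add2)+
  have "fits \<eta> N \<rho> k s'" by (rule fits_weaken[OF fi _ e(4)]) simp
  note c = runs_withinD[OF rc this sc]
  show "val_size \<beta> (eval G \<eta> (EIfPair a e1 e2)) \<le> f N + h1 N + h2 N + 1"
    unfolding ev using c(1) by simp
  from c(2) obtain t2 s2 where s2: "exec \<beta> (compile C \<rho> k c) s' t2 s2" "t2 \<le> h1 N + h2 N"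
    "s2 k = eval G \<eta> c" "\<forall>x<k. s2 x = s' x" by (rule evaluatesE)
  have h: "holds (IsPair k) s' = pair" using e(3) by (simp add: pair_def)
  have "exec \<beta> (If (IsPair k) (compile C \<rho> k e1) (compile C \<rho> k e2)) s' (1 + t2) s2"
    using exec_IfTrue[of "IsPair k" s' \<beta> "compile C \<rho> k e1" t2 s2 "compile C \<rho> k e2"]
      exec_IfFalse[of "IsPair k" s' \<beta> "compile C \<rho> k e2" t2 s2 "compile C \<rho> k e1"]
      s2(1) unfolding h c_def by (cases pair) auto
  from exec_Seq[OF e(1) this, folded compile.simps] show "evaluates G C (EIfPair a e1 e2) \<eta> \<rho> k s (f N + h1 N + h2 N + 1)"
    by (rule evaluatesI) (use e(2-4) s2 in \<open>auto simp: ev simp del: eval.simps\<close>)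
qed

lemma runs_ELet:
  assumes "runs_within G D C a f" "runs_within G D C e g"
  shows "runs_within G D C (ELet x a e) (\<lambda>N. f N + g (N + f N) + 1)"
proof (rule runs_withinI)
  fix \<eta> N \<rho> k s assume fi: "fits \<eta> N \<rho> k s" and s: "safe G D \<eta> (ELet x a e)"
  let ?\<eta> = "\<eta>(x := eval G \<eta> a)" and ?\<rho> = "\<rho>(x := k)"
  from s have s: "safe G D \<eta> a" "safe G D ?\<eta> e" by auto
  note a = runs_withinD[OF assms(1) fi s(1)]
  from a(2) obtain t s' where e: "exec \<beta> (compile C \<rho> k a) s t s'" "t \<le> f N"
    "s' k = eval G \<eta> a" "\<forall>x<k. s' x = s x" by (rule evaluatesE)
  have "fits ?\<eta> (N + f N) ?\<rho> (k + 1) s'"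
    by (rule fits_bind[OF fi _ e(4,3)]) (use a(1) in auto)
  note b = runs_withinD[OF assms(2) this s(2)]
  from b(2) obtain t2 s2 where s2: "exec \<beta> (compile C ?\<rho> (k + 1) e) s' t2 s2" "t2 \<le> g (N + f N)"
    "s2 (k + 1) = eval G ?\<eta> e" "\<forall>x<k + 1. s2 x = s' x" by (rule evaluatesE)
  show "val_size \<beta> (eval G \<eta> (ELet x a e)) \<le> f N + g (N + f N) + 1" using b(1) by simp
  show "evaluates G C (ELet x a e) \<eta> \<rho> k s (f N + g (N + f N) + 1)"
    by (rule evaluatesI, unfold compile.simps, rule exec_Seq[OF e(1) exec_Seq[OF s2(1) exec_Copy]])
       (use e(2-4) s2 in auto)
qed

lemma runs_ELen:
  assumes "runs_within G D C a f"
  shows "runs_within G D C (ELen a) (\<lambda>N. f N + (f N + 6) * f N + 3)"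
proof (rule runs_withinI)
  fix \<eta> N \<rho> k s assume fi: "fits \<eta> N \<rho> k s" and s: "safe G D \<eta> (ELen a)"
  from s have s: "safe G D \<eta> a" by auto
  have "fits \<eta> N \<rho> (k + 1) s" by (rule fits_weaken[OF fi]) auto
  note a = runs_withinD[OF assms(1) this s]
  from a(2) obtain t s1 where e: "exec \<beta> (compile C \<rho> (k + 1) a) s t s1" "t \<le> f N"
    "s1 (k + 1) = eval G \<eta> a" "\<forall>x<k + 1. s1 x = s x" by (rule evaluatesE)
  define L where "L = length (elems (eval G \<eta> a))"
  have L: "L \<le> f N" unfolding L_def using length_elems[of "eval G \<eta> a" \<beta>] a(1) by simp
  define s2 where "s2 = s1(k := Num (of_int 0))"
  define s3 where "s3 = s2(k + 2 := Num (of_int 1))"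
  have x: "exec \<beta> (SetInt k 0) s1 1 s2" "exec \<beta> (SetInt (k + 2) 1) s2 1 s3"
    unfolding s3_def s2_def by (rule exec_SetInt)+
  have "s3 (k + 1) = eval G \<eta> a" "s3 (k + 2) = Num 1" "s3 k = Num (of_nat 0)"
    using e(3) by (simp_all add: s3_def s2_def)
  from exec_len_loop[of s3 k, OF this bits_of_nat] obtain t4 s4 where s4:
    "exec \<beta> (While (IsPair (k + 1)) (Seq (Arith Plus k k (k + 2)) (Tail (k + 1) (k + 1)))) s3 t4 s4"
    "t4 \<le> (L + 6) * L + 1" "s4 k = Num (of_nat L)" "\<forall>x<k. s4 x = s3 x"
    by (auto simp: L_def)
  have "(L + 6) * L \<le> (f N + 6) * f N" using L by (intro mult_mono) auto
  then have t4: "t4 \<le> (f N + 6) * f N + 1" using s4(2) by simp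
  show "val_size \<beta> (eval G \<eta> (ELen a)) \<le> f N + (f N + 6) * f N + 3"
    using L bits_of_nat[of L] by (simp add: L_def)
  show "evaluates G C (ELen a) \<eta> \<rho> k s (f N + (f N + 6) * f N + 3)"
    by (rule evaluatesI, unfold compile.simps, rule exec_Seq[OF e(1) exec_Seq[OF x(1) exec_Seq[OF x(2) s4(1)]]])
       (use e(2-4) s4 t4 in \<open>auto simp: L_def s3_def s2_def\<close>)
qed

lemma runs_EGather:
  assumes "runs_within G D C a f" "runs_within G D C e g"
  shows "runs_within G D C (EGather x a e)
    (\<lambda>N. f N + (g (N + f N) + 4 * g (N + f N) + 3) * f N + 4 * (1 + f N * g (N + f N)) + 4)"
    (is "runs_within _ _ _ _ ?h")
proof (rule runs_withinI)
  fix \<eta> N \<rho> k s assume fi: "fits \<eta> N \<rho> k s" and s: "safe G D \<eta> (EGather x a e)"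
  let ?\<eta> = "\<lambda>u. \<eta>(x := u)" and ?\<rho> = "\<rho>(x := k)"
  define v where "v = eval G \<eta> a"
  define R where "R = g (N + f N)"
  from s have sa: "safe G D \<eta> a" and se: "\<And>u. u \<in> set (suffixes v) \<Longrightarrow> safe G D (?\<eta> u) e"
    by (auto simp: v_def)
  note a = runs_withinD[OF assms(1) fi sa]
  from a(2) obtain t s1 where s1: "exec \<beta> (compile C \<rho> k a) s t s1" "t \<le> f N"
    "s1 k = v" "\<forall>x<k. s1 x = s x" unfolding v_def by (rule evaluatesE)
  have body: "val_size \<beta> (eval G (?\<eta> u) e) \<le> R \<and> evaluates G C e (?\<eta> u) ?\<rho> (k + 2) st R"
    if "u \<in> set (suffixes v)" "st k = u" "\<forall>x<k. st x = s x" for u st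
  proof -
    have "val_size \<beta> u \<le> N + f N"
      using val_size_suffix[OF that(1), of \<beta>] a(1) by (simp add: v_def)
    then have "fits (?\<eta> u) (N + f N) ?\<rho> (k + 2) st"
      by (intro fits_bind[OF fi _ that(3,2)]) auto
    from runs_withinD[OF assms(2) this se[OF that(1)]] show ?thesis unfolding R_def by simp
  qed
  define F where "F = (\<lambda>u. elems (eval G (?\<eta> u) e))"
  have sz: "val_size \<beta> (eval G (?\<eta> u) e) \<le> R" if "u \<in> set (suffixes v)" for u
    using body[OF that, of "s(k := u)"] by simp
  define s2 where "s2 = s1(k + 1 := Nil)"
  have x2: "exec \<beta> (SetNil (k + 1)) s1 1 s2" unfolding s2_def by (rule exec_SetNil)
  let ?W = "While (IsPair k) (Seq (Seq (compile C ?\<rho> (k + 2) e) (push (k + 1) (k + 2) (k + 3))) (Tail k k))"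
  have "\<exists>t st'. exec \<beta> ?W s2 t st' \<and> t \<le> (R + 4 * R + 3) * length (suffixes v) + 1 \<and>
    st' (k + 1) = fold Pair (concat (map F (suffixes v))) (s2 (k + 1)) \<and> (\<forall>x<k. st' x = s x)"
  proof (rule exec_gather_loop)
    fix u st assume u: "u \<in> set (suffixes v)" "st k = u" "\<forall>x<k. st x = s x"
    then have "evaluates G C e (?\<eta> u) ?\<rho> (k + 2) st R" using body by blast
    then obtain t st' where "exec \<beta> (compile C ?\<rho> (k + 2) e) st t st'" "t \<le> R"
      "st' (k + 2) = eval G (?\<eta> u) e" "\<forall>x<k + 2. st' x = st x" by (rule evaluatesE)
    then show "\<exists>t st'. exec \<beta> (compile C ?\<rho> (k + 2) e) st t st' \<and> t \<le> R \<and>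
        elems (st' (k + 2)) = F u \<and> (\<forall>x<k + 2. st' x = st x)"
      by (intro exI[of _ t] exI[of _ st']) (simp add: F_def)
  next
    fix u assume "u \<in> set (suffixes v)"
    from sz[OF this] show "length (F u) \<le> R"
      unfolding F_def using length_elems order_trans by blast
  next
    show "s2 k = v" "\<forall>x<k. s2 x = s x" using s1(3,4) by (auto simp: s2_def)
  qed
  then obtain t3 s3 where s3: "exec \<beta> ?W s2 t3 s3" "t3 \<le> (R + 4 * R + 3) * length (suffixes v) + 1"
    "s3 (k + 1) = fold Pair (concat (map F (suffixes v))) (s2 (k + 1))" "\<forall>x<k. s3 x = s x" by blast
  define xs where "xs = concat (map F (suffixes v))"
  have s3': "s3 (k + 1) = enc_list (\<lambda>x. x) (rev xs)"
    using s3(3) fold_Pair[of xs "[]"] by (simp add: s2_def xs_def)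
  define s4 where "s4 = s3(k := Nil)"
  have x4: "exec \<beta> (SetNil k) s3 1 s4" unfolding s4_def by (rule exec_SetNil)
  from exec_push[of k "k + 1" "k + 2" s4 _ \<beta>, OF _ _ _ refl] obtain s5 where s5:
    "exec \<beta> (push k (k + 1) (k + 2)) s4 (1 + 4 * length (elems (s4 (k + 1)))) s5"
    "s5 k = fold Pair (elems (s4 (k + 1))) (s4 k)"
    "\<forall>x. x \<noteq> k \<longrightarrow> x \<noteq> k + 1 \<longrightarrow> x \<noteq> k + 2 \<longrightarrow> s5 x = s4 x" by auto
  have el: "elems (s4 (k + 1)) = rev xs" using s3' by (simp add: s4_def)
  have ev: "eval G \<eta> (EGather x a e) = enc_list (\<lambda>x. x) xs"
    by (simp add: gather_def xs_def F_def v_def)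
  have s5k: "s5 k = eval G \<eta> (EGather x a e)"
    unfolding ev s5(2) el using fold_Pair[of "rev xs" "[]"] by (simp add: s4_def)
  have size: "val_size \<beta> (eval G \<eta> (EGather x a e)) \<le> 1 + f N * R"
  proof -
    have "val_size \<beta> (eval G \<eta> (EGather x a e)) \<le> 1 + val_size \<beta> v * R"
      unfolding eval.simps v_def[symmetric] by (rule val_size_gather[OF sz])
    also have "\<dots> \<le> 1 + f N * R" using a(1) by (simp add: v_def)
    finally show ?thesis .
  qed
  then show "val_size \<beta> (eval G \<eta> (EGather x a e)) \<le> ?h N" by (simp add: R_def)
  have "length xs \<le> 1 + f N * R"
    using length_elems[of "eval G \<eta> (EGather x a e)" \<beta>] size unfolding ev by simp
  then have "4 * length xs \<le> 4 * (1 + f N * R)" by (rule mult_le_mono2)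
  moreover have "length (suffixes v) \<le> f N"
    using length_suffixes[of v \<beta>] a(1) by (simp add: v_def)
  then have "(R + 4 * R + 3) * length (suffixes v) \<le> (R + 4 * R + 3) * f N"
    by (rule mult_le_mono2)
  then have "t3 \<le> (R + 4 * R + 3) * f N + 1" using s3(2) by (rule order_trans[rotated, OF add_right_mono])
  moreover have "t + (1 + (t3 + (1 + (1 + m)))) \<le> p + q + r + 4"
    if "m \<le> r" "t3 \<le> q + 1" "t \<le> p" for m p q r :: nat
    using that by linarith
  ultimately have T: "t + (1 + (t3 + (1 + (1 + 4 * length (elems (s4 (k + 1))))))) \<le> ?h N"
    using s1(2) unfolding el length_rev R_def by blast
  show "evaluates G C (EGather x a e) \<eta> \<rho> k s (?h N)"
  proof (rule evaluatesI)
    show "exec \<beta> (compile C \<rho> k (EGather x a e)) s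
        (t + (1 + (t3 + (1 + (1 + 4 * length (elems (s4 (k + 1)))))))) s5"
      unfolding compile.simps by (intro exec_Seq) (rule s1(1) x2 s3(1) x4 s5(1))+
  qed (use T s5k s5(3) s3(4) in \<open>auto simp: s4_def\<close>)
qed

lemma runs_ECall:
  assumes "runs_within G D C a f"
    and solver: "\<And>v. v \<in> D \<Longrightarrow> \<exists>t s. exec \<beta> C (initial v) t s \<and> s 0 = G v \<and>
      t \<le> q (val_size \<beta> v) \<and> val_size \<beta> (G v) \<le> q (val_size \<beta> v)"
    and q: "poly_bound q"
  shows "runs_within G D C (ECall a) (\<lambda>N. f N + Suc (Max (com_vars C \<union> {0})) + q (f N))"
proof (rule runs_withinI)
  fix \<eta> N \<rho> k s assume fi: "fits \<eta> N \<rho> k s" and "safe G D \<eta> (ECall a)"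
  then have s: "safe G D \<eta> a" "eval G \<eta> a \<in> D" by auto
  note a = runs_withinD[OF assms(1) fi s(1)]
  from a(2) obtain t s1 where s1: "exec \<beta> (compile C \<rho> k a) s t s1" "t \<le> f N"
    "s1 k = eval G \<eta> a" "\<forall>x<k. s1 x = s x" by (rule evaluatesE)
  have m: "q (val_size \<beta> (eval G \<eta> a)) \<le> q (f N)" by (rule poly_bound_mono[OF q a(1)])
  from solver[OF s(2)] obtain t2 s2 where s2: "exec \<beta> C (initial (s1 k)) t2 s2"
    "s2 0 = G (eval G \<eta> a)" "t2 \<le> q (f N)" "val_size \<beta> (G (eval G \<eta> a)) \<le> q (f N)"
    using m s1(3) by (metis order_trans)
  from exec_subroutine[of \<beta> C s1 k t2 s2, OF s2(1)] obtain s3 where s3: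
    "exec \<beta> (subroutine C k) s1 (Suc (Max (com_vars C \<union> {0})) + t2) s3"
    "s3 k = s2 0" "\<forall>x<k. s3 x = s1 x" by blast
  show "val_size \<beta> (eval G \<eta> (ECall a)) \<le> f N + Suc (Max (com_vars C \<union> {0})) + q (f N)"
    using s2(4) by simp
  show "evaluates G C (ECall a) \<eta> \<rho> k s (f N + Suc (Max (com_vars C \<union> {0})) + q (f N))"
    by (rule evaluatesI, unfold compile.simps, rule exec_Seq[OF s1(1) s3(1)])
       (use s1 s2 s3 in auto)
qed

text \<open>The bound refers to the size of the environment and covers the value as well as the time, since
  the value of a subexpression becomes part of the environment of another one. A loop runs its body
  at most as often as the size of the list, always in an environment of the same bounded size.\<close>

theorem expr_runs_in_poly_time:
  assumes solver: "\<And>v. v \<in> D \<Longrightarrow> \<exists>t s. exec \<beta> C (initial v) t s \<and> s 0 = G v \<and>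
      t \<le> q (val_size \<beta> v) \<and> val_size \<beta> (G v) \<le> q (val_size \<beta> v)"
    and q: "poly_bound q"
  shows "\<exists>f. poly_bound f \<and> runs_within G D C e f"
proof (induction e)
  case (EVar x) then show ?case by (intro exI conjI, rule_tac[2] runs_EVar) auto
next
  case ENil then show ?case by (intro exI conjI, rule_tac[2] runs_ENil) auto
next
  case (EInt m) then show ?case by (intro exI conjI, rule_tac[2] runs_EInt) auto
next
  case (ECons a b)
  then obtain f g where "poly_bound f" "runs_within G D C a f" "poly_bound g" "runs_within G D C b g" by blast
  then show ?case by (intro exI conjI, rule_tac[2] runs_ECons) auto
next
  case (EHead a)
  then obtain f where "poly_bound f" "runs_within G D C a f" by blast
  then show ?case by (intro exI conjI, rule_tac[2] runs_EHead) auto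
next
  case (ETail a)
  then obtain f where "poly_bound f" "runs_within G D C a f" by blast
  then show ?case by (intro exI conjI, rule_tac[2] runs_ETail) auto
next
  case (EArith h a b)
  then obtain f g where "poly_bound f" "runs_within G D C a f" "poly_bound g" "runs_within G D C b g" by blast
  then show ?case by (intro exI conjI, rule_tac[2] runs_EArith) auto
next
  case (EIfLess a b e e')
  then obtain f g h h' where "poly_bound f" "runs_within G D C a f" "poly_bound g" "runs_within G D C b g"
    "poly_bound h" "runs_within G D C e h" "poly_bound h'" "runs_within G D C e' h'" by blast
  then show ?case by (intro exI conjI, rule_tac[2] runs_EIfLess) auto
next
  case (EIfPair a e e')
  then obtain f h h' where "poly_bound f" "runs_within G D C a f"
    "poly_bound h" "runs_within G D C e h" "poly_bound h'" "runs_within G D C e' h'" by blast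
  then show ?case by (intro exI conjI, rule_tac[2] runs_EIfPair) auto
next
  case (ELet x a b)
  then obtain f g where fg: "poly_bound f" "runs_within G D C a f" "poly_bound g" "runs_within G D C b g" by blast
  have "poly_bound (\<lambda>N. g (N + f N))" by (rule poly_bound_comp[OF fg(3)]) (use fg in auto)
  with fg show ?case by (intro exI conjI, rule_tac[2] runs_ELet) auto
next
  case (ELen a)
  then obtain f where "poly_bound f" "runs_within G D C a f" by blast
  then show ?case by (intro exI conjI, rule_tac[2] runs_ELen) auto
next
  case (EGather x a b)
  then obtain f g where fg: "poly_bound f" "runs_within G D C a f" "poly_bound g" "runs_within G D C b g" by blast
  have "poly_bound (\<lambda>N. g (N + f N))" by (rule poly_bound_comp[OF fg(3)]) (use fg in auto)
  with fg show ?case by (intro exI conjI, rule_tac[2] runs_EGather) auto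
next
  case (ECall a)
  then obtain f where f: "poly_bound f" "runs_within G D C a f" by blast
  have "poly_bound (\<lambda>N. q (f N))" by (rule poly_bound_comp[OF q f(1)])
  with f show ?case by (intro exI conjI, rule_tac[2] runs_ECall[OF _ solver q]) auto
qed

end

section \<open>Bit sizes of numbers\<close>

lemma nat_bitlen_le_iff: "nat (bitlen x) \<le> w \<longleftrightarrow> x < 2 ^ w"
  using bitlen_le_iff_power[of x "int w"] bitlen_nonneg[of x] by (simp add: nat_le_iff)

lemma less_two_power_bitlen: "x < 2 ^ nat (bitlen x)"
  using nat_bitlen_le_iff by blast

lemma nat_bitlen_mono: "x \<le> y \<Longrightarrow> nat (bitlen x) \<le> nat (bitlen y)"
  using nat_bitlen_le_iff less_two_power_bitlen order_le_less_trans by blast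

lemma nat_bitlen_mult: "0 \<le> x \<Longrightarrow> 0 \<le> y \<Longrightarrow> nat (bitlen (x * y)) \<le> nat (bitlen x) + nat (bitlen y)"
  unfolding nat_bitlen_le_iff power_add by (intro mult_strict_mono less_two_power_bitlen) auto

lemma nat_bitlen_add:
  "0 \<le> x \<Longrightarrow> 0 \<le> y \<Longrightarrow> nat (bitlen (x + y)) \<le> nat (bitlen x) + nat (bitlen y) + 1"
proof -
  assume xy: "0 \<le> x" "0 \<le> y"
  let ?m = "nat (bitlen x)" and ?n = "nat (bitlen y)"
  have "x < 2 ^ ?m" "y < 2 ^ ?n" by (rule less_two_power_bitlen)+
  moreover have "(2 :: int) ^ ?m \<le> 2 ^ (?m + ?n)" "(2 :: int) ^ ?n \<le> 2 ^ (?m + ?n)"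
    by (rule power_increasing; simp)+
  ultimately have "x + y < 2 * 2 ^ (?m + ?n)" by linarith
  then show ?thesis unfolding nat_bitlen_le_iff by simp
qed

lemma rat_bits_Fract:
  assumes "q \<noteq> 0"
  shows "rat_bits (Rat.Fract p q) \<le> nat (bitlen \<bar>p\<bar>) + nat (bitlen \<bar>q\<bar>)"
proof -
  obtain a b where ab: "quotient_of (Rat.Fract p q) = (a, b)" by force
  then have b: "b > 0" "coprime a b" "Rat.Fract p q = Rat.Fract a b"
    using quotient_of_denom_pos quotient_of_coprime quotient_of_div Fract_of_int_quotient by metis+
  then have eq: "p * b = a * q" using assms by (simp add: eq_rat)
  have "b dvd q"
    using b(2) eq by (metis coprime_commute coprime_dvd_mult_right_iff dvd_triv_right)
  then have "b \<le> \<bar>q\<bar>" using assms b(1) by (metis dvd_imp_le_int zero_less_abs_iff abs_of_pos)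
  moreover have "\<bar>a\<bar> \<le> \<bar>p\<bar>"
  proof (cases "p = 0")
    case False
    have "a dvd p" using b(2) eq by (metis coprime_dvd_mult_left_iff dvd_triv_left)
    then show ?thesis using False by (rule dvd_imp_le_int[rotated])
  qed (use eq assms in simp)
  ultimately have "nat (bitlen b) \<le> nat (bitlen \<bar>q\<bar>)" "nat (bitlen \<bar>a\<bar>) \<le> nat (bitlen \<bar>p\<bar>)"
    by (auto intro: nat_bitlen_mono)
  moreover have "rat_bits (Rat.Fract p q) = nat (bitlen \<bar>a\<bar>) + nat (bitlen b)"
    by (simp add: rat_bits_def ab nat_add_distrib bitlen_nonneg)
  ultimately show ?thesis by simp
qed

lemma bit_size_rat: "bit_size rat_bits"
proof
  fix h and r s :: rat
  obtain a b where ab: "quotient_of r = (a, b)" by force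
  obtain c e where ce: "quotient_of s = (c, e)" by force
  have pos: "b > 0" "e > 0" using ab ce quotient_of_denom_pos by metis+
  have r: "r = Rat.Fract a b" and s: "s = Rat.Fract c e"
    using ab ce quotient_of_div Fract_of_int_quotient by metis+
  define A B C E where "A = nat (bitlen \<bar>a\<bar>)" and "B = nat (bitlen \<bar>b\<bar>)"
    and "C = nat (bitlen \<bar>c\<bar>)" and "E = nat (bitlen \<bar>e\<bar>)"
  have bits: "rat_bits r = A + B" "rat_bits s = C + E"
    using pos by (simp_all add: rat_bits_def ab ce nat_add_distrib bitlen_nonneg A_def B_def C_def E_def)
  have m: "nat (bitlen \<bar>x * y\<bar>) \<le> nat (bitlen \<bar>x\<bar>) + nat (bitlen \<bar>y\<bar>)" for x y
    unfolding abs_mult by (rule nat_bitlen_mult) auto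
  have sum: "nat (bitlen \<bar>x\<bar>) \<le> A + E + (C + B) + 1" if "\<bar>x\<bar> \<le> \<bar>a * e\<bar> + \<bar>c * b\<bar>" for x
  proof -
    have "nat (bitlen \<bar>x\<bar>) \<le> nat (bitlen (\<bar>a * e\<bar> + \<bar>c * b\<bar>))" by (rule nat_bitlen_mono[OF that])
    also have "\<dots> \<le> nat (bitlen \<bar>a * e\<bar>) + nat (bitlen \<bar>c * b\<bar>) + 1" by (rule nat_bitlen_add) auto
    also have "\<dots> \<le> A + E + (C + B) + 1"
      using m[of a e] m[of c b] unfolding A_def B_def C_def E_def by linarith
    finally show ?thesis .
  qed
  have be: "nat (bitlen \<bar>b * e\<bar>) \<le> B + E" unfolding B_def E_def by (rule m)
  show "rat_bits (arith_op h r s) \<le> 2 * (rat_bits r + rat_bits s) + 2"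
  proof (cases h)
    case Plus
    have "arith_op h r s = Rat.Fract (a * e + c * b) (b * e)" using pos by (simp add: Plus r s)
    then show ?thesis
      using rat_bits_Fract[of "b * e" "a * e + c * b"] be sum[OF abs_triangle_ineq] pos bits by auto
  next
    case Minus
    have "arith_op h r s = Rat.Fract (a * e - c * b) (b * e)" using pos by (simp add: Minus r s)
    then show ?thesis
      using rat_bits_Fract[of "b * e" "a * e - c * b"] be sum[OF abs_triangle_ineq4] pos bits by auto
  next
    case Times
    have "arith_op h r s = Rat.Fract (a * c) (b * e)" by (simp add: Times r s)
    then show ?thesis
      using rat_bits_Fract[of "b * e" "a * c"] be m[of a c] pos bits by (auto simp: A_def C_def)
  next
    case Divide
    show ?thesis
    proof (cases "c = 0")
      case True
      then have "arith_op h r s = 0" by (simp add: Divide s rat_number_collapse)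
      moreover have "rat_bits 0 = 1" by (simp add: rat_bits_def bitlen_alt_def)
      ultimately show ?thesis by simp
    next
      case False
      have "arith_op h r s = Rat.Fract (a * e) (b * c)" by (simp add: Divide r s)
      then show ?thesis
        using rat_bits_Fract[of "b * c" "a * e"] m[of a e] m[of b c] pos False bits
        by (auto simp: A_def B_def C_def E_def)
    qed
  qed
next
  fix n
  have "rat_bits (of_nat n) = nat (bitlen (int n)) + 1"
    using quotient_of_int[of "int n"]
    by (simp add: rat_bits_def bitlen_alt_def[of 1] nat_add_distrib bitlen_nonneg)
  moreover have "nat (bitlen (int n)) \<le> n"
    unfolding nat_bitlen_le_iff by (metis of_nat_less_two_power of_nat_numeral of_nat_power)
  ultimately show "rat_bits (of_nat n) \<le> n + 1" by simp
qed

lemma bit_size_real: "bit_size real_bits"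
  by unfold_locales (simp_all add: real_bits_def)

fun leaf_bits :: "('a \<Rightarrow> nat) \<Rightarrow> 'a val \<Rightarrow> nat" where
  "leaf_bits \<beta> Nil = 0"
| "leaf_bits \<beta> (Num a) = \<beta> a"
| "leaf_bits \<beta> (Pair v w) = max (leaf_bits \<beta> v) (leaf_bits \<beta> w)"

lemma leaf_bits_le: "leaf_bits \<beta> v \<le> val_size \<beta> v"
  by (induction v) auto

lemma leaf_bits_head: "leaf_bits \<beta> (head v) \<le> leaf_bits \<beta> v"
  by (cases v) auto

lemma leaf_bits_tail: "leaf_bits \<beta> (tail v) \<le> leaf_bits \<beta> v"
  by (cases v) auto

fun const_bits :: "('a::linordered_field \<Rightarrow> nat) \<Rightarrow> com \<Rightarrow> nat" where
  "const_bits \<beta> (SetInt x m) = \<beta> (of_int m)"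
| "const_bits \<beta> (Seq C D) = max (const_bits \<beta> C) (const_bits \<beta> D)"
| "const_bits \<beta> (If b C D) = max (const_bits \<beta> C) (const_bits \<beta> D)"
| "const_bits \<beta> (While b C) = const_bits \<beta> C"
| "const_bits \<beta> _ = 0"

context bit_size begin

text \<open>An arithmetic operation is charged for the bits of its operands and at most doubles them, up to a
  constant; all other operations copy numbers or load constants. This would fail for the size of the computed trees,
  which can double with every cons.\<close>

lemma exec_leaf_bits:
  "exec \<beta> C s t s' \<Longrightarrow> const_bits \<beta> C \<le> M \<Longrightarrow> (\<And>x. leaf_bits \<beta> (s x) \<le> M) \<Longrightarrow>
    leaf_bits \<beta> (s' x) \<le> max M (2 * t)"
proof (induction arbitrary: M x rule: exec.induct)
  case (exec_Head y z s)
  then show ?case using order_trans[OF leaf_bits_head exec_Head.prems(2)] by (simp add: max.coboundedI1)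
next
  case (exec_Tail y z s)
  then show ?case using order_trans[OF leaf_bits_tail exec_Tail.prems(2)] by (simp add: max.coboundedI1)
next
  case (exec_Arith f y z w s)
  then show ?case
    using bits_arith[of f "num_of (s z)" "num_of (s w)"] by (auto simp: max.coboundedI1 max.coboundedI2)
next
  case (exec_Seq C1 s t1 s' C2 t2 s'')
  have "leaf_bits \<beta> (s'' x) \<le> max (max M (2 * t1)) (2 * t2)"
    by (rule exec_Seq.IH(2)) (use exec_Seq.prems exec_Seq.IH(1)[of M] in \<open>auto simp: max.coboundedI1\<close>)
  then show ?case by auto
next
  case (exec_IfTrue b s C1 t s' C2)
  have "leaf_bits \<beta> (s' x) \<le> max M (2 * t)"
    by (rule exec_IfTrue.IH) (use exec_IfTrue.prems in auto)
  then show ?case by auto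
next
  case (exec_IfFalse b s C2 t s' C1)
  have "leaf_bits \<beta> (s' x) \<le> max M (2 * t)"
    by (rule exec_IfFalse.IH) (use exec_IfFalse.prems in auto)
  then show ?case by auto
next
  case (exec_WhileTrue b s C t1 s' t2 s'')
  have "leaf_bits \<beta> (s'' x) \<le> max (max M (2 * t1)) (2 * t2)"
    by (rule exec_WhileTrue.IH(2))
      (use exec_WhileTrue.prems exec_WhileTrue.IH(1)[of M] in \<open>auto simp: max.coboundedI1\<close>)
  then show ?case by auto
qed (auto simp: max.coboundedI1)

lemma exec_number_size:
  assumes "exec \<beta> C (initial v) t s" "s 0 = Num r"
  shows "val_size \<beta> (s 0) \<le> 1 + const_bits \<beta> C + val_size \<beta> v + 2 * t"
proof -
  have "leaf_bits \<beta> (s 0) \<le> max (const_bits \<beta> C + val_size \<beta> v) (2 * t)"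
    by (rule exec_leaf_bits[OF assms(1)])
      (auto simp: initial_def intro: trans_le_add2[OF leaf_bits_le])
  then show ?thesis using assms(2) by simp
qed

section \<open>Reductions\<close>

text \<open>To solve \<open>Y\<close> by an algorithm for \<open>X\<close> it is enough to give an expression which is correct for
  every function \<open>G\<close> that assigns valid outputs to the inputs of \<open>X\<close>. Outputs of \<open>X\<close> have to be
  numbers because only for numbers the size of the output is bounded by the running time.\<close>

lemma poly_time_reduction:
  fixes X :: "('a, 'x) problem" and Y :: "('a, 'y) problem"
  assumes "poly_time_solvable \<beta> X"
    and number: "\<And>x v. x \<in> inputs X \<Longrightarrow> valid_output X x v \<Longrightarrow> \<exists>r. v = Num r"
    and correct: "\<And>G y. (\<And>x. x \<in> inputs X \<Longrightarrow> valid_output X x (G (encode X x))) \<Longrightarrow> y \<in> inputs Y \<Longrightarrow>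
      safe G (encode X ` inputs X) (initial (encode Y y)) e \<and>
      valid_output Y y (eval G (initial (encode Y y)) e)"
  shows "poly_time_solvable \<beta> Y"
proof -
  from assms(1) obtain C p where C: "\<And>x. x \<in> inputs X \<Longrightarrow> \<exists>t s.
        exec \<beta> C (initial (encode X x)) t s \<and>
        t \<le> poly p (val_size \<beta> (encode X x)) \<and> valid_output X x (s 0)"
    unfolding poly_time_solvable_def poly_time_algorithm_def by blast
  define G where "G v = (SOME w. \<exists>t s. exec \<beta> C (initial v) t s \<and> w = s 0)" for v
  have G: "G v = s 0" if "exec \<beta> C (initial v) t s" for v t s
  proof -
    have "\<exists>t s. exec \<beta> C (initial v) t s \<and> G v = s 0"
      unfolding G_def by (rule someI_ex) (use that in blast)
    then show ?thesis using exec_deterministic[OF that] by fastforce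
  qed
  define q where "q n = 1 + const_bits \<beta> C + n + 2 * poly p n" for n
  have "poly_bound (poly p)" unfolding poly_bound_def by blast
  then have q: "poly_bound q" unfolding q_def by auto
  have solver: "\<exists>t s. exec \<beta> C (initial v) t s \<and> s 0 = G v \<and>
      t \<le> q (val_size \<beta> v) \<and> val_size \<beta> (G v) \<le> q (val_size \<beta> v)"
    if "v \<in> encode X ` inputs X" for v
  proof -
    from that obtain x where x: "x \<in> inputs X" "v = encode X x" by blast
    from C[OF x(1)] obtain t s where s: "exec \<beta> C (initial v) t s" "t \<le> poly p (val_size \<beta> v)"
      "valid_output X x (s 0)" unfolding x(2) by blast
    obtain r where "s 0 = Num r" using number[OF x(1) s(3)] by blast
    from exec_number_size[OF s(1) this] have "val_size \<beta> (s 0) \<le> q (val_size \<beta> v)"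
      using s(2) unfolding q_def by simp
    then show ?thesis using G[OF s(1)] s(1,2) by (intro exI[of _ t] exI[of _ s]) (simp add: q_def)
  qed
  from expr_runs_in_poly_time[OF solver q, of _ e] obtain f where
    f: "poly_bound f" "runs_within G (encode X ` inputs X) C e f" by blast
  then obtain p' where p': "f = poly p'" unfolding poly_bound_def by blast
  have valid: "valid_output X x (G (encode X x))" if "x \<in> inputs X" for x
    using C[OF that] G by fastforce
  define \<rho> :: "nat \<Rightarrow> nat" where "\<rho> y = (if y = 0 then 0 else 1)" for y
  have "poly_time_algorithm \<beta> Y (Seq (compile C \<rho> 2 e) (Copy 0 2))"
    unfolding poly_time_algorithm_def
  proof (intro exI[of _ "p' + 1"] ballI)
    fix y assume y: "y \<in> inputs Y"
    let ?v = "encode Y y"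
    have fit: "fits (initial ?v) (val_size \<beta> ?v) \<rho> 2 (initial ?v)"
      unfolding fits_def initial_def \<rho>_def using val_size_pos[of \<beta> ?v] by auto
    from correct[OF valid y] have c: "safe G (encode X ` inputs X) (initial ?v) e"
      "valid_output Y y (eval G (initial ?v) e)" by blast+
    from runs_withinD(2)[OF f(2) fit c(1)] obtain t s where s:
      "exec \<beta> (compile C \<rho> 2 e) (initial ?v) t s" "t \<le> f (val_size \<beta> ?v)"
      "s 2 = eval G (initial ?v) e" by (rule evaluatesE)
    show "\<exists>t s. exec \<beta> (Seq (compile C \<rho> 2 e) (Copy 0 2)) (initial ?v) t s \<and>
      t \<le> poly (p' + 1) (val_size \<beta> ?v) \<and> valid_output Y y (s 0)"
      by (rule exI, rule exI, rule conjI, rule exec_Seq[OF s(1) exec_Copy]) (use s c p' in simp)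
  qed
  then show ?thesis unfolding poly_time_solvable_def by blast
qed

end

section \<open>Programming with lists\<close>

abbreviation vlist :: "'a val list \<Rightarrow> 'a val" where
  "vlist \<equiv> enc_list (\<lambda>x. x)"

lemma enc_list_vlist: "enc_list e xs = vlist (map e xs)"
  by (induction xs) auto

fun call_free :: "expr \<Rightarrow> bool" where
  "call_free (ECons a b) \<longleftrightarrow> call_free a \<and> call_free b"
| "call_free (EHead a) \<longleftrightarrow> call_free a"
| "call_free (ETail a) \<longleftrightarrow> call_free a"
| "call_free (EArith f a b) \<longleftrightarrow> call_free a \<and> call_free b"
| "call_free (EIfLess a b e e') \<longleftrightarrow> call_free a \<and> call_free b \<and> call_free e \<and> call_free e'"
| "call_free (EIfPair a e e') \<longleftrightarrow> call_free a \<and> call_free e \<and> call_free e'"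
| "call_free (ELet x a e) \<longleftrightarrow> call_free a \<and> call_free e"
| "call_free (ELen a) \<longleftrightarrow> call_free a"
| "call_free (EGather x a e) \<longleftrightarrow> call_free a \<and> call_free e"
| "call_free (ECall a) \<longleftrightarrow> False"
| "call_free _ \<longleftrightarrow> True"

lemma safe_if_call_free: "call_free e \<Longrightarrow> safe G D \<eta> e"
  by (induction e arbitrary: \<eta>) (auto split: val.split)

definition item :: "nat \<Rightarrow> expr" where
  "item x = EHead (EVar x)"

fun elist :: "expr list \<Rightarrow> expr" where
  "elist [] = ENil"
| "elist (e # es) = ECons e (elist es)"

definition emap :: "nat \<Rightarrow> expr \<Rightarrow> expr \<Rightarrow> expr" where
  "emap x l e = EGather x l (elist [e])"

definition enth :: "nat \<Rightarrow> expr \<Rightarrow> expr" where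
  "enth i e = EHead ((ETail ^^ i) e)"

text \<open>An optimal number in a list is one that no other beats, and all pairs can be compared without an
  accumulator. The names 100 to 102 are reserved for this purpose.\<close>

definition ebest :: "bool \<Rightarrow> expr \<Rightarrow> expr" where
  "ebest lo l = ELet 100 l (EHead (EGather 101 (EVar 100)
     (EIfPair (EGather 102 (EVar 100)
         (if lo then EIfLess (item 102) (item 101) (elist [EInt 1]) ENil
          else EIfLess (item 101) (item 102) (elist [EInt 1]) ENil))
       ENil (elist [item 101]))))"

abbreviation "emin \<equiv> ebest True"
abbreviation "emax \<equiv> ebest False"

lemma call_free_macros [simp]:
  "call_free (item x)"
  "call_free (elist es) \<longleftrightarrow> (\<forall>e\<in>set es. call_free e)"
  "call_free (emap x l e) \<longleftrightarrow> call_free l \<and> call_free e"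
  "call_free (enth i e) \<longleftrightarrow> call_free e"
  "call_free (ebest m l) \<longleftrightarrow> call_free l"
proof -
  show 1: "call_free (elist es) \<longleftrightarrow> (\<forall>e\<in>set es. call_free e)" for es by (induction es) auto
  have "call_free ((ETail ^^ i) e) \<longleftrightarrow> call_free e" by (induction i) auto
  then show "call_free (enth i e) \<longleftrightarrow> call_free e" by (simp add: enth_def)
  show "call_free (item x)" by (simp add: item_def)
  then show "call_free (ebest m l) \<longleftrightarrow> call_free l" by (simp add: ebest_def item_def 1)
  show "call_free (emap x l e) \<longleftrightarrow> call_free l \<and> call_free e" by (auto simp: emap_def)
qed

lemma eval_item [simp]: "eval G \<eta> (item x) = head (\<eta> x)"
  by (simp add: item_def)

lemma eval_elist [simp]: "eval G \<eta> (elist es) = vlist (map (eval G \<eta>) es)"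
  by (induction es) auto

lemma suffixes_vlist:
  "suffixes (vlist xs) = map (\<lambda>i. Pair (xs ! i) (vlist (drop (Suc i) xs))) [0..<length xs]"
proof (induction xs)
  case (Cons x xs)
  have "[0..<length (x # xs)] = 0 # map Suc [0..<length xs]"
    by (simp add: upt_conv_Cons map_Suc_upt del: upt_Suc)
  then show ?case using Cons by (simp add: comp_def del: upt_Suc)
qed simp

lemma eval_gather_nth:
  assumes "eval G \<eta> l = vlist xs"
    and "\<And>i t. i < length xs \<Longrightarrow> length (elems t) = length xs - Suc i \<Longrightarrow>
      eval G (\<eta>(x := Pair (xs ! i) t)) b = vlist (F i)"
  shows "eval G \<eta> (EGather x l b) = vlist (concat (map F [0..<length xs]))"
proof -
  have "map (\<lambda>v. elems (eval G (\<eta>(x := v)) b)) (suffixes (vlist xs)) = map F [0..<length xs]"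
    unfolding suffixes_vlist map_map comp_def
  proof (rule map_cong[OF refl])
    fix i assume "i \<in> set [0..<length xs]"
    then have "eval G (\<eta>(x := Pair (xs ! i) (vlist (drop (Suc i) xs)))) b = vlist (F i)"
      by (intro assms(2)) auto
    then show "elems (eval G (\<eta>(x := Pair (xs ! i) (vlist (drop (Suc i) xs)))) b) = F i"
      by (simp del: fun_upd_apply)
  qed
  then show ?thesis using assms(1) by (simp add: gather_def)
qed

lemma eval_emap_nth:
  assumes "eval G \<eta> l = vlist xs"
    and "\<And>i t. i < length xs \<Longrightarrow> length (elems t) = length xs - Suc i \<Longrightarrow>
      eval G (\<eta>(x := Pair (xs ! i) t)) b = f i"
  shows "eval G \<eta> (emap x l b) = vlist (map f [0..<length xs])"
proof -
  have "eval G \<eta> (emap x l b) = vlist (concat (map (\<lambda>i. [f i]) [0..<length xs]))"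
    unfolding emap_def by (rule eval_gather_nth[OF assms(1)]) (simp add: assms(2) del: fun_upd_apply)
  then show ?thesis by simp
qed

lemma eval_gather_map:
  assumes "eval G \<eta> l = vlist (map e xs)"
    and "\<And>y t. y \<in> set xs \<Longrightarrow> eval G (\<eta>(x := Pair (e y) t)) b = vlist (F y)"
  shows "eval G \<eta> (EGather x l b) = vlist (concat (map F xs))"
proof -
  have "eval G \<eta> (EGather x l b) = vlist (concat (map (\<lambda>i. F (xs ! i)) [0..<length (map e xs)]))"
    by (rule eval_gather_nth[OF assms(1)]) (simp add: assms(2) del: fun_upd_apply)
  also have "map (\<lambda>i. F (xs ! i)) [0..<length (map e xs)] = map F xs"
    by (rule nth_equalityI) auto
  finally show ?thesis .
qed

lemma eval_emap_map:
  assumes "eval G \<eta> l = vlist (map e xs)"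
    and "\<And>y t. y \<in> set xs \<Longrightarrow> eval G (\<eta>(x := Pair (e y) t)) b = f y"
  shows "eval G \<eta> (emap x l b) = vlist (map f xs)"
proof -
  have "eval G \<eta> (emap x l b) = vlist (concat (map (\<lambda>y. [f y]) xs))"
    unfolding emap_def by (rule eval_gather_map[OF assms(1)]) (simp add: assms(2) del: fun_upd_apply)
  then show ?thesis by simp
qed

lemma eval_enth:
  assumes "eval G \<eta> e = vlist xs" "i < length xs"
  shows "eval G \<eta> (enth i e) = xs ! i"
proof -
  have "eval G \<eta> ((ETail ^^ i) e) = vlist (drop i xs)"
    using assms(2)
  proof (induction i)
    case 0 then show ?case using assms(1) by simp
  next
    case (Suc i)
    then have "drop i xs = xs ! i # drop (Suc i) xs" by (simp add: Cons_nth_drop_Suc)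
    then show ?case using Suc by simp
  qed
  moreover have "drop i xs = xs ! i # drop (Suc i) xs" using assms(2) by (simp add: Cons_nth_drop_Suc)
  ultimately show ?thesis by (simp add: enth_def)
qed

lemma eval_EIfPair_vlist:
  "eval G \<eta> a = vlist xs \<Longrightarrow>
    eval G \<eta> (EIfPair a e e') = (if xs = [] then eval G \<eta> e' else eval G \<eta> e)"
  by (cases xs) auto

lemma eval_ebest:
  fixes xs :: "'a::linordered_field list"
  assumes "eval G \<eta> l = vlist (map Num xs)" "xs \<noteq> []"
  shows "eval G \<eta> (ebest lo l) = Num (if lo then Min (set xs) else Max (set xs))"
proof -
  \<comment> \<open>An optimal entry is one without a better one; antisymmetry makes it unique.\<close>
  define better where "better y x \<longleftrightarrow> (if lo then y < x else x < y)" for x y :: 'a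
  define opt where "opt = (if lo then Min (set xs) else Max (set xs))"
  have opt: "opt \<in> set xs" "\<not> better y opt" if "y \<in> set xs" for y
    using assms(2) that by (auto simp: opt_def better_def not_less)
  have uniq: "x = opt" if "x \<in> set xs" "\<And>y. y \<in> set xs \<Longrightarrow> \<not> better y x" for x
    using that(2)[OF opt(1)[OF that(1)]] opt(2)[OF that(1)] by (auto simp: better_def split: if_splits)
  let ?\<eta> = "\<eta>(100 := vlist (map Num xs))"
  let ?worse = "EGather 102 (EVar 100)
         (if lo then EIfLess (item 102) (item 101) (elist [EInt 1]) ENil
          else EIfLess (item 101) (item 102) (elist [EInt 1]) ENil)"
  have worse: "eval G (?\<eta>(101 := Pair (Num x) t)) ?worse
      = vlist (concat (map (\<lambda>y. if better y x then [Num 1] else []) xs))" for x t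
    by (rule eval_gather_map[where e = Num]) (auto simp: better_def)
  have empty: "concat (map (\<lambda>y. if better y x then [Num 1 :: 'a val] else []) xs) = [] \<longleftrightarrow>
      (\<forall>y\<in>set xs. \<not> better y x)" for x :: 'a
    by auto
  let ?R = "concat (map (\<lambda>x. if \<forall>y\<in>set xs. \<not> better y x then [Num x] else []) xs)"
  have "eval G ?\<eta> (EGather 101 (EVar 100) (EIfPair ?worse ENil (elist [item 101]))) = vlist ?R"
  proof (rule eval_gather_map[where e = Num])
    fix x t
    show "eval G (?\<eta>(101 := Pair (Num x) t)) (EIfPair ?worse ENil (elist [item 101])) =
        vlist (if \<forall>y\<in>set xs. \<not> better y x then [Num x] else [])"
      unfolding eval_EIfPair_vlist[OF worse] empty by simp
  qed simp
  moreover have "\<exists>ys. ?R = Num opt # ys"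
  proof -
    have "\<exists>ys. R = a # ys" if "set R \<subseteq> {a}" "a \<in> set R" for a :: "'a val" and R
      using that by (cases R) auto
    moreover have "set ?R \<subseteq> {Num opt}" using uniq by auto
    moreover have "Num opt \<in> set ?R" using opt assms(2) by (cases xs) auto
    ultimately show ?thesis by blast
  qed
  ultimately show ?thesis using assms(1) unfolding ebest_def opt_def[symmetric] by auto
qed

section \<open>Homomorphisms between sums of upset modules\<close>

definition usum :: "real vec set list \<Rightarrow> ('k::field, nat \<times> unit) pmod" where
  "usum Us = direct_sum (map upset_module Us)"

definition nonempty_indices :: "real vec set list \<Rightarrow> nat set" where
  "nonempty_indices Us = {i. i < length Us \<and> Us ! i \<noteq> {}}"

definition unit_fun :: "nat \<Rightarrow> nat \<times> unit \<Rightarrow> 'k::field" where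
  "unit_fun j = (\<lambda>(i, _). if i = j then 1 else 0)"

definition mat_act :: "nat set \<Rightarrow> (nat \<Rightarrow> nat \<Rightarrow> 'k::field) \<Rightarrow> (nat \<times> unit \<Rightarrow> 'k) \<Rightarrow> nat \<times> unit \<Rightarrow> 'k" where
  "mat_act I a x = (\<lambda>(j, _). \<Sum>i\<in>I. a j i * x (i, ()))"

lemma finite_nonempty_indices [simp]: "finite (nonempty_indices Us)"
  unfolding nonempty_indices_def by simp

text \<open>The index \<open>()\<close> of the one-dimensional summands is carried along; together with
  \<open>tr_usum\<close> this says that the spaces of a sum of upset modules are coordinate subspaces of one
  vector space and that the structure maps are the inclusions.\<close>

lemma sp_usum: "x \<in> sp (usum Us) p \<longleftrightarrow> (\<forall>j. x (j, ()) \<noteq> 0 \<longrightarrow> j < length Us \<and> p \<in> Us ! j)"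
proof -
  have "(\<lambda>i. x (j, i)) = (0 :: unit \<Rightarrow> 'a) \<longleftrightarrow> x (j, ()) = 0" for j
    by (auto simp: fun_eq_iff)
  then show ?thesis
    unfolding usum_def direct_sum_def upset_module_def
    by (auto simp: not_less[symmetric])
qed

lemma tr_usum: "x \<in> sp (usum Us) p \<Longrightarrow> tr (usum Us) p q x = x"
proof -
  assume "x \<in> sp (usum Us) p"
  then have x: "x (j, u) \<noteq> 0 \<Longrightarrow> j < length Us \<and> p \<in> Us ! j" for j u
    unfolding sp_usum by (cases u) auto
  show ?thesis
    unfolding usum_def direct_sum_def upset_module_def
    using x by (force simp: fun_eq_iff)
qed

lemma pmodule_usum: "(\<And>U. U \<in> set Us \<Longrightarrow> upset d U) \<Longrightarrow> pmodule d (usum Us)"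
  unfolding usum_def by (rule pmodule_direct_sum) (auto intro: pmodule_upset_module)

lemma upset_sum_usum: "upset_sum d Us = usum (map (generated_upset d) Us)"
  unfolding upset_sum_def usum_def by (simp add: comp_def)

lemma sp_shift [simp]: "sp (shift d \<epsilon> M) p = sp M (p + diag d \<epsilon>)"
  by (simp add: shift_def)

lemma tr_shift [simp]: "tr (shift d \<epsilon> M) p q = tr M (p + diag d \<epsilon>) (q + diag d \<epsilon>)"
  by (simp add: shift_def)

lemma diag_carrier [simp]: "diag d \<epsilon> \<in> carrier_vec d"
  by (simp add: diag_def)

lemma add_diag_zero [simp]: "p \<in> carrier_vec d \<Longrightarrow> p + diag d 0 = p"
  by (auto simp: diag_def)

lemma upper_bound_points:
  fixes P :: "real vec set"
  assumes "finite P" "P \<subseteq> carrier_vec d"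
  shows "\<exists>q\<in>carrier_vec d. \<forall>p\<in>P. p \<le> q"
proof (intro bexI ballI)
  define q where "q = vec d (\<lambda>i. Max ((\<lambda>p. p $ i) ` P))"
  show "q \<in> carrier_vec d" by (simp add: q_def)
  fix p assume "p \<in> P"
  then show "p \<le> q"
    using assms unfolding less_eq_vec_def q_def by (auto intro!: Max_ge)
qed

text \<open>Nonempty upsets are directed: a point above one chosen point of each of them lies in all of them.\<close>

lemma common_point:
  assumes "\<And>U. U \<in> set Us \<Longrightarrow> upset d U"
  obtains q where "q \<in> carrier_vec d" "\<And>r i. r \<in> carrier_vec d \<Longrightarrow> q \<le> r \<Longrightarrow> i \<in> nonempty_indices Us \<Longrightarrow> r \<in> Us ! i"
proof -
  have "\<forall>i\<in>nonempty_indices Us. \<exists>p. p \<in> Us ! i" by (auto simp: nonempty_indices_def)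
  then obtain f where f: "\<forall>i\<in>nonempty_indices Us. f i \<in> Us ! i" by metis
  have us: "upset d (Us ! i)" if "i \<in> nonempty_indices Us" for i
    using that assms by (auto simp: nonempty_indices_def)
  then have "f ` nonempty_indices Us \<subseteq> carrier_vec d" using f unfolding upset_def by blast
  then obtain q where q: "q \<in> carrier_vec d" "\<forall>p\<in>f ` nonempty_indices Us. p \<le> q"
    using upper_bound_points[of "f ` nonempty_indices Us" d] by auto
  show ?thesis
  proof (rule that[OF q(1)])
    fix r i assume "r \<in> carrier_vec d" "q \<le> r" "i \<in> nonempty_indices Us"
    then show "r \<in> Us ! i"
      using f q(2) us[of i] unfolding upset_def by (metis image_eqI order_trans)
  qed
qed

lemma upper_bound_two:
  fixes p q :: "real vec"
  assumes "p \<in> carrier_vec d" "q \<in> carrier_vec d"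
  obtains r where "r \<in> carrier_vec d" "p \<le> r" "q \<le> r"
  using upper_bound_points[of "{p, q}" d] assms by auto

lemma unit_fun_in_sp: "i < length Us \<Longrightarrow> p \<in> Us ! i \<Longrightarrow> unit_fun i \<in> sp (usum Us) p"
  unfolding sp_usum unit_fun_def by (auto split: if_splits)

lemma unit_fun_apply [simp]: "unit_fun j (i, u) = (if i = j then 1 else 0)"
  by (simp add: unit_fun_def)

lemma mat_act_apply [simp]: "mat_act I a x (j, u) = (\<Sum>i\<in>I. a j i * x (i, ()))"
  by (simp add: mat_act_def)

lemma mat_act_unit_fun: "finite I \<Longrightarrow> i \<in> I \<Longrightarrow> mat_act I a (unit_fun i) (j, u) = a j i"
  by (simp add: if_distrib[of "(*) _"] sum.delta cong: if_cong)

lemma fun_eq_units: "(\<And>j. x (j, ()) = y (j, ())) \<Longrightarrow> x = (y :: nat \<times> unit \<Rightarrow> 'k)"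
  by (auto simp: fun_eq_iff)

lemma linear_betweenD:
  assumes "linear_between V W f"
  shows "x \<in> V \<Longrightarrow> f x \<in> W" "x \<in> V \<Longrightarrow> y \<in> V \<Longrightarrow> f (x + y) = f x + f y"
    "x \<in> V \<Longrightarrow> f (fscale c x) = fscale c (f x)"
  using assms unfolding linear_between_def by blast+

lemma linear_between_units:
  fixes f :: "(nat \<times> unit \<Rightarrow> 'k::field) \<Rightarrow> ('j \<Rightarrow> 'k)"
  assumes "linear_between (sp (usum Us) r) W f"
    and "finite I" "\<And>i. i \<in> I \<Longrightarrow> i < length Us \<and> r \<in> Us ! i" "\<And>i. i \<notin> I \<Longrightarrow> x (i, ()) = 0"
  shows "f x = (\<lambda>j. \<Sum>i\<in>I. x (i, ()) * f (unit_fun i) j)"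
  using assms(2-4)
proof (induction I arbitrary: x rule: finite_induct)
  case empty
  then have "x = fscale 0 x" by (intro fun_eq_units) (simp add: fscale_def)
  moreover have "x \<in> sp (usum Us) r" using empty unfolding sp_usum by auto
  ultimately have "f x = fscale 0 (f x)" using linear_betweenD(3)[OF assms(1), of x 0] by simp
  then show ?case by (simp add: fscale_def)
next
  case (insert i I)
  define y where "y = (\<lambda>(j, u). if j = i then 0 else x (j, u))"
  have i: "unit_fun i \<in> sp (usum Us) r" using insert.prems by (auto intro: unit_fun_in_sp)
  then have si: "fscale (x (i, ())) (unit_fun i) \<in> sp (usum Us) r"
    unfolding sp_usum by (auto simp: fscale_def split: if_splits)
  have x: "x \<in> sp (usum Us) r" unfolding sp_usum using insert.prems by blast
  then have y: "y \<in> sp (usum Us) r" unfolding sp_usum y_def by auto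
  have "x = fscale (x (i, ())) (unit_fun i) + y"
    by (rule fun_eq_units) (auto simp: y_def fscale_def)
  then have "f x = fscale (x (i, ())) (f (unit_fun i)) + f y"
    using linear_betweenD(2)[OF assms(1) si y] linear_betweenD(3)[OF assms(1) i] by metis
  also have "f y = (\<lambda>j. \<Sum>l\<in>I. y (l, ()) * f (unit_fun l) j)"
    by (rule insert.IH) (use insert.prems in \<open>auto simp: y_def\<close>)
  also have "\<dots> = (\<lambda>j. \<Sum>l\<in>I. x (l, ()) * f (unit_fun l) j)"
    by (rule ext, rule sum.cong) (use insert.hyps in \<open>auto simp: y_def\<close>)
  finally show ?case using insert.hyps by (simp add: fscale_def plus_fun_def)
qed

lemma morphismD:
  assumes "morphism d M N f" "p \<in> carrier_vec d"
  shows "linear_between (sp M p) (sp N p) (f p)"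
    and "q \<in> carrier_vec d \<Longrightarrow> p \<le> q \<Longrightarrow> x \<in> sp M p \<Longrightarrow> f q (tr M p q x) = tr N p q (f p x)"
  using assms unfolding morphism_def by blast+

lemma morphism_usum_constant:
  assumes "morphism d (usum Us) (shift d \<epsilon> (usum Vs)) \<phi>"
    and "p \<in> carrier_vec d" "r \<in> carrier_vec d" "p \<le> r" "x \<in> sp (usum Us) p"
  shows "\<phi> r x = \<phi> p x"
  using morphismD(2)[OF assms(1,2,3,4,5)] tr_usum[OF assms(5)]
    linear_betweenD(1)[OF morphismD(1)[OF assms(1,2)] assms(5)]
  by (simp add: tr_usum)

text \<open>As structure maps are inclusions, naturality says that the components of \<open>\<phi>\<close> at comparable points
  agree where both are defined. At a point common to all nonempty upsets all basis vectors are
  available, and their images form the matrix. An entry in column \<open>i\<close> is therefore already visible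
  at every point of the upset \<open>i\<close>, which gives the condition on nonzero entries.\<close>

lemma morphism_matrix:
  fixes \<phi> :: "real vec \<Rightarrow> (nat \<times> unit \<Rightarrow> 'k::field) \<Rightarrow> (nat \<times> unit \<Rightarrow> 'k)"
  assumes up: "\<And>U. U \<in> set Us \<Longrightarrow> upset d U"
    and mor: "morphism d (usum Us) (shift d \<epsilon> (usum Vs)) \<phi>"
  obtains a where
    "\<And>i j p. i \<in> nonempty_indices Us \<Longrightarrow> a j i \<noteq> 0 \<Longrightarrow> p \<in> Us ! i \<Longrightarrow> j < length Vs \<and> p + diag d \<epsilon> \<in> Vs ! j"
    "\<And>p x. p \<in> carrier_vec d \<Longrightarrow> x \<in> sp (usum Us) p \<Longrightarrow> \<phi> p x = mat_act (nonempty_indices Us) a x"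
proof -
  obtain q where q: "q \<in> carrier_vec d"
    "\<And>r i. r \<in> carrier_vec d \<Longrightarrow> q \<le> r \<Longrightarrow> i \<in> nonempty_indices Us \<Longrightarrow> r \<in> Us ! i"
    using common_point[OF up] by metis
  define a where "a j i = \<phi> q (unit_fun i) (j, ())" for j i
  have len: "i < length Us" if "i \<in> nonempty_indices Us" for i
    using that by (simp add: nonempty_indices_def)
  have same: "\<phi> r (unit_fun i) = \<phi> q (unit_fun i)"
    if "r \<in> carrier_vec d" "q \<le> r" "i \<in> nonempty_indices Us" for r i
    by (rule morphism_usum_constant[OF mor q(1) that(1,2)])
       (use q(2)[OF q(1) order_refl that(3)] len[OF that(3)] in \<open>auto intro: unit_fun_in_sp\<close>)
  show ?thesis
  proof (rule that[of a])
    fix i j p assume i: "i \<in> nonempty_indices Us" and a: "a j i \<noteq> 0" and p: "p \<in> Us ! i"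
    have pc: "p \<in> carrier_vec d" using up[of "Us ! i"] len[OF i] p by (auto simp: upset_def)
    obtain r where r: "r \<in> carrier_vec d" "p \<le> r" "q \<le> r" by (rule upper_bound_two[OF pc q(1)])
    have u: "unit_fun i \<in> sp (usum Us) p" using p len[OF i] by (rule unit_fun_in_sp[rotated])
    have "\<phi> p (unit_fun i) = \<phi> q (unit_fun i)"
      using same[OF r(1,3) i] morphism_usum_constant[OF mor pc r(1,2) u] by simp
    moreover have "\<phi> p (unit_fun i) \<in> sp (usum Vs) (p + diag d \<epsilon>)"
      using linear_betweenD(1)[OF morphismD(1)[OF mor pc] u] by simp
    ultimately show "j < length Vs \<and> p + diag d \<epsilon> \<in> Vs ! j"
      using a unfolding sp_usum a_def by auto
  next
    fix p and x :: "nat \<times> unit \<Rightarrow> 'k"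
    assume pc: "p \<in> carrier_vec d" and x: "x \<in> sp (usum Us) p"
    obtain r where r: "r \<in> carrier_vec d" "p \<le> r" "q \<le> r" by (rule upper_bound_two[OF pc q(1)])
    have "x (i, ()) = 0" if "i \<notin> nonempty_indices Us" for i
      using x that unfolding sp_usum nonempty_indices_def by auto
    then have "\<phi> r x = (\<lambda>j. \<Sum>i\<in>nonempty_indices Us. x (i, ()) * \<phi> r (unit_fun i) j)"
      by (intro linear_between_units[OF morphismD(1)[OF mor r(1)]]) (use q(2)[OF r(1,3)] len in auto)
    also have "\<dots> = mat_act (nonempty_indices Us) a x"
      by (rule fun_eq_units) (auto simp: a_def same[OF r(1,3)] mult.commute intro!: sum.cong)
    finally show "\<phi> p x = mat_act (nonempty_indices Us) a x"
      using morphism_usum_constant[OF mor pc r(1,2) x] by simp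
  qed
qed

lemma matrix_morphism:
  assumes "\<And>i j p. i \<in> nonempty_indices Us \<Longrightarrow> a j i \<noteq> 0 \<Longrightarrow> p \<in> Us ! i \<Longrightarrow>
      j < length Vs \<and> p + diag d \<epsilon> \<in> Vs ! j"
  shows "morphism d (usum Us) (shift d \<epsilon> (usum Vs)) (\<lambda>p. mat_act (nonempty_indices Us) a)"
proof -
  have m: "mat_act (nonempty_indices Us) a x \<in> sp (usum Vs) (p + diag d \<epsilon>)"
    if x: "x \<in> sp (usum Us) p" for p x
    unfolding sp_usum
  proof (intro allI impI)
    fix j assume "mat_act (nonempty_indices Us) a x (j, ()) \<noteq> 0"
    then obtain i where "i \<in> nonempty_indices Us" "a j i * x (i, ()) \<noteq> 0"
      unfolding mat_act_apply by (metis (no_types, lifting) sum.neutral)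
    then show "j < length Vs \<and> p + diag d \<epsilon> \<in> Vs ! j"
      using assms[of i j p] x unfolding sp_usum by auto
  qed
  show ?thesis
    unfolding morphism_def linear_between_def
    by (auto simp: m tr_usum fun_eq_iff fscale_def algebra_simps sum.distrib sum_distrib_left)
qed

lemma morphism_shift_zero: "morphism d M (shift d 0 N) f \<longleftrightarrow> morphism d M N f"
  unfolding morphism_def by simp

lemma common_unit_funs:
  assumes "\<And>U. U \<in> set Us \<Longrightarrow> upset d U"
  obtains q where "q \<in> carrier_vec d" "\<And>i. i \<in> nonempty_indices Us \<Longrightarrow> unit_fun i \<in> sp (usum Us) q"
proof -
  obtain q where "q \<in> carrier_vec d"
    "\<And>r i. r \<in> carrier_vec d \<Longrightarrow> q \<le> r \<Longrightarrow> i \<in> nonempty_indices Us \<Longrightarrow> r \<in> Us ! i"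
    using common_point[OF assms] by metis
  then show ?thesis using that[of q] by (auto intro!: unit_fun_in_sp simp: nonempty_indices_def)
qed

text \<open>If the middle index set were smaller, both factors could be padded with zeros to square matrices.
  The product in the opposite order would then be the identity as well, although it has a zero row.\<close>

lemma card_le_if_identity_factors:
  fixes \<alpha> :: "'a \<Rightarrow> 'b \<Rightarrow> 'k::field"
  assumes fin: "finite A" "finite B"
    and id: "\<And>a a'. a \<in> A \<Longrightarrow> a' \<in> A \<Longrightarrow> (\<Sum>b\<in>B. \<alpha> a b * \<gamma> b a') = (if a = a' then 1 else 0)"
  shows "card A \<le> card B"
proof (rule ccontr)
  define n m where "n = card A" and "m = card B"
  assume "\<not> card A \<le> card B"
  then have mn: "m < n" by (simp add: n_def m_def)
  obtain f where f: "bij_betw f {0..<n} A" using ex_bij_betw_nat_finite[OF fin(1)] n_def by blast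
  obtain g where g: "bij_betw g {0..<m} B" using ex_bij_betw_nat_finite[OF fin(2)] m_def by blast
  define X where "X = mat n n (\<lambda>(i, j). if j < m then \<alpha> (f i) (g j) else 0)"
  define Y where "Y = mat n n (\<lambda>(j, i). if j < m then \<gamma> (g j) (f i) else 0)"
  have XY: "X \<in> carrier_mat n n" "Y \<in> carrier_mat n n" by (simp_all add: X_def Y_def)
  have "X * Y = 1\<^sub>m n"
  proof (rule eq_matI)
    fix i i' assume "i < dim_row (1\<^sub>m n)" "i' < dim_col (1\<^sub>m n)"
    then have i: "i < n" "i' < n" by auto
    have "(X * Y) $$ (i, i') = (\<Sum>j\<in>{0..<n}. X $$ (i, j) * Y $$ (j, i'))"
      using i XY by (simp add: scalar_prod_def)
    also have "\<dots> = (\<Sum>j\<in>{0..<n}. if j < m then \<alpha> (f i) (g j) * \<gamma> (g j) (f i') else 0)"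
      by (rule sum.cong) (use i in \<open>auto simp: X_def Y_def\<close>)
    also have "\<dots> = (\<Sum>j\<in>{0..<m}. \<alpha> (f i) (g j) * \<gamma> (g j) (f i'))"
      by (rule sum.mono_neutral_cong_right) (use mn in auto)
    also have "\<dots> = (\<Sum>b\<in>B. \<alpha> (f i) b * \<gamma> b (f i'))"
      using sum.reindex_bij_betw[OF g] by fastforce
    also have "\<dots> = (if f i = f i' then 1 else 0)"
      by (rule id) (use f i in \<open>auto simp: bij_betw_def\<close>)
    also have "f i = f i' \<longleftrightarrow> i = i'"
      using f i by (auto simp: bij_betw_def dest: inj_onD)
    finally show "(X * Y) $$ (i, i') = 1\<^sub>m n $$ (i, i')" using i by simp
  qed (use XY in auto)
  then have "Y * X = 1\<^sub>m n" using mat_mult_left_right_inverse[OF XY] by simp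
  moreover have "(Y * X) $$ (m, m) = 0"
    using mn XY by (simp add: scalar_prod_def Y_def)
  ultimately show False using mn by simp
qed

section \<open>Interleavings as solutions of CI problems\<close>

text \<open>The matrices of homomorphisms from \<open>usum Us\<close> to the shifted module \<open>usum Vs\<close>, by
  \<open>morphism_feasible\<close> and \<open>matrix_morphism\<close>.\<close>

definition feasible :: "nat \<Rightarrow> real \<Rightarrow> real vec set list \<Rightarrow> real vec set list \<Rightarrow> (nat \<Rightarrow> nat \<Rightarrow> 'k::field) \<Rightarrow> bool" where
  "feasible d \<epsilon> Us Vs a \<longleftrightarrow> (\<forall>i\<in>nonempty_indices Us. \<forall>j. a j i \<noteq> 0 \<longrightarrow>
     j < length Vs \<and> (\<forall>p\<in>Us ! i. p + diag d \<epsilon> \<in> Vs ! j))"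

definition inverse_on :: "nat set \<Rightarrow> nat set \<Rightarrow> (nat \<Rightarrow> nat \<Rightarrow> 'k::field) \<Rightarrow> (nat \<Rightarrow> nat \<Rightarrow> 'k) \<Rightarrow> bool" where
  "inverse_on I J b a \<longleftrightarrow> (\<forall>i\<in>I. \<forall>i'\<in>I. (\<Sum>j\<in>J. b i j * a j i') = (if i = i' then 1 else 0))"

lemma mat_act_mat_act:
  "mat_act J b (mat_act I a x) (i, u) = (\<Sum>i'\<in>I. (\<Sum>j\<in>J. b i j * a j i') * x (i', ()))"
  by (simp add: sum_distrib_left sum_distrib_right mult.assoc) (rule sum.swap)

text \<open>At a point common to all nonempty upsets, all unit vectors are available as test vectors.\<close>

lemma inverse_on_if_mat_act:
  assumes up: "\<And>U. U \<in> set Us \<Longrightarrow> upset d U"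
    and "\<And>p x. p \<in> carrier_vec d \<Longrightarrow> x \<in> sp (usum Us) p \<Longrightarrow>
      mat_act J b (mat_act (nonempty_indices Us) a x) = (x :: nat \<times> unit \<Rightarrow> 'k::field)"
  shows "inverse_on (nonempty_indices Us) J b a"
  unfolding inverse_on_def
proof (intro ballI)
  fix i i' assume i: "i \<in> nonempty_indices Us" "i' \<in> nonempty_indices Us"
  obtain q where q: "q \<in> carrier_vec d"
    "\<And>i. i \<in> nonempty_indices Us \<Longrightarrow> unit_fun i \<in> (sp (usum Us) q :: (nat \<times> unit \<Rightarrow> 'k) set)"
    using common_unit_funs[OF up] by metis
  have "(\<Sum>j\<in>J. b i j * a j i') = mat_act J b (mat_act (nonempty_indices Us) a (unit_fun i')) (i, ())"
    using mat_act_unit_fun[OF finite_nonempty_indices i(2), of a]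
    unfolding mat_act_apply[of J] by simp
  also have "\<dots> = unit_fun i' (i, ())" using assms(2)[OF q(1) q(2)[OF i(2)]] by simp
  finally show "(\<Sum>j\<in>J. b i j * a j i') = (if i = i' then 1 else 0)" by simp
qed

lemma mat_act_if_inverse_on:
  assumes "inverse_on (nonempty_indices Us) (nonempty_indices Vs) b a"
    and "feasible d \<epsilon> Vs Us b" and "x \<in> sp (usum Us) p"
  shows "mat_act (nonempty_indices Vs) b (mat_act (nonempty_indices Us) a x) = x"
proof (rule fun_eq_units)
  fix i
  show "mat_act (nonempty_indices Vs) b (mat_act (nonempty_indices Us) a x) (i, ()) = x (i, ())"
  proof (cases "i \<in> nonempty_indices Us")
    case True
    have "mat_act (nonempty_indices Vs) b (mat_act (nonempty_indices Us) a x) (i, ()) =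
        (\<Sum>i'\<in>nonempty_indices Us. if i = i' then x (i', ()) else 0)"
      unfolding mat_act_mat_act
      by (rule sum.cong) (use assms(1) True in \<open>auto simp: inverse_on_def\<close>)
    then show ?thesis using True by simp
  next
    case False
    then have "x (i, ()) = 0" using assms(3) by (auto simp: sp_usum nonempty_indices_def)
    moreover have "b i j = 0" if j: "j \<in> nonempty_indices Vs" for j
    proof (rule ccontr)
      assume "b i j \<noteq> 0"
      then have "i < length Us" "\<forall>p\<in>Vs ! j. p + diag d \<epsilon> \<in> Us ! i"
        using assms(2) j unfolding feasible_def by blast+
      moreover obtain p where "p \<in> Vs ! j" using j by (auto simp: nonempty_indices_def)
      ultimately show False using False by (auto simp: nonempty_indices_def)
    qed
    ultimately show ?thesis by (simp add: mat_act_apply)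
  qed
qed

lemma morphism_feasible:
  fixes \<phi> :: "real vec \<Rightarrow> (nat \<times> unit \<Rightarrow> 'k::field) \<Rightarrow> (nat \<times> unit \<Rightarrow> 'k)"
  assumes "\<And>U. U \<in> set Us \<Longrightarrow> upset d U" "morphism d (usum Us) (shift d \<epsilon> (usum Vs)) \<phi>"
  obtains a where "feasible d \<epsilon> Us Vs a"
    "\<And>p x. p \<in> carrier_vec d \<Longrightarrow> x \<in> sp (usum Us) p \<Longrightarrow> \<phi> p x = mat_act (nonempty_indices Us) a x"
proof (rule morphism_matrix[OF assms])
  fix a
  assume a: "\<And>i j p. i \<in> nonempty_indices Us \<Longrightarrow> a j i \<noteq> 0 \<Longrightarrow> p \<in> Us ! i \<Longrightarrow>
        j < length Vs \<and> p + diag d \<epsilon> \<in> Vs ! j"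
    and \<phi>: "\<And>p x. p \<in> carrier_vec d \<Longrightarrow> x \<in> sp (usum Us) p \<Longrightarrow> \<phi> p x = mat_act (nonempty_indices Us) a x"
  have "j < length Vs \<and> (\<forall>p\<in>Us ! i. p + diag d \<epsilon> \<in> Vs ! j)" if "i \<in> nonempty_indices Us" "a j i \<noteq> 0" for i j
    using a[OF that] that(1) by (auto simp: nonempty_indices_def)
  then have "feasible d \<epsilon> Us Vs a" unfolding feasible_def by blast
  then show thesis by (rule that[OF _ \<phi>])
qed

lemma interleavedE:
  assumes "interleaved d \<epsilon> M N"
  obtains \<phi> \<psi> where "0 \<le> \<epsilon>" "morphism d M (shift d \<epsilon> N) \<phi>" "morphism d N (shift d \<epsilon> M) \<psi>"
    "\<And>p x. p \<in> carrier_vec d \<Longrightarrow> x \<in> sp M p \<Longrightarrow>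
        \<psi> (p + diag d \<epsilon>) (\<phi> p x) = tr M p (p + diag d (2 * \<epsilon>)) x"
    "\<And>p y. p \<in> carrier_vec d \<Longrightarrow> y \<in> sp N p \<Longrightarrow>
        \<phi> (p + diag d \<epsilon>) (\<psi> p y) = tr N p (p + diag d (2 * \<epsilon>)) y"
proof -
  from assms obtain \<phi> \<psi> where m: "0 \<le> \<epsilon>" "morphism d M (shift d \<epsilon> N) \<phi>" "morphism d N (shift d \<epsilon> M) \<psi>"
    and inv: "\<forall>p\<in>carrier_vec d.
      (\<forall>x\<in>sp M p. \<psi> (p + diag d \<epsilon>) (\<phi> p x) = tr M p (p + diag d (2 * \<epsilon>)) x) \<and>
      (\<forall>y\<in>sp N p. \<phi> (p + diag d \<epsilon>) (\<psi> p y) = tr N p (p + diag d (2 * \<epsilon>)) y)"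
    unfolding interleaved_def by blast
  show ?thesis by (rule that[OF m]) (use inv in simp_all)
qed

lemma interleaved_usum_iff:
  fixes Us Vs
  defines "I \<equiv> nonempty_indices Us" and "J \<equiv> nonempty_indices Vs"
  assumes U: "\<And>U. U \<in> set Us \<Longrightarrow> upset d U" and V: "\<And>V. V \<in> set Vs \<Longrightarrow> upset d V"
  shows "interleaved d \<epsilon> (usum Us :: ('k::field, _) pmod) (usum Vs :: ('k, _) pmod) \<longleftrightarrow>
    0 \<le> \<epsilon> \<and> (\<exists>a b :: nat \<Rightarrow> nat \<Rightarrow> 'k. feasible d \<epsilon> Us Vs a \<and> feasible d \<epsilon> Vs Us b \<and>
      inverse_on I J b a \<and> inverse_on J I a b)"
    (is "?L \<longleftrightarrow> ?R")
proof
  let ?M = "usum Us :: ('k, nat \<times> unit) pmod" and ?N = "usum Vs :: ('k, nat \<times> unit) pmod"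
  assume ?L
  obtain \<phi> \<psi> where e: "0 \<le> \<epsilon>" and
    mor: "morphism d ?M (shift d \<epsilon> ?N) \<phi>" "morphism d ?N (shift d \<epsilon> ?M) \<psi>" and
    inv: "\<And>p x. p \<in> carrier_vec d \<Longrightarrow> x \<in> sp ?M p \<Longrightarrow>
        \<psi> (p + diag d \<epsilon>) (\<phi> p x) = tr ?M p (p + diag d (2 * \<epsilon>)) x"
      "\<And>p y. p \<in> carrier_vec d \<Longrightarrow> y \<in> sp ?N p \<Longrightarrow>
        \<phi> (p + diag d \<epsilon>) (\<psi> p y) = tr ?N p (p + diag d (2 * \<epsilon>)) y"
    by (rule interleavedE[OF \<open>?L\<close>]) (rule that; assumption)
  obtain a where a: "feasible d \<epsilon> Us Vs a"
    "\<And>p x. p \<in> carrier_vec d \<Longrightarrow> x \<in> sp ?M p \<Longrightarrow> \<phi> p x = mat_act I a x"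
    by (rule morphism_feasible[OF U mor(1), folded I_def], assumption) (rule that; assumption)
  obtain b where b: "feasible d \<epsilon> Vs Us b"
    "\<And>p x. p \<in> carrier_vec d \<Longrightarrow> x \<in> sp ?N p \<Longrightarrow> \<psi> p x = mat_act J b x"
    by (rule morphism_feasible[OF V mor(2), folded J_def], assumption) (rule that; assumption)
  have "mat_act J b (mat_act I a x) = x" if p: "p \<in> carrier_vec d" and x: "x \<in> sp ?M p" for p x
  proof -
    have "\<phi> p x \<in> sp ?N (p + diag d \<epsilon>)"
      using linear_betweenD(1)[OF morphismD(1)[OF mor(1) p] x] by simp
    then show ?thesis
      using inv(1)[OF p x] b(2)[of "p + diag d \<epsilon>" "\<phi> p x"] a(2)[OF p x] p tr_usum[OF x] by simp
  qed
  moreover have "mat_act I a (mat_act J b x) = x" if p: "p \<in> carrier_vec d" and x: "x \<in> sp ?N p" for p x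
  proof -
    have "\<psi> p x \<in> sp ?M (p + diag d \<epsilon>)"
      using linear_betweenD(1)[OF morphismD(1)[OF mor(2) p] x] by simp
    then show ?thesis
      using inv(2)[OF p x] a(2)[of "p + diag d \<epsilon>" "\<psi> p x"] b(2)[OF p x] p tr_usum[OF x] by simp
  qed
  ultimately have "inverse_on I J b a" "inverse_on J I a b"
    unfolding I_def J_def using inverse_on_if_mat_act[OF U] inverse_on_if_mat_act[OF V] by blast+
  with e a(1) b(1) show ?R by blast
next
  let ?M = "usum Us :: ('k, nat \<times> unit) pmod" and ?N = "usum Vs :: ('k, nat \<times> unit) pmod"
  assume ?R
  then obtain a b :: "nat \<Rightarrow> nat \<Rightarrow> 'k" where e: "0 \<le> \<epsilon>" and ab: "feasible d \<epsilon> Us Vs a" "feasible d \<epsilon> Vs Us b"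
    "inverse_on I J b a" "inverse_on J I a b" by blast
  show ?L unfolding interleaved_def
  proof (intro conjI exI ballI)
    show "0 \<le> \<epsilon>" by (rule e)
    show "morphism d ?M (shift d \<epsilon> ?N) (\<lambda>_. mat_act I a)"
      unfolding I_def by (rule matrix_morphism) (use ab(1) in \<open>auto simp: feasible_def\<close>)
    show "morphism d ?N (shift d \<epsilon> ?M) (\<lambda>_. mat_act J b)"
      unfolding J_def by (rule matrix_morphism) (use ab(2) in \<open>auto simp: feasible_def\<close>)
    fix p :: "real vec"
    show "mat_act J b (mat_act I a x) = tr ?M p (p + diag d (2 * \<epsilon>)) x" if "x \<in> sp ?M p" for x
      using mat_act_if_inverse_on[OF ab(3)[unfolded I_def J_def] ab(2) that] tr_usum[OF that]
      unfolding I_def J_def by simp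
    show "mat_act I a (mat_act J b x) = tr ?N p (p + diag d (2 * \<epsilon>)) x" if "x \<in> sp ?N p" for x
      using mat_act_if_inverse_on[OF ab(4)[unfolded I_def J_def] ab(1) that] tr_usum[OF that]
      unfolding I_def J_def by simp
  qed
qed

definition interleaving_problem :: "nat \<Rightarrow> real \<Rightarrow> real vec set list \<Rightarrow> real vec set list \<Rightarrow> ci_problem" where
  "interleaving_problem d \<epsilon> Us Vs = (let n = length Us in
     (mat n n (\<lambda>(j, i). if \<forall>p\<in>Us ! i. p + diag d \<epsilon> \<in> Vs ! j then Star else Zero),
      mat n n (\<lambda>(i, j). if \<forall>p\<in>Vs ! j. p + diag d \<epsilon> \<in> Us ! i then Star else Zero)))"

text \<open>A solution of a CI problem only provides \<open>A B = 1\<close>. Since the matrices are square, this implies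
  \<open>B A = 1\<close>, which is the other equation of an interleaving.\<close>

lemma interleaved_iff_ci_solvable:
  assumes U: "\<And>U. U \<in> set Us \<Longrightarrow> upset d U \<and> U \<noteq> {}" and V: "\<And>V. V \<in> set Vs \<Longrightarrow> upset d V \<and> V \<noteq> {}"
    and len: "length Us = length Vs"
  shows "interleaved d \<epsilon> (usum Us :: ('k::field, _) pmod) (usum Vs :: ('k, _) pmod) \<longleftrightarrow>
    0 \<le> \<epsilon> \<and> ci_solvable TYPE('k) (interleaving_problem d \<epsilon> Us Vs)"
    (is "?L \<longleftrightarrow> ?R")
proof -
  define n where "n = length Us"
  have I: "nonempty_indices Us = {0..<n}" "nonempty_indices Vs = {0..<n}"
    using U V len by (auto simp: nonempty_indices_def n_def)
  let ?C = "interleaving_problem d \<epsilon> Us Vs"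
  have size: "ci_size ?C = n" by (simp add: ci_size_def interleaving_problem_def Let_def n_def)
  have P: "fst ?C $$ (j, i) = Zero \<longleftrightarrow> \<not> (\<forall>p\<in>Us ! i. p + diag d \<epsilon> \<in> Vs ! j)" if "i < n" "j < n" for i j
    using that by (simp add: interleaving_problem_def Let_def n_def)
  have Q: "snd ?C $$ (i, j) = Zero \<longleftrightarrow> \<not> (\<forall>p\<in>Vs ! j. p + diag d \<epsilon> \<in> Us ! i)" if "i < n" "j < n" for i j
    using that by (simp add: interleaving_problem_def Let_def n_def)
  have "?L \<longleftrightarrow> 0 \<le> \<epsilon> \<and> (\<exists>a b :: nat \<Rightarrow> nat \<Rightarrow> 'k. feasible d \<epsilon> Us Vs a \<and> feasible d \<epsilon> Vs Us b \<and>
      inverse_on {0..<n} {0..<n} b a \<and> inverse_on {0..<n} {0..<n} a b)" (is "_ \<longleftrightarrow> _ \<and> ?S")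
    using interleaved_usum_iff[of Us d Vs \<epsilon>] U V unfolding I by blast
  moreover have "?S \<longleftrightarrow> ci_solvable TYPE('k) ?C"
  proof
    assume ?S
    then obtain a b :: "nat \<Rightarrow> nat \<Rightarrow> 'k" where ab: "feasible d \<epsilon> Us Vs a" "feasible d \<epsilon> Vs Us b"
      "inverse_on {0..<n} {0..<n} a b" by blast
    define A where "A = mat n n (\<lambda>(j, i). a j i)"
    define B where "B = mat n n (\<lambda>(i, j). b i j)"
    have "A * B = 1\<^sub>m n"
      using ab(3) by (intro eq_matI) (auto simp: A_def B_def scalar_prod_def inverse_on_def)
    moreover have "A $$ (j, i) = 0" if "j < n" "i < n" "fst ?C $$ (j, i) = Zero" for i j
    proof -
      have "i \<in> nonempty_indices Us" using that I by simp
      then show ?thesis using ab(1) P[OF that(2,1)] that unfolding feasible_def A_def by auto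
    qed
    moreover have "B $$ (i, j) = 0" if "j < n" "i < n" "snd ?C $$ (i, j) = Zero" for i j
    proof -
      have "j \<in> nonempty_indices Vs" using that I by simp
      then show ?thesis using ab(2) Q[OF that(2,1)] that unfolding feasible_def B_def by auto
    qed
    ultimately have "ci_solution ?C A B"
      unfolding ci_solution_def Let_def size by (auto simp: A_def B_def)
    then show "ci_solvable TYPE('k) ?C" unfolding ci_solvable_def by blast
  next
    assume "ci_solvable TYPE('k) ?C"
    then obtain A B :: "'k mat" where AB: "A \<in> carrier_mat n n" "B \<in> carrier_mat n n" "A * B = 1\<^sub>m n"
      "\<forall>i<n. \<forall>j<n. fst ?C $$ (i, j) = Zero \<longrightarrow> A $$ (i, j) = 0"
      "\<forall>i<n. \<forall>j<n. snd ?C $$ (i, j) = Zero \<longrightarrow> B $$ (i, j) = 0"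
      unfolding ci_solvable_def ci_solution_def Let_def size by blast
    have BA: "B * A = 1\<^sub>m n" by (rule mat_mult_left_right_inverse[OF AB(1-3)])
    define a where "a j i = (if i < n \<and> j < n then A $$ (j, i) else 0)" for j i
    define b where "b i j = (if i < n \<and> j < n then B $$ (i, j) else 0)" for i j
    have "feasible d \<epsilon> Us Vs a"
      unfolding feasible_def
    proof (intro ballI allI impI)
      fix i j assume "i \<in> nonempty_indices Us" "a j i \<noteq> 0"
      then have ij: "i < n" "j < n" "A $$ (j, i) \<noteq> 0" by (auto simp: a_def split: if_splits)
      then have "fst ?C $$ (j, i) \<noteq> Zero" using AB(4) by blast
      then show "j < length Vs \<and> (\<forall>p\<in>Us ! i. p + diag d \<epsilon> \<in> Vs ! j)"
        using P[OF ij(1,2)] ij(2) len by (simp add: n_def)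
    qed
    moreover have "feasible d \<epsilon> Vs Us b"
      unfolding feasible_def
    proof (intro ballI allI impI)
      fix j i assume "j \<in> nonempty_indices Vs" "b i j \<noteq> 0"
      then have ij: "i < n" "j < n" "B $$ (i, j) \<noteq> 0" by (auto simp: b_def split: if_splits)
      then have "snd ?C $$ (i, j) \<noteq> Zero" using AB(5) by blast
      then show "i < length Us \<and> (\<forall>p\<in>Vs ! j. p + diag d \<epsilon> \<in> Us ! i)"
        using Q[OF ij(1,2)] ij(1) by (simp add: n_def)
    qed
    moreover have "inverse_on {0..<n} {0..<n} x y"
      if "X * Y = 1\<^sub>m n" "X \<in> carrier_mat n n" "Y \<in> carrier_mat n n"
        "\<And>i j. i < n \<Longrightarrow> j < n \<Longrightarrow> x i j = X $$ (i, j)" "\<And>i j. i < n \<Longrightarrow> j < n \<Longrightarrow> y i j = Y $$ (i, j)"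
      for x y and X Y :: "'k mat"
      unfolding inverse_on_def
    proof (intro ballI)
      fix i i' assume i: "i \<in> {0..<n}" "i' \<in> {0..<n}"
      have "(\<Sum>j\<in>{0..<n}. x i j * y j i') = (X * Y) $$ (i, i')"
        using i that(2-5) by (simp add: scalar_prod_def)
      then show "(\<Sum>j\<in>{0..<n}. x i j * y j i') = (if i = i' then 1 else 0)"
        using i that(1) by simp
    qed
    then have "inverse_on {0..<n} {0..<n} a b" "inverse_on {0..<n} {0..<n} b a"
      using AB(1-3) BA by (auto simp: a_def b_def)
    ultimately show ?S by blast
  qed
  ultimately show ?thesis by blast
qed

lemma ci_solvable_mono:
  assumes "ci_size C = ci_size C'"
    and "\<And>i j. i < ci_size C \<Longrightarrow> j < ci_size C \<Longrightarrow> fst C' $$ (i, j) = Zero \<Longrightarrow> fst C $$ (i, j) = Zero"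
    and "\<And>i j. i < ci_size C \<Longrightarrow> j < ci_size C \<Longrightarrow> snd C' $$ (i, j) = Zero \<Longrightarrow> snd C $$ (i, j) = Zero"
    and "ci_solvable K C"
  shows "ci_solvable K C'"
  using assms unfolding ci_solvable_def ci_solution_def Let_def by (metis (no_types, lifting))

section \<open>Isomorphisms and interleavings\<close>

lemma isomorphic_sym: "isomorphic d M N \<Longrightarrow> isomorphic d N M"
  unfolding isomorphic_def by blast

lemma morphism_comp:
  assumes "morphism d L M f" "morphism d M N g"
  shows "morphism d L N (\<lambda>p x. g p (f p x))"
  using assms unfolding morphism_def linear_between_def by simp

lemma morphism_maps: "morphism d M N f \<Longrightarrow> p \<in> carrier_vec d \<Longrightarrow> x \<in> sp M p \<Longrightarrow> f p x \<in> sp N p"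
  unfolding morphism_def linear_between_def by blast

lemma isomorphic_trans:
  assumes "isomorphic d L M" "isomorphic d M N"
  shows "isomorphic d L N"
proof -
  from assms obtain f f' g g' where m: "morphism d L M f" "morphism d M L f'"
    "morphism d M N g" "morphism d N M g'"
    and i: "\<forall>p\<in>carrier_vec d. (\<forall>x\<in>sp L p. f' p (f p x) = x) \<and> (\<forall>y\<in>sp M p. f p (f' p y) = y)"
      "\<forall>p\<in>carrier_vec d. (\<forall>x\<in>sp M p. g' p (g p x) = x) \<and> (\<forall>y\<in>sp N p. g p (g' p y) = y)"
    unfolding isomorphic_def by blast
  show ?thesis
    unfolding isomorphic_def
  proof (intro exI conjI ballI)
    show "morphism d L N (\<lambda>p x. g p (f p x))" "morphism d N L (\<lambda>p x. f' p (g' p x))"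
      by (rule morphism_comp[OF m(1,3)], rule morphism_comp[OF m(4,2)])
  qed (use i morphism_maps[OF m(1)] morphism_maps[OF m(4)] in auto)
qed

lemma isomorphic_refl: "pmodule d M \<Longrightarrow> isomorphic d M M"
  unfolding isomorphic_def
  by (intro exI[of _ "\<lambda>_ x. x"]) (auto simp: morphism_def linear_between_def pmodule_def)

lemma diag_add_diag: "p \<in> carrier_vec d \<Longrightarrow> p + diag d \<epsilon> + diag d \<epsilon> = p + diag d (2 * \<epsilon>)"
  by (auto simp: diag_def)

lemma interleaved_isomorphic:
  assumes "isomorphic d M M'" "interleaved d \<epsilon> M N"
  shows "interleaved d \<epsilon> M' N"
proof -
  from assms(1) obtain f g where m: "morphism d M M' f" "morphism d M' M g"
    and fg: "\<And>p x. p \<in> carrier_vec d \<Longrightarrow> x \<in> sp M p \<Longrightarrow> g p (f p x) = x"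
      "\<And>p y. p \<in> carrier_vec d \<Longrightarrow> y \<in> sp M' p \<Longrightarrow> f p (g p y) = y"
    unfolding isomorphic_def by blast
  obtain \<phi> \<psi> where e: "0 \<le> \<epsilon>" and
    mor: "morphism d M (shift d \<epsilon> N) \<phi>" "morphism d N (shift d \<epsilon> M) \<psi>" and
    inv: "\<And>p x. p \<in> carrier_vec d \<Longrightarrow> x \<in> sp M p \<Longrightarrow>
        \<psi> (p + diag d \<epsilon>) (\<phi> p x) = tr M p (p + diag d (2 * \<epsilon>)) x"
      "\<And>p y. p \<in> carrier_vec d \<Longrightarrow> y \<in> sp N p \<Longrightarrow>
        \<phi> (p + diag d \<epsilon>) (\<psi> p y) = tr N p (p + diag d (2 * \<epsilon>)) y"
    by (rule interleavedE[OF assms(2)]) (rule that; assumption)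
  have c: "p + diag d r \<in> carrier_vec d" if "p \<in> carrier_vec d" for p r
    using that by simp
  have le: "p \<le> p + diag d (2 * \<epsilon>)" if "p \<in> carrier_vec d" for p
    using that e by (auto simp: less_eq_vec_def diag_def)
  have le2: "p + diag d \<epsilon> \<le> q + diag d \<epsilon>" if "p \<in> carrier_vec d" "q \<in> carrier_vec d" "p \<le> q" for p q
    using that by (auto simp: less_eq_vec_def diag_def)
  have sh: "morphism d (shift d \<epsilon> M) (shift d \<epsilon> M') (\<lambda>p. f (p + diag d \<epsilon>))"
    using m(1) c le2 unfolding morphism_def by simp
  show ?thesis unfolding interleaved_def
  proof (intro conjI exI ballI)
    show "morphism d M' (shift d \<epsilon> N) (\<lambda>p x. \<phi> p (g p x))"
      by (rule morphism_comp[OF m(2) mor(1)])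
    show "morphism d N (shift d \<epsilon> M') (\<lambda>p x. f (p + diag d \<epsilon>) (\<psi> p x))"
      by (rule morphism_comp[OF mor(2) sh])
    fix p :: "real vec" assume p: "p \<in> carrier_vec d"
    show "f (p + diag d \<epsilon> + diag d \<epsilon>) (\<psi> (p + diag d \<epsilon>) (\<phi> p (g p x))) =
        tr M' p (p + diag d (2 * \<epsilon>)) x" if x: "x \<in> sp M' p" for x
    proof -
      have g: "g p x \<in> sp M p" by (rule morphism_maps[OF m(2) p x])
      then show ?thesis
        using inv(1)[OF p g] morphismD(2)[OF m(1) p c[OF p] le[OF p] g] fg(2)[OF p x]
        by (simp add: diag_add_diag[OF p])
    qed
    show "\<phi> (p + diag d \<epsilon>) (g (p + diag d \<epsilon>) (f (p + diag d \<epsilon>) (\<psi> p y))) =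
        tr N p (p + diag d (2 * \<epsilon>)) y" if y: "y \<in> sp N p" for y
    proof -
      have "\<psi> p y \<in> sp M (p + diag d \<epsilon>)"
        using morphism_maps[OF mor(2) p y] by simp
      then show ?thesis using inv(2)[OF p y] fg(1)[OF c[OF p]] by simp
    qed
  qed (rule e)
qed

lemma interleaved_sym: "interleaved d \<epsilon> M N \<Longrightarrow> interleaved d \<epsilon> N M"
  unfolding interleaved_def by blast

lemma interleaved_cong:
  assumes "isomorphic d M M'" "isomorphic d N N'"
  shows "interleaved d \<epsilon> M N \<longleftrightarrow> interleaved d \<epsilon> M' N'"
  using assms interleaved_isomorphic interleaved_sym isomorphic_sym by metis

text \<open>For sums of finitely generated upset modules the interleaving distance is attained, so this says
  that nonisomorphic ones have positive distance.\<close>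

lemma isomorphic_iff_interleaved_zero:
  assumes "pmodule d M" "pmodule d N"
  shows "isomorphic d M N \<longleftrightarrow> interleaved d 0 M N"
proof -
  have t: "tr M p p x = x" if "p \<in> carrier_vec d" "x \<in> sp M p" for p x
    using assms(1) that unfolding pmodule_def by blast
  have t': "tr N p p x = x" if "p \<in> carrier_vec d" "x \<in> sp N p" for p x
    using assms(2) that unfolding pmodule_def by blast
  show ?thesis
    unfolding isomorphic_def interleaved_def morphism_shift_zero
    by (simp add: t t' cong: ball_cong)
qed

text \<open>Inputs may contain empty lists of points, whose upset modules are zero. The CI problem of an
  interleaving has to be indexed by the nonzero summands only.\<close>

lemma usum_filter_isomorphic:
  assumes "\<And>U. U \<in> set Us \<Longrightarrow> upset d U"
  shows "isomorphic d (usum Us :: ('k::field, _) pmod) (usum (filter (\<lambda>U. U \<noteq> {}) Us))"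
proof -
  define Vs where "Vs = filter (\<lambda>U. U \<noteq> {}) Us"
  define idx where "idx = filter (\<lambda>i. Us ! i \<noteq> {}) [0..<length Us]"
  have Vs: "Vs = map ((!) Us) idx"
    unfolding Vs_def idx_def by (subst map_nth[of Us, symmetric], subst filter_map) (simp add: comp_def)
  have idx: "distinct idx" "set idx = nonempty_indices Us"
    unfolding idx_def by (auto simp: nonempty_indices_def)
  define \<tau> where "\<tau> i = (THE m. m < length idx \<and> idx ! m = i)" for i
  have \<tau>: "\<tau> (idx ! m) = m" if "m < length idx" for m
    unfolding \<tau>_def by (rule the_equality) (use that idx(1) nth_eq_iff_index_eq in blast)+
  define f where "f x = (\<lambda>(m, u). if m < length idx then x (idx ! m, u) else 0)" for x :: "nat \<times> unit \<Rightarrow> 'k"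
  define g where "g y = (\<lambda>(i, u). if i \<in> set idx then y (\<tau> i, u) else 0)" for y :: "nat \<times> unit \<Rightarrow> 'k"
  have fm: "f x \<in> sp (usum Vs) p" if "x \<in> sp (usum Us) p" for x p
    using that unfolding sp_usum f_def by (auto simp: Vs split: if_splits)
  have gm: "g y \<in> sp (usum Us) p" if "y \<in> sp (usum Vs) p" for y p
    unfolding sp_usum
  proof (intro allI impI)
    fix i assume "g y (i, ()) \<noteq> 0"
    then have i: "i \<in> set idx" "y (\<tau> i, ()) \<noteq> 0" by (auto simp: g_def split: if_splits)
    then obtain m where m: "m < length idx" "i = idx ! m" by (metis in_set_conv_nth)
    then show "i < length Us \<and> p \<in> Us ! i"
      using i that \<tau>[OF m(1)] idx(2) unfolding sp_usum by (auto simp: Vs nonempty_indices_def)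
  qed
  have gf: "g (f x) = x" if "x \<in> sp (usum Us) p" for x p
  proof (rule fun_eq_units)
    fix i
    show "g (f x) (i, ()) = x (i, ())"
    proof (cases "i \<in> set idx")
      case True
      then obtain m where "m < length idx" "i = idx ! m" by (metis in_set_conv_nth)
      then show ?thesis using \<tau> by (simp add: f_def g_def)
    next
      case False
      then show ?thesis using that unfolding idx(2) sp_usum by (auto simp: g_def idx(2) nonempty_indices_def)
    qed
  qed
  have fg: "f (g y) = y" if "y \<in> sp (usum Vs) p" for y p
  proof (rule fun_eq_units)
    fix m
    show "f (g y) (m, ()) = y (m, ())"
      using that \<tau> unfolding sp_usum by (auto simp: f_def g_def Vs)
  qed
  have "isomorphic d (usum Us :: ('k, _) pmod) (usum Vs)"
    unfolding isomorphic_def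
    by (intro exI[of _ "\<lambda>_. f"] exI[of _ "\<lambda>_. g"])
       (auto simp: morphism_def linear_between_def fm gm gf fg tr_usum,
        auto simp: f_def g_def fscale_def fun_eq_iff)
  then show ?thesis unfolding Vs_def .
qed

section \<open>Decompositions\<close>

text \<open>A direct sum decomposition in terms of inclusions \<open>u\<close> and projections \<open>v\<close>, which compose well with
  other homomorphisms, in contrast to the explicit index pairs of \<open>direct_sum\<close>.\<close>

definition decomposes where
  "decomposes d M Xs u v \<longleftrightarrow>
     (\<forall>j<length Xs. morphism d (Xs ! j) M (u j) \<and> morphism d M (Xs ! j) (v j)) \<and>
     (\<forall>p\<in>carrier_vec d. \<forall>j<length Xs. \<forall>l<length Xs. \<forall>x\<in>sp (Xs ! l) p.
        v j p (u l p x) = (if j = l then x else 0)) \<and>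
     (\<forall>p\<in>carrier_vec d. \<forall>m\<in>sp M p. (\<Sum>j<length Xs. u j p (v j p m)) = m)"

lemma sum_fun_apply: "(\<Sum>j\<in>F. h j) x = (\<Sum>j\<in>F. h j x)" for h :: "'a \<Rightarrow> 'b \<Rightarrow> 'c::comm_monoid_add"
  by (induction F rule: infinite_finite_induct) auto

lemma pmodule_zero: "pmodule d M \<Longrightarrow> p \<in> carrier_vec d \<Longrightarrow> 0 \<in> sp M p"
  and pmodule_add: "pmodule d M \<Longrightarrow> p \<in> carrier_vec d \<Longrightarrow> x \<in> sp M p \<Longrightarrow> y \<in> sp M p \<Longrightarrow> x + y \<in> sp M p"
  and pmodule_scale: "pmodule d M \<Longrightarrow> p \<in> carrier_vec d \<Longrightarrow> x \<in> sp M p \<Longrightarrow> fscale c x \<in> sp M p"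
  for M :: "('k::field, 'i) pmod"
proof -
  interpret V: vector_space "fscale :: 'k \<Rightarrow> ('i \<Rightarrow> 'k) \<Rightarrow> 'i \<Rightarrow> 'k" by (rule vector_space_fscale)
  have S: "pmodule d M \<Longrightarrow> p \<in> carrier_vec d \<Longrightarrow> V.subspace (sp M p)"
    by (simp add: pmodule_def)
  show "pmodule d M \<Longrightarrow> p \<in> carrier_vec d \<Longrightarrow> 0 \<in> sp M p"
    by (rule V.subspace_0[OF S])
  show "pmodule d M \<Longrightarrow> p \<in> carrier_vec d \<Longrightarrow> x \<in> sp M p \<Longrightarrow> y \<in> sp M p \<Longrightarrow> x + y \<in> sp M p"
    by (rule V.subspace_add[OF S])
  show "pmodule d M \<Longrightarrow> p \<in> carrier_vec d \<Longrightarrow> x \<in> sp M p \<Longrightarrow> fscale c x \<in> sp M p"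
    by (rule V.subspace_scale[OF S])
qed

lemma fscale_zero [simp]: "fscale 0 x = 0" "fscale c 0 = 0"
  by (simp_all add: fscale_def fun_eq_iff)

lemma pmodule_tr:
  assumes "pmodule d M" "p \<in> carrier_vec d" "q \<in> carrier_vec d" "p \<le> q"
  shows "linear_between (sp M p) (sp M q) (tr M p q)"
  using assms unfolding pmodule_def by blast

lemma linear_between_zero: "linear_between V W f \<Longrightarrow> 0 \<in> V \<Longrightarrow> f 0 = 0"
proof -
  assume "linear_between V W f" "0 \<in> V"
  then have "f (fscale 0 0) = fscale 0 (f 0)" by (rule linear_betweenD(3))
  then show "f 0 = 0" unfolding fscale_zero .
qed

lemma pmodule_sum:
  assumes "pmodule d M" "p \<in> carrier_vec d" "\<And>j. j \<in> F \<Longrightarrow> h j \<in> sp M p"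
  shows "(\<Sum>j\<in>F. h j) \<in> sp M p"
  using assms(3)
  by (induction F rule: infinite_finite_induct) (auto intro: pmodule_zero[OF assms(1,2)] pmodule_add[OF assms(1,2)])

lemma linear_between_sum:
  assumes M: "pmodule d M" "p \<in> carrier_vec d" and f: "linear_between (sp M p) W f"
    and "finite F" "\<And>j. j \<in> F \<Longrightarrow> h j \<in> sp M p"
  shows "f (\<Sum>j\<in>F. h j) = (\<Sum>j\<in>F. f (h j))"
  using assms(4,5)
proof (induction F rule: finite_induct)
  case empty
  then show ?case using linear_between_zero[OF f pmodule_zero[OF M]] by (simp only: sum.empty)
next
  case (insert j F)
  have "(\<Sum>j\<in>F. h j) \<in> sp M p" by (rule pmodule_sum[OF M]) (use insert in auto)
  then have "f (h j + (\<Sum>j\<in>F. h j)) = f (h j) + f (\<Sum>j\<in>F. h j)"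
    by (rule linear_betweenD(2)[OF f, rotated]) (use insert.prems in blast)
  also have "f (\<Sum>j\<in>F. h j) = (\<Sum>j\<in>F. f (h j))"
    by (rule insert.IH) (use insert.prems in blast)
  finally show ?case unfolding sum.insert[OF insert.hyps] .
qed

lemma sp_direct_sum:
  "h \<in> sp (direct_sum Xs) p \<longleftrightarrow>
    (\<forall>j<length Xs. (\<lambda>i. h (j, i)) \<in> sp (Xs ! j) p) \<and> (\<forall>j\<ge>length Xs. \<forall>i. h (j, i) = 0)"
  by (simp add: direct_sum_def)

lemma tr_direct_sum:
  "tr (direct_sum Xs) p q h = (\<lambda>(j, i). if j < length Xs then tr (Xs ! j) p q (\<lambda>i. h (j, i)) i else 0)"
  by (simp add: direct_sum_def)

lemma isomorphic_direct_sumE: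
  fixes M :: "('k::field, 'i) pmod" and Xs :: "('k, 'j) pmod list"
  assumes iso: "isomorphic d M (direct_sum Xs)" and X: "\<And>X. X \<in> set Xs \<Longrightarrow> pmodule d X"
  obtains u v where "decomposes d M Xs u v"
proof -
  let ?S = "direct_sum Xs"
  have S: "pmodule d ?S" by (rule pmodule_direct_sum[OF X])
  have Xj: "pmodule d (Xs ! j)" if "j < length Xs" for j using X that by simp
  from iso obtain f g where m: "morphism d M ?S f" "morphism d ?S M g"
    and fg: "\<forall>p\<in>carrier_vec d. (\<forall>x\<in>sp M p. g p (f p x) = x) \<and> (\<forall>y\<in>sp ?S p. f p (g p y) = y)"
    unfolding isomorphic_def by blast
  define inj where "inj j y = (\<lambda>(l, i). if l = j then y i else 0)" for j :: nat and y :: "'j \<Rightarrow> 'k"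
  define prj where "prj j h = (\<lambda>i. h (j, i))" for j :: nat and h :: "nat \<times> 'j \<Rightarrow> 'k"
  have inj_in: "inj j y \<in> sp ?S p" if "j < length Xs" "p \<in> carrier_vec d" "y \<in> sp (Xs ! j) p" for j p y
    unfolding sp_direct_sum
  proof (intro conjI allI impI)
    fix l assume l: "l < length Xs"
    have "(\<lambda>i. inj j y (l, i)) = (if l = j then y else 0)" by (auto simp: inj_def zero_fun_def)
    then show "(\<lambda>i. inj j y (l, i)) \<in> sp (Xs ! l) p"
      using that pmodule_zero[OF Xj[OF l] that(2)] by simp
  qed (use that in \<open>auto simp: inj_def\<close>)
  have inj: "morphism d (Xs ! j) ?S (\<lambda>_. inj j)" if j: "j < length Xs" for j
    unfolding morphism_def
  proof (intro conjI ballI impI)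
    fix p :: "real vec" assume "p \<in> carrier_vec d"
    then show "linear_between (sp (Xs ! j) p) (sp ?S p) (inj j)"
      unfolding linear_between_def using inj_in[OF j] by (auto simp: inj_def fscale_def fun_eq_iff)
  next
    fix p q :: "real vec" and x
    assume pq: "p \<in> carrier_vec d" "q \<in> carrier_vec d" "p \<le> q" "x \<in> sp (Xs ! j) p"
    show "inj j (tr (Xs ! j) p q x) = tr ?S p q (inj j x)"
    proof (rule ext, clarify)
      fix l i
      have "(\<lambda>i. inj j x (l, i)) = (if l = j then x else 0)" by (auto simp: inj_def zero_fun_def)
      moreover have "l < length Xs \<Longrightarrow> tr (Xs ! l) p q 0 = 0"
        using linear_between_zero[OF pmodule_tr[OF Xj pq(1-3)] pmodule_zero[OF Xj pq(1)]] by blast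
      ultimately show "inj j (tr (Xs ! j) p q x) (l, i) = tr ?S p q (inj j x) (l, i)"
        using j by (auto simp: tr_direct_sum inj_def)
    qed
  qed
  have prj: "morphism d ?S (Xs ! j) (\<lambda>_. prj j)" if j: "j < length Xs" for j
    unfolding morphism_def linear_between_def using j
    by (auto simp: sp_direct_sum tr_direct_sum prj_def fscale_def plus_fun_def)
  have prj_inj: "prj j (inj l y) = (if j = l then y else 0)" for j l y
    by (auto simp: prj_def inj_def zero_fun_def)
  have sum: "(\<Sum>j<length Xs. inj j (prj j h)) = h" if "h \<in> sp ?S p" for h p
  proof (rule ext, clarify)
    fix l i
    have "(\<Sum>j<length Xs. inj j (prj j h)) (l, i) = (\<Sum>j<length Xs. if l = j then h (l, i) else 0)"
      unfolding sum_fun_apply by (rule sum.cong) (auto simp: inj_def prj_def)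
    then show "(\<Sum>j<length Xs. inj j (prj j h)) (l, i) = h (l, i)"
      using that unfolding sp_direct_sum by auto
  qed
  show ?thesis
  proof (rule that[of "\<lambda>j p x. g p (inj j x)" "\<lambda>j p x. prj j (f p x)"], unfold decomposes_def, intro conjI allI impI ballI)
    fix j assume j: "j < length Xs"
    show "morphism d (Xs ! j) M (\<lambda>p x. g p (inj j x))" by (rule morphism_comp[OF inj[OF j] m(2)])
    show "morphism d M (Xs ! j) (\<lambda>p x. prj j (f p x))" by (rule morphism_comp[OF m(1) prj[OF j]])
  next
    fix p :: "real vec" and j l x
    assume "p \<in> carrier_vec d" "j < length Xs" "l < length Xs" "x \<in> sp (Xs ! l) p"
    then show "prj j (f p (g p (inj l x))) = (if j = l then x else 0)"
      using fg inj_in prj_inj by simp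
  next
    fix p :: "real vec" and x assume p: "p \<in> carrier_vec d" and x: "x \<in> sp M p"
    have fx: "f p x \<in> sp ?S p" by (rule morphism_maps[OF m(1) p x])
    have "(\<Sum>j<length Xs. g p (inj j (prj j (f p x)))) = g p (\<Sum>j<length Xs. inj j (prj j (f p x)))"
      by (rule linear_between_sum[OF S p morphismD(1)[OF m(2) p], symmetric])
         (use inj_in[OF _ p] morphism_maps[OF prj p fx] in auto)
    also have "\<dots> = x" using sum[OF fx] fg p x by simp
    finally show "(\<Sum>j<length Xs. g p (inj j (prj j (f p x)))) = x" .
  qed
qed

lemma decomposes_isomorphic:
  fixes M :: "('k::field, 'i) pmod" and Xs :: "('k, 'j) pmod list"
  assumes dec: "decomposes d M Xs u v" and M: "pmodule d M" and X: "\<And>X. X \<in> set Xs \<Longrightarrow> pmodule d X"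
  shows "isomorphic d M (direct_sum Xs)"
proof -
  let ?S = "direct_sum Xs" and ?n = "length Xs"
  have um: "morphism d (Xs ! j) M (u j)" and vm: "morphism d M (Xs ! j) (v j)" if "j < ?n" for j
    using dec that unfolding decomposes_def by blast+
  have vu: "v j p (u l p x) = (if j = l then x else 0)"
    if "p \<in> carrier_vec d" "j < ?n" "l < ?n" "x \<in> sp (Xs ! l) p" for p j l x
    using dec that unfolding decomposes_def by blast
  have sum: "(\<Sum>j<?n. u j p (v j p m)) = m" if "p \<in> carrier_vec d" "m \<in> sp M p" for p m
    using dec that unfolding decomposes_def by blast
  have S: "pmodule d ?S" by (rule pmodule_direct_sum[OF X])
  define f where "f p x = (\<lambda>(j, i). if j < ?n then v j p x i else 0)" for p x
  define g where "g p h = (\<Sum>j<?n. u j p (\<lambda>i. h (j, i)))" for p h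
  have f1: "(\<lambda>i. f p x (j, i)) = v j p x" if "j < ?n" for p x j using that by (simp add: f_def)
  have fin: "f p x \<in> sp ?S p" if "p \<in> carrier_vec d" "x \<in> sp M p" for p x
    unfolding sp_direct_sum using f1 morphism_maps[OF vm that] by (auto simp: f_def)
  have comp: "(\<lambda>i. h (j, i)) \<in> sp (Xs ! j) p" if "h \<in> sp ?S p" "j < ?n" for h j p
    using that unfolding sp_direct_sum by blast
  have gin: "g p h \<in> sp M p" if "p \<in> carrier_vec d" "h \<in> sp ?S p" for p h
    unfolding g_def by (rule pmodule_sum[OF M that(1)]) (use morphism_maps[OF um that(1)] comp[OF that(2)] in auto)
  have fm: "morphism d M ?S f"
    unfolding morphism_def
  proof (intro conjI ballI impI)
    fix p :: "real vec" assume p: "p \<in> carrier_vec d"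
    show "linear_between (sp M p) (sp ?S p) (f p)"
      unfolding linear_between_def
    proof (intro conjI ballI allI)
      fix x y a assume x: "x \<in> sp M p"
      show "f p x \<in> sp ?S p" by (rule fin[OF p x])
      show "f p (fscale a x) = fscale a (f p x)"
        using linear_betweenD(3)[OF morphismD(1)[OF vm p] x] by (auto simp: f_def fscale_def fun_eq_iff)
      assume y: "y \<in> sp M p"
      show "f p (x + y) = f p x + f p y"
        using linear_betweenD(2)[OF morphismD(1)[OF vm p] x y] by (auto simp: f_def fun_eq_iff)
    qed
  next
    fix p q :: "real vec" and x
    assume pq: "p \<in> carrier_vec d" "q \<in> carrier_vec d" "p \<le> q" "x \<in> sp M p"
    show "f q (tr M p q x) = tr ?S p q (f p x)"
      using morphismD(2)[OF vm pq] f1 by (auto simp: tr_direct_sum f_def fun_eq_iff)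
  qed
  have gm: "morphism d ?S M g"
    unfolding morphism_def
  proof (intro conjI ballI impI)
    fix p :: "real vec" assume p: "p \<in> carrier_vec d"
    show "linear_between (sp ?S p) (sp M p) (g p)"
      unfolding linear_between_def
    proof (intro conjI ballI allI)
      fix x y a assume x: "x \<in> sp ?S p"
      show "g p x \<in> sp M p" by (rule gin[OF p x])
      have "u j p (\<lambda>i. fscale a x (j, i)) = fscale a (u j p (\<lambda>i. x (j, i)))" if "j < ?n" for j
        using linear_betweenD(3)[OF morphismD(1)[OF um[OF that] p] comp[OF x that]]
        by (simp add: fscale_def)
      then show "g p (fscale a x) = fscale a (g p x)"
        by (simp add: g_def fun_eq_iff sum_fun_apply fscale_def sum_distrib_left)
      assume y: "y \<in> sp ?S p"
      have "u j p (\<lambda>i. (x + y) (j, i)) = u j p (\<lambda>i. x (j, i)) + u j p (\<lambda>i. y (j, i))" if "j < ?n" for j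
        using linear_betweenD(2)[OF morphismD(1)[OF um[OF that] p] comp[OF x that] comp[OF y that]]
        by (simp add: plus_fun_def)
      then show "g p (x + y) = g p x + g p y"
        by (simp add: g_def sum.distrib del: plus_fun_apply)
    qed
  next
    fix p q :: "real vec" and h
    assume pq: "p \<in> carrier_vec d" "q \<in> carrier_vec d" "p \<le> q" "h \<in> sp ?S p"
    have "tr M p q (g p h) = (\<Sum>j<?n. tr M p q (u j p (\<lambda>i. h (j, i))))"
      unfolding g_def
      by (rule linear_between_sum[OF M pq(1) pmodule_tr[OF M pq(1-3)]])
         (use morphism_maps[OF um pq(1)] comp[OF pq(4)] in auto)
    also have "\<dots> = (\<Sum>j<?n. u j q (\<lambda>i. tr ?S p q h (j, i)))"
      by (rule sum.cong) (use morphismD(2)[OF um pq(1-3)] comp[OF pq(4)] in \<open>auto simp: tr_direct_sum\<close>)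
    finally show "g q (tr ?S p q h) = tr M p q (g p h)" by (simp add: g_def)
  qed
  have "g p (f p x) = x" if "p \<in> carrier_vec d" "x \<in> sp M p" for p x
    using sum[OF that] f1 by (simp add: g_def)
  moreover have "f p (g p h) = h" if p: "p \<in> carrier_vec d" and h: "h \<in> sp ?S p" for p h
  proof (rule ext, clarify)
    fix j i
    show "f p (g p h) (j, i) = h (j, i)"
    proof (cases "j < ?n")
      case True
      have "v j p (g p h) = (\<Sum>l<?n. v j p (u l p (\<lambda>i. h (l, i))))"
        unfolding g_def
        by (rule linear_between_sum[OF M p morphismD(1)[OF vm[OF True] p]])
           (use morphism_maps[OF um p] comp[OF h] in auto)
      also have "\<dots> = (\<Sum>l<?n. if j = l then (\<lambda>i. h (l, i)) else 0)"
        by (rule sum.cong) (use vu[OF p True] comp[OF h] in auto)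
      also have "\<dots> = (\<lambda>i. h (j, i))" using True by simp
      finally show ?thesis using True by (simp add: f_def)
    next
      case False
      then show ?thesis using h by (simp add: f_def sp_direct_sum)
    qed
  qed
  ultimately show ?thesis unfolding isomorphic_def using fm gm by blast
qed

text \<open>\<open>X\<close> is the sum of a copy of its retract \<open>W\<close> and the kernel of \<open>\<alpha>\<close>. As \<open>X\<close> is indecomposable and
  \<open>W\<close> is not zero, the kernel vanishes.\<close>

lemma retract_isomorphic:
  fixes X W :: "('k::field, 'i) pmod"
  assumes X: "pmodule d X" and W: "pmodule d W" and ind: "indecomposable d X"
    and a: "morphism d X W \<alpha>" and b: "morphism d W X \<beta>"
    and ab: "\<And>p y. p \<in> carrier_vec d \<Longrightarrow> y \<in> sp W p \<Longrightarrow> \<alpha> p (\<beta> p y) = y"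
    and nz: "\<not> zero_module d W"
  shows "isomorphic d X W"
proof -
  interpret V: vector_space "fscale :: 'k \<Rightarrow> ('i \<Rightarrow> 'k) \<Rightarrow> 'i \<Rightarrow> 'k" by (rule vector_space_fscale)
  define Z where "Z = \<lparr>sp = (\<lambda>p. {x \<in> sp X p. \<alpha> p x = 0}), tr = tr X\<rparr>"
  have Zsp: "x \<in> sp Z p \<longleftrightarrow> x \<in> sp X p \<and> \<alpha> p x = 0" for x p by (simp add: Z_def)
  have Ztr: "tr Z = tr X" by (simp add: Z_def)
  have al: "\<alpha> p 0 = 0" if "p \<in> carrier_vec d" for p
    by (rule linear_between_zero[OF morphismD(1)[OF a that] pmodule_zero[OF X that]])
  have bl: "\<beta> p 0 = 0" if "p \<in> carrier_vec d" for p
    by (rule linear_between_zero[OF morphismD(1)[OF b that] pmodule_zero[OF W that]])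
  have Z: "pmodule d Z"
    unfolding pmodule_def
  proof (intro conjI ballI impI)
    fix p :: "real vec" assume p: "p \<in> carrier_vec d"
    show "V.subspace (sp Z p)"
      unfolding V.subspace_def
      using al[OF p] pmodule_zero[OF X p] pmodule_add[OF X p] pmodule_scale[OF X p]
        linear_betweenD(2,3)[OF morphismD(1)[OF a p]]
      by (auto simp: Zsp)
    show "tr Z p p x = x" if "x \<in> sp Z p" for x
      using X p that unfolding pmodule_def Ztr Zsp by blast
  next
    fix p q :: "real vec" assume pq: "p \<in> carrier_vec d" "q \<in> carrier_vec d" "p \<le> q"
    have "\<alpha> q (tr X p q x) = 0" if "x \<in> sp X p" "\<alpha> p x = 0" for x
      using morphismD(2)[OF a pq that(1)] that(2)
        linear_between_zero[OF pmodule_tr[OF W pq] pmodule_zero[OF W pq(1)]] by simp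
    then show "linear_between (sp Z p) (sp Z q) (tr Z p q)"
      using pmodule_tr[OF X pq] unfolding linear_between_def Ztr by (simp add: Zsp)
  next
    fix p q r :: "real vec" and x
    assume "p \<in> carrier_vec d" "q \<in> carrier_vec d" "r \<in> carrier_vec d" "p \<le> q" "q \<le> r" "x \<in> sp Z p"
    then show "tr Z q r (tr Z p q x) = tr Z p r x"
      using X unfolding pmodule_def Ztr Zsp by blast
  qed
  define \<kappa> where "\<kappa> p x = x + fscale (-1) (\<beta> p (\<alpha> p x))" for p x
  have \<kappa>in: "\<kappa> p x \<in> sp Z p" if p: "p \<in> carrier_vec d" and x: "x \<in> sp X p" for p x
  proof -
    have ax: "\<alpha> p x \<in> sp W p" by (rule morphism_maps[OF a p x])
    have bax: "\<beta> p (\<alpha> p x) \<in> sp X p" by (rule morphism_maps[OF b p ax])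
    have "\<alpha> p (\<kappa> p x) = \<alpha> p x + fscale (-1) (\<alpha> p (\<beta> p (\<alpha> p x)))"
      unfolding \<kappa>_def linear_betweenD(2)[OF morphismD(1)[OF a p] x pmodule_scale[OF X p bax]]
        linear_betweenD(3)[OF morphismD(1)[OF a p] bax] ..
    also have "\<dots> = 0" unfolding ab[OF p ax] by (simp add: fscale_def fun_eq_iff)
    finally show ?thesis
      unfolding Zsp using pmodule_add[OF X p x pmodule_scale[OF X p bax]] unfolding \<kappa>_def by blast
  qed
  have bma: "morphism d X X (\<lambda>p x. \<beta> p (\<alpha> p x))" by (rule morphism_comp[OF a b])
  have \<kappa>m: "morphism d X Z \<kappa>"
    unfolding morphism_def
  proof (intro conjI ballI impI)
    fix p :: "real vec" assume p: "p \<in> carrier_vec d"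
    show "linear_between (sp X p) (sp Z p) (\<kappa> p)"
      unfolding linear_between_def
      using \<kappa>in[OF p] linear_betweenD(2,3)[OF morphismD(1)[OF bma p]]
      by (auto simp: \<kappa>_def fscale_def fun_eq_iff algebra_simps)
  next
    fix p q :: "real vec" and x
    assume pq: "p \<in> carrier_vec d" "q \<in> carrier_vec d" "p \<le> q" and x: "x \<in> sp X p"
    have bax: "\<beta> p (\<alpha> p x) \<in> sp X p" by (rule morphism_maps[OF bma pq(1) x])
    have "tr X p q (\<kappa> p x) = tr X p q x + fscale (-1) (tr X p q (\<beta> p (\<alpha> p x)))"
      unfolding \<kappa>_def linear_betweenD(2)[OF pmodule_tr[OF X pq] x pmodule_scale[OF X pq(1) bax]]
        linear_betweenD(3)[OF pmodule_tr[OF X pq] bax] ..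
    then show "\<kappa> q (tr X p q x) = tr Z p q (\<kappa> p x)"
      using morphismD(2)[OF bma pq x] by (simp add: \<kappa>_def Ztr)
  qed
  have incl: "morphism d Z X (\<lambda>_ x. x)"
    unfolding morphism_def linear_between_def Ztr by (auto simp: Zsp)
  define u where "u j = (if j = 0 then \<beta> else (\<lambda>_ x. x))" for j :: nat
  define v where "v j = (if j = 0 then \<alpha> else \<kappa>)" for j :: nat
  have dec: "decomposes d X [W, Z] u v"
    unfolding decomposes_def
  proof (intro conjI allI impI ballI)
    fix j assume "j < length [W, Z]"
    then have "j = 0 \<or> j = 1" by auto
    then show "morphism d ([W, Z] ! j) X (u j)" "morphism d X ([W, Z] ! j) (v j)"
      using a b \<kappa>m incl by (auto simp: u_def v_def)
  next
    fix p :: "real vec" and j l x assume p: "p \<in> carrier_vec d"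
      and "j < length [W, Z]" "l < length [W, Z]" and x: "x \<in> sp ([W, Z] ! l) p"
    then have "j = 0 \<or> j = 1" "l = 0 \<or> l = 1" by auto
    moreover have "\<kappa> p (\<beta> p y) = 0" if "y \<in> sp W p" for y
      unfolding \<kappa>_def ab[OF p that] by (simp add: fscale_def fun_eq_iff)
    moreover have "\<kappa> p y = y" if "y \<in> sp Z p" for y
    proof -
      have "\<alpha> p y = 0" using that Zsp by blast
      then show ?thesis by (simp add: \<kappa>_def bl[OF p])
    qed
    ultimately show "v j p (u l p x) = (if j = l then x else 0)"
      using x ab[OF p] by (auto simp: u_def v_def Zsp)
  next
    fix p :: "real vec" and x assume "p \<in> carrier_vec d" "x \<in> sp X p"
    have "(\<Sum>j<length [W, Z]. u j p (v j p x)) = \<beta> p (\<alpha> p x) + \<kappa> p x"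
      by (simp add: u_def v_def numeral_2_eq_2)
    then show "(\<Sum>j<length [W, Z]. u j p (v j p x)) = x"
      by (simp add: \<kappa>_def fscale_def fun_eq_iff)
  qed
  have "isomorphic d X (direct_sum [W, Z])"
    by (rule decomposes_isomorphic[OF dec X]) (use W Z in auto)
  then have "zero_module d Z" using ind W Z nz unfolding indecomposable_def by blast
  then have "\<beta> p (\<alpha> p x) = x" if "p \<in> carrier_vec d" "x \<in> sp X p" for p x
    using \<kappa>in[OF that] that unfolding zero_module_def by (auto simp: \<kappa>_def fscale_def fun_eq_iff)
  then show ?thesis unfolding isomorphic_def using a b ab by blast
qed

section \<open>Barcodes of sums of upset modules\<close>

lemma nonempty_indices_single: "U \<noteq> {} \<Longrightarrow> nonempty_indices [U] = {0}"
  by (auto simp: nonempty_indices_def)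

lemma upset_point: "upset d U \<Longrightarrow> U \<noteq> {} \<Longrightarrow> \<exists>p. p \<in> U \<and> p \<in> carrier_vec d"
  by (auto simp: upset_def)

lemma usum_single_not_zero: "upset d U \<Longrightarrow> U \<noteq> {} \<Longrightarrow> \<not> zero_module d (usum [U] :: ('k::field, _) pmod)"
proof
  assume U: "upset d U" "U \<noteq> {}" and z: "zero_module d (usum [U] :: ('k, _) pmod)"
  from upset_point[OF U] obtain p where p: "p \<in> U" "p \<in> carrier_vec d" by blast
  from p have "(unit_fun 0 :: _ \<Rightarrow> 'k) \<in> sp (usum [U]) p" by (intro unit_fun_in_sp) auto
  then have "(unit_fun 0 :: _ \<Rightarrow> 'k) = 0" using z p(2) unfolding zero_module_def by blast
  then have "(unit_fun 0 :: _ \<Rightarrow> 'k) (0, ()) = 0" by (simp only: zero_fun_apply)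
  then show False by simp
qed

lemma usum_single_isomorphic_iff:
  assumes "upset d U" "upset d V"
  shows "isomorphic d (usum [U] :: ('k::field, _) pmod) (usum [V] :: ('k, _) pmod) \<longleftrightarrow> U = V"
proof
  have sub: "U \<subseteq> V" if iso: "isomorphic d (usum [U] :: ('k, _) pmod) (usum [V] :: ('k, _) pmod)"
    and U: "upset d U" for U V
  proof
    fix p assume p: "p \<in> U"
    then have pc: "p \<in> carrier_vec d" using U unfolding upset_def by blast
    from iso obtain f g where fg: "morphism d (usum [U] :: ('k, _) pmod) (usum [V]) f"
      "morphism d (usum [V] :: ('k, _) pmod) (usum [U]) g"
      "\<forall>p\<in>carrier_vec d. \<forall>x\<in>sp (usum [U]) p. g p (f p x) = x"
      unfolding isomorphic_def by blast
    have u: "(unit_fun 0 :: _ \<Rightarrow> 'k) \<in> sp (usum [U]) p" using p by (intro unit_fun_in_sp) auto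
    show "p \<in> V"
    proof (rule ccontr)
      assume "p \<notin> V"
      then have "f p (unit_fun 0) = 0"
        using morphism_maps[OF fg(1) pc u] by (intro fun_eq_units) (auto simp: sp_usum)
      moreover have "0 \<in> sp (usum [V] :: ('k, _) pmod) p" by (simp add: sp_usum)
      then have "g p 0 = 0" by (rule linear_between_zero[OF morphismD(1)[OF fg(2) pc]])
      ultimately have "unit_fun 0 = (0 :: _ \<Rightarrow> 'k)" using fg(3) pc u by metis
      then have "(unit_fun 0 :: _ \<Rightarrow> 'k) (0, ()) = 0" by (simp only: zero_fun_apply)
      then show False by simp
    qed
  qed
  assume iso: "isomorphic d (usum [U] :: ('k, _) pmod) (usum [V] :: ('k, _) pmod)"
  show "U = V" using sub[OF iso assms(1)] sub[OF isomorphic_sym[OF iso] assms(2)] by blast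
next
  assume "U = V"
  then show "isomorphic d (usum [U] :: ('k, _) pmod) (usum [V] :: ('k, _) pmod)"
    using assms(1) by (auto intro!: isomorphic_refl pmodule_usum)
qed

lemma usum_isomorphic_direct_sum:
  assumes up: "\<And>U. U \<in> set Us \<Longrightarrow> upset d U"
  shows "isomorphic d (usum Us :: ('k::field, _) pmod) (direct_sum (map (\<lambda>U. usum [U]) Us))"
proof -
  let ?Xs = "map (\<lambda>U. usum [U]) Us :: ('k, nat \<times> unit) pmod list"
  define u where "u j p x = (\<lambda>(i, w). if i = j then x (0, w) else 0)" for j :: nat and p :: "real vec" and x :: "nat \<times> unit \<Rightarrow> 'k"
  define v where "v j p x = (\<lambda>(i :: nat, w). if i = 0 then x (j, w) else 0)" for j :: nat and p :: "real vec" and x :: "nat \<times> unit \<Rightarrow> 'k"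
  have um: "u j p x \<in> sp (usum Us) p" if "j < length Us" "x \<in> sp (usum [Us ! j]) p" for j p x
    using that unfolding sp_usum u_def by (auto split: if_splits)
  have vm: "v j p x \<in> sp (usum [Us ! j]) p" if "x \<in> sp (usum Us) p" for j p x
    using that unfolding sp_usum v_def by (auto split: if_splits)
  have "decomposes d (usum Us) ?Xs u v"
    unfolding decomposes_def
  proof (intro conjI allI impI ballI)
    fix j assume "j < length ?Xs"
    then have j: "j < length Us" by simp
    show "morphism d (?Xs ! j) (usum Us) (u j)"
      using j um[OF j] um[OF j, THEN tr_usum]
      by (auto simp: morphism_def linear_between_def tr_usum) (auto simp: u_def fscale_def fun_eq_iff)
    show "morphism d (usum Us) (?Xs ! j) (v j)"
      using j vm vm[THEN tr_usum]
      by (auto simp: morphism_def linear_between_def tr_usum) (auto simp: v_def fscale_def fun_eq_iff)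
  next
    fix p :: "real vec" and j l x
    assume "j < length ?Xs" "l < length ?Xs" "x \<in> sp (?Xs ! l) p"
    then show "v j p (u l p x) = (if j = l then x else 0)"
      by (intro fun_eq_units) (auto simp: v_def u_def sp_usum)
  next
    fix p and m :: "nat \<times> unit \<Rightarrow> 'k" assume m: "m \<in> sp (usum Us) p"
    show "(\<Sum>j<length ?Xs. u j p (v j p m)) = m"
    proof (rule fun_eq_units)
      fix i
      have "(\<Sum>j<length ?Xs. u j p (v j p m)) (i, ()) = (\<Sum>j<length Us. if i = j then m (i, ()) else 0)"
        unfolding sum_fun_apply by (rule sum.cong) (auto simp: u_def v_def)
      also have "\<dots> = m (i, ())" using m by (auto simp: sp_usum)
      finally show "(\<Sum>j<length ?Xs. u j p (v j p m)) (i, ()) = m (i, ())" .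
    qed
  qed
  then show ?thesis
    by (rule decomposes_isomorphic) (auto intro!: pmodule_usum up)
qed

lemma count_mset_card: "count (mset xs) c = card {i. i < length xs \<and> xs ! i = c}"
  by (simp add: count_mset count_list_eq_length_filter length_filter_conv_card eq_commute[of c])

lemma decomposition_matrices:
  fixes Xs :: "('k::field, 'i) pmod list"
  assumes up: "\<And>U. U \<in> set Us \<Longrightarrow> upset d U \<and> U \<noteq> {}" and dec: "decomposes d (usum Us) Xs u v"
  obtains E where "\<And>j p x. j < length Xs \<Longrightarrow> p \<in> carrier_vec d \<Longrightarrow> x \<in> sp (usum Us) p \<Longrightarrow>
      u j p (v j p x) = mat_act {..<length Us} (E j) x"
proof -
  let ?M = "usum Us :: ('k, nat \<times> unit) pmod"
  have I: "nonempty_indices Us = {..<length Us}" using up by (auto simp: nonempty_indices_def)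
  have "\<forall>j. \<exists>e. j < length Xs \<longrightarrow> (\<forall>p\<in>carrier_vec d. \<forall>x\<in>sp ?M p. u j p (v j p x) = mat_act {..<length Us} e x)"
  proof
    fix j
    show "\<exists>e. j < length Xs \<longrightarrow> (\<forall>p\<in>carrier_vec d. \<forall>x\<in>sp ?M p. u j p (v j p x) = mat_act {..<length Us} e x)"
    proof (cases "j < length Xs")
      case True
      then have "morphism d (Xs ! j) ?M (u j)" "morphism d ?M (Xs ! j) (v j)"
        using dec unfolding decomposes_def by blast+
      then have "morphism d ?M (shift d 0 ?M) (\<lambda>p x. u j p (v j p x))"
        unfolding morphism_shift_zero by (rule morphism_comp[rotated])
      then obtain e where "\<And>p x. p \<in> carrier_vec d \<Longrightarrow> x \<in> sp ?M p \<Longrightarrow> u j p (v j p x) = mat_act {..<length Us} e x"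
        by (rule morphism_feasible[rotated, unfolded I]) (use up in \<open>auto simp: I\<close>)
      then show ?thesis by blast
    qed simp
  qed
  from choice[OF this] that show thesis by blast
qed

text \<open>The endomorphisms \<open>E\<^sub>j = u\<^sub>j v\<^sub>j\<close> are nonzero orthogonal idempotents acting on a space of dimension
  \<open>length Us\<close>. A nonzero vector \<open>w\<^sub>l\<close> is chosen in the image of each \<open>E\<^sub>l\<close>, and a coordinate \<open>c\<^sub>j\<close> in
  which \<open>w\<^sub>j\<close> does not vanish. The scaled rows \<open>c\<^sub>j\<close> of the \<open>E\<^sub>j\<close> and the columns \<open>w\<^sub>l\<close> then factor an
  identity matrix of size \<open>length Xs\<close> through \<open>length Us\<close>.\<close>

lemma decomposition_length_le:
  fixes Xs :: "('k::field, 'i) pmod list"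
  assumes up: "\<And>U. U \<in> set Us \<Longrightarrow> upset d U \<and> U \<noteq> {}"
    and X: "\<And>X. X \<in> set Xs \<Longrightarrow> pmodule d X \<and> \<not> zero_module d X"
    and dec: "decomposes d (usum Us) Xs u v"
  shows "length Xs \<le> length Us"
proof -
  let ?M = "usum Us :: ('k, nat \<times> unit) pmod"
  have um: "morphism d (Xs ! j) ?M (u j)" and vm: "morphism d ?M (Xs ! j) (v j)" if "j < length Xs" for j
    using dec that unfolding decomposes_def by blast+
  have vu: "v j p (u l p x) = (if j = l then x else 0)"
    if "p \<in> carrier_vec d" "j < length Xs" "l < length Xs" "x \<in> sp (Xs ! l) p" for p j l x
    using dec that unfolding decomposes_def by blast
  obtain E where E: "\<And>j p x. j < length Xs \<Longrightarrow> p \<in> carrier_vec d \<Longrightarrow> x \<in> sp ?M p \<Longrightarrow>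
      u j p (v j p x) = mat_act {..<length Us} (E j) x"
    by (rule decomposition_matrices[OF up dec]) (assumption, rule that)
  have "\<forall>j<length Xs. \<exists>p x. p \<in> carrier_vec d \<and> x \<in> sp (Xs ! j) p \<and> x \<noteq> 0"
  proof (intro allI impI)
    fix j assume "j < length Xs"
    then have "pmodule d (Xs ! j)" "\<not> zero_module d (Xs ! j)" using X by auto
    then show "\<exists>p x. p \<in> carrier_vec d \<and> x \<in> sp (Xs ! j) p \<and> x \<noteq> 0"
      unfolding zero_module_def using pmodule_zero by blast
  qed
  then have "\<forall>j. \<exists>px. j < length Xs \<longrightarrow> fst px \<in> carrier_vec d \<and> snd px \<in> sp (Xs ! j) (fst px) \<and> snd px \<noteq> 0"
    by (metis fst_conv snd_conv)
  from choice[OF this] obtain px where px': "\<forall>j. j < length Xs \<longrightarrow>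
      fst (px j) \<in> carrier_vec d \<and> snd (px j) \<in> sp (Xs ! j) (fst (px j)) \<and> snd (px j) \<noteq> 0" ..
  define p x where "p j = fst (px j)" and "x j = snd (px j)" for j
  have px: "p j \<in> carrier_vec d \<and> x j \<in> sp (Xs ! j) (p j) \<and> x j \<noteq> 0" if "j < length Xs" for j
    using px' that unfolding p_def x_def by blast
  define w where "w j = u j (p j) (x j)" for j
  have w: "w j \<in> sp ?M (p j)" if "j < length Xs" for j
    unfolding w_def using morphism_maps[OF um[OF that]] px[OF that] by blast
  have "\<forall>j<length Xs. \<exists>c. w j (c, ()) \<noteq> 0"
  proof (intro allI impI, rule ccontr)
    fix j assume j: "j < length Xs" and "\<not> (\<exists>c. w j (c, ()) \<noteq> 0)"
    then have "w j = 0" by (intro fun_eq_units) simp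
    moreover have "v j (p j) 0 = 0"
      by (rule linear_between_zero[OF morphismD(1)[OF vm[OF j]]]) (use px[OF j] in \<open>auto simp: sp_usum\<close>)
    ultimately show False using vu[of "p j" j j "x j"] px[OF j] j by (simp add: w_def)
  qed
  then obtain c where c: "\<And>j. j < length Xs \<Longrightarrow> w j (c j, ()) \<noteq> 0" by metis
  have "card {..<length Xs} \<le> card {..<length Us}"
  proof (rule card_le_if_identity_factors[of _ _ "\<lambda>j i. E j (c j) i / w j (c j, ())" "\<lambda>i l. w l (i, ())"])
    fix j l assume "j \<in> {..<length Xs}" "l \<in> {..<length Xs}"
    then have j: "j < length Xs" "l < length Xs" by auto
    have "(\<Sum>i<length Us. E j (c j) i / w j (c j, ()) * w l (i, ())) =
        mat_act {..<length Us} (E j) (w l) (c j, ()) / w j (c j, ())"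
      by (simp add: sum_divide_distrib)
    also have "mat_act {..<length Us} (E j) (w l) = u j (p l) (v j (p l) (w l))"
      using E[OF j(1) _ w[OF j(2)]] px[OF j(2)] by simp
    also have "v j (p l) (w l) = (if j = l then x l else 0)"
      unfolding w_def by (rule vu) (use px[OF j(2)] j in auto)
    also have "u j (p l) \<dots> = (if j = l then w l else 0)"
    proof -
      have "u j (p l) 0 = 0"
        by (rule linear_between_zero[OF morphismD(1)[OF um[OF j(1)]] pmodule_zero]) (use px[OF j(2)] X j in auto)
      then show ?thesis by (auto simp: w_def)
    qed
    finally show "(\<Sum>i<length Us. E j (c j) i / w j (c j, ()) * w l (i, ())) = (if j = l then 1 else 0)"
      using c[OF j(1)] by auto
  qed auto
  then show ?thesis by simp
qed

text \<open>Two nonzero summands would contradict the preceding bound on the number of summands.\<close>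

lemma indecomposable_usum_single:
  assumes U: "upset d U" "U \<noteq> {}"
  shows "indecomposable d (usum [U] :: ('k::field, _) pmod)"
  unfolding indecomposable_def
proof (intro conjI allI impI, rule usum_single_not_zero[OF U], rule ccontr)
  fix X Y :: "('k, nat \<times> unit) pmod"
  assume X: "pmodule d X" and Y: "pmodule d Y"
    and iso: "isomorphic d (usum [U] :: ('k, nat \<times> unit) pmod) (direct_sum [X, Y])"
    and nz: "\<not> (zero_module d X \<or> zero_module d Y)"
  obtain u v where dec: "decomposes d (usum [U] :: ('k, nat \<times> unit) pmod) [X, Y] u v"
    by (rule isomorphic_direct_sumE[OF iso]) (use X Y in auto)
  have "length [X, Y] \<le> length [U]"
    by (rule decomposition_length_le[OF _ _ dec]) (use U X Y nz in auto)
  then show False by simp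
qed

text \<open>The identity matrix on the indices of the summands equal to \<open>U\<close> is the sum of the restricted
  matrices \<open>E\<^sub>j\<close> of \<open>u\<^sub>j v\<^sub>j\<close>. If such a restriction is not zero, then \<open>U\<close> is a retract of \<open>X\<^sub>j\<close>,
  so \<open>X\<^sub>j\<close> is isomorphic to the module of \<open>U\<close>. In this case \<open>E\<^sub>j\<close> factors through a single upset
  module and has rank one. Hence the identity factors through the set of all \<open>j\<close> of this kind.\<close>

lemma decomposition_count_le:
  fixes Xs :: "('k::field, nat \<times> unit) pmod list"
  assumes up: "\<And>U. U \<in> set Us \<Longrightarrow> upset d U \<and> U \<noteq> {}"
    and X: "\<And>X. X \<in> set Xs \<Longrightarrow> pmodule d X \<and> indecomposable d X"
    and dec: "decomposes d (usum Us) Xs u v"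
    and U: "U \<in> set Us"
  shows "card {i. i < length Us \<and> Us ! i = U} \<le> card {j. j < length Xs \<and> isomorphic d (Xs ! j) (usum [U])}"
proof -
  let ?M = "usum Us :: ('k, nat \<times> unit) pmod" and ?W = "usum [U] :: ('k, nat \<times> unit) pmod"
  let ?I = "{i. i < length Us \<and> Us ! i = U}" and ?J = "{j. j < length Xs \<and> isomorphic d (Xs ! j) ?W}"
  have UU: "upset d U" "U \<noteq> {}" using up[OF U] by auto
  have up': "\<And>V. V \<in> set Us \<Longrightarrow> upset d V" "\<And>V. V \<in> set [U] \<Longrightarrow> upset d V" using up UU by auto
  have I: "nonempty_indices Us = {..<length Us}" "nonempty_indices [U] = {0}"
    using up UU(2) by (auto simp: nonempty_indices_def)
  have um: "morphism d (Xs ! j) ?M (u j)" and vm: "morphism d ?M (Xs ! j) (v j)" if "j < length Xs" for j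
    using dec that unfolding decomposes_def by blast+
  have sum: "(\<Sum>j<length Xs. u j p (v j p m)) = m" if "p \<in> carrier_vec d" "m \<in> sp ?M p" for p m
    using dec that unfolding decomposes_def by blast
  have W: "pmodule d ?W" by (rule pmodule_usum) (use UU in auto)
  obtain q where q: "q \<in> carrier_vec d" "\<And>i. i < length Us \<Longrightarrow> (unit_fun i :: _ \<Rightarrow> 'k) \<in> sp (usum Us) q"
    by (rule common_unit_funs[of Us, OF up'(1)], assumption) (rule that, assumption, simp add: I)
  obtain E where E: "\<And>j p x. j < length Xs \<Longrightarrow> p \<in> carrier_vec d \<Longrightarrow> x \<in> sp ?M p \<Longrightarrow>
      u j p (v j p x) = mat_act {..<length Us} (E j) x"
    by (rule decomposition_matrices[OF up dec]) (assumption, rule that)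
  have Eq: "E j i' i = u j q (v j q (unit_fun i)) (i', ())" if "j < length Xs" "i < length Us" for j i' i
    using E[OF that(1) q(1) q(2)[OF that(2)]] mat_act_unit_fun[of "{..<length Us}" i "E j" i' "()"] that(2) by simp
  have iso: "isomorphic d (Xs ! j) ?W"
    if j: "j < length Xs" and i: "i \<in> ?I" "i' \<in> ?I" and nz: "E j i' i \<noteq> 0" for j i i'
  proof -
    have Xj: "pmodule d (Xs ! j)" "indecomposable d (Xs ! j)" using X j by auto
    \<comment> \<open>The maps from \<open>U\<close> into summand \<open>i\<close> and back from summand \<open>i'\<close>, scaled so that the composite is 1.\<close>
    define b where "b l m = (if l = i \<and> m = (0::nat) then 1 else 0 :: 'k)" for l m
    define a where "a l m = (if l = (0::nat) \<and> m = i' then 1 / E j i' i else 0)" for l m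
    have pd: "p + diag d 0 \<in> U" if "p \<in> U" for p
      using that UU(1) by (simp add: upset_def subset_iff)
    have bm: "morphism d ?W (shift d 0 ?M) (\<lambda>_. mat_act {0} b)"
      by (rule matrix_morphism[of "[U]" b Us d 0, unfolded I]) (use i pd in \<open>auto simp: b_def split: if_splits\<close>)
    have am: "morphism d ?M (shift d 0 ?W) (\<lambda>_. mat_act {..<length Us} a)"
      by (rule matrix_morphism[of Us a "[U]" d 0, unfolded I]) (use i pd in \<open>auto simp: a_def split: if_splits\<close>)
    show ?thesis
    proof (rule retract_isomorphic[OF Xj(1) W Xj(2) _ _ _ usum_single_not_zero[OF UU]])
      show "morphism d (Xs ! j) ?W (\<lambda>p x. mat_act {..<length Us} a (u j p x))"
        by (rule morphism_comp[OF um[OF j] am[unfolded morphism_shift_zero]])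
      show "morphism d ?W (Xs ! j) (\<lambda>p y. v j p (mat_act {0} b y))"
        by (rule morphism_comp[OF bm[unfolded morphism_shift_zero] vm[OF j]])
      fix p :: "real vec" and y assume p: "p \<in> carrier_vec d" and y: "y \<in> sp ?W p"
      have bi: "mat_act {0} b y \<in> sp ?M p" by (rule morphism_maps[OF bm[unfolded morphism_shift_zero] p y])
      show "mat_act {..<length Us} a (u j p (v j p (mat_act {0} b y))) = y"
      proof (rule fun_eq_units)
        fix l
        show "mat_act {..<length Us} a (u j p (v j p (mat_act {0} b y))) (l, ()) = y (l, ())"
          using i nz y unfolding E[OF j p bi]
          by (cases "l = 0") (auto simp: a_def b_def sp_usum if_distrib[of "\<lambda>x. x * _"] if_distrib[of "(*) _"] sum.delta cong: if_cong)
      qed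
    qed
  qed
  have "\<forall>j\<in>?J. \<exists>\<alpha> \<gamma>. \<forall>i<length Us. \<forall>i'. E j i' i = \<alpha> i' * \<gamma> i"
  proof
    fix j assume "j \<in> ?J"
    then have j: "j < length Xs" "isomorphic d (Xs ! j) ?W" by auto
    from j(2) obtain f g where fg: "morphism d (Xs ! j) ?W f" "morphism d ?W (Xs ! j) g"
      "\<forall>p\<in>carrier_vec d. \<forall>x\<in>sp (Xs ! j) p. g p (f p x) = x"
      unfolding isomorphic_def by blast
    have m1: "morphism d ?M (shift d 0 ?W) (\<lambda>p x. f p (v j p x))"
      unfolding morphism_shift_zero by (rule morphism_comp[OF vm[OF j(1)] fg(1)])
    have m2: "morphism d ?W (shift d 0 ?M) (\<lambda>p x. u j p (g p x))"
      unfolding morphism_shift_zero by (rule morphism_comp[OF fg(2) um[OF j(1)]])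
    obtain \<gamma> where \<gamma>: "\<And>p x. p \<in> carrier_vec d \<Longrightarrow> x \<in> sp ?M p \<Longrightarrow> f p (v j p x) = mat_act {..<length Us} \<gamma> x"
      by (rule morphism_feasible[OF up'(1) m1, unfolded I]) (auto simp: I)
    obtain \<alpha> where \<alpha>: "\<And>p x. p \<in> carrier_vec d \<Longrightarrow> x \<in> sp ?W p \<Longrightarrow> u j p (g p x) = mat_act {0} \<alpha> x"
      by (rule morphism_feasible[OF up'(2) m2, unfolded I]) (auto simp: I)
    have "E j i' i = \<alpha> i' 0 * \<gamma> 0 i" if i: "i < length Us" for i i'
    proof -
      have vq: "v j q (unit_fun i) \<in> sp (Xs ! j) q" by (rule morphism_maps[OF vm[OF j(1)] q(1) q(2)[OF i]])
      have "E j i' i = u j q (g q (f q (v j q (unit_fun i)))) (i', ())"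
        using fg(3) q(1) vq by (simp add: Eq[OF j(1) i])
      also have "\<dots> = \<alpha> i' 0 * f q (v j q (unit_fun i)) (0, ())"
        using \<alpha>[OF q(1) morphism_maps[OF fg(1) q(1) vq]] by simp
      also have "\<dots> = \<alpha> i' 0 * \<gamma> 0 i"
        using \<gamma>[OF q(1) q(2)[OF i]] mat_act_unit_fun[of "{..<length Us}" i \<gamma> 0 "()"] i by simp
      finally show ?thesis .
    qed
    then show "\<exists>\<alpha> \<gamma>. \<forall>i<length Us. \<forall>i'. E j i' i = \<alpha> i' * \<gamma> i"
      by (intro exI[of _ "\<lambda>i'. \<alpha> i' 0"] exI[of _ "\<lambda>i. \<gamma> 0 i"]) simp
  qed
  from bchoice[OF this] obtain \<alpha> where "\<forall>j\<in>?J. \<exists>\<gamma>. \<forall>i<length Us. \<forall>i'. E j i' i = \<alpha> j i' * \<gamma> i" ..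
  from bchoice[OF this] obtain \<gamma> where
    rank1: "\<forall>j\<in>?J. \<forall>i<length Us. \<forall>i'. E j i' i = \<alpha> j i' * \<gamma> j i" ..
  show ?thesis
  proof (rule card_le_if_identity_factors[of ?I ?J "\<lambda>i j. \<alpha> j i" \<gamma>])
    fix i' i assume i: "i' \<in> ?I" "i \<in> ?I"
    have "(\<Sum>j\<in>?J. \<alpha> j i' * \<gamma> j i) = (\<Sum>j\<in>?J. E j i' i)"
      by (rule sum.cong) (use rank1 i in auto)
    also have "\<dots> = (\<Sum>j<length Xs. E j i' i)"
      by (rule sum.mono_neutral_left) (use iso i in auto)
    also have "\<dots> = (\<Sum>j<length Xs. u j q (v j q (unit_fun i))) (i', ())"
      unfolding sum_fun_apply by (rule sum.cong) (use Eq i in auto)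
    also have "\<dots> = unit_fun i (i', ())" using sum[OF q(1) q(2)] i by simp
    finally show "(\<Sum>j\<in>?J. \<alpha> j i' * \<gamma> j i) = (if i' = i then 1 else 0)" by simp
  qed auto
qed

lemma iso_class_eq_iff:
  assumes "pmodule d N"
  shows "iso_class d M = iso_class d N \<longleftrightarrow> isomorphic d M (N :: ('k::field, 'i) pmod)"
proof
  assume "iso_class d M = iso_class d N"
  then show "isomorphic d M N" using isomorphic_refl[OF assms] assms unfolding iso_class_def by blast
next
  assume "isomorphic d M N"
  then show "iso_class d M = iso_class d N"
    unfolding iso_class_def using isomorphic_trans isomorphic_sym by blast
qed

text \<open>Krull--Remak--Schmidt: passing from the upsets \<open>Us\<close> to another decomposition, the multiplicity of
  each upset cannot decrease and the number of summands cannot increase. So both decompositions give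
  the same multiset, and the barcode is well-defined.\<close>

theorem size_barcode_usum:
  assumes up: "\<And>U. U \<in> set Us \<Longrightarrow> upset d U"
  shows "size (barcode d (usum Us :: ('k::field, _) pmod)) = length (filter (\<lambda>U. U \<noteq> {}) Us)"
proof -
  define Vs where "Vs = filter (\<lambda>U. U \<noteq> {}) Us"
  define Ws where "Ws = (map (\<lambda>U. usum [U]) Vs :: ('k, nat \<times> unit) pmod list)"
  define \<BB> where "\<BB> = mset (map (iso_class d) Ws)"
  have V: "\<And>V. V \<in> set Vs \<Longrightarrow> upset d V \<and> V \<noteq> {}" using up by (auto simp: Vs_def)
  have W: "pmodule d W" "indecomposable d W" if "W \<in> set Ws" for W
    using that V unfolding Ws_def by (auto intro!: pmodule_usum indecomposable_usum_single)
  have MV: "isomorphic d (usum Us :: ('k, _) pmod) (usum Vs)"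
    unfolding Vs_def by (rule usum_filter_isomorphic[OF up])
  have "isomorphic d (usum Vs :: ('k, _) pmod) (direct_sum Ws)"
    unfolding Ws_def by (rule usum_isomorphic_direct_sum) (use V in auto)
  then have "is_barcode d (usum Us) \<BB>"
    unfolding is_barcode_def \<BB>_def using W isomorphic_trans[OF MV] by blast
  moreover have "\<BB>' = \<BB>" if "is_barcode d (usum Us :: ('k, _) pmod) \<BB>'" for \<BB>'
  proof -
    from that obtain Xs where X: "\<forall>X\<in>set Xs. pmodule d X \<and> indecomposable d X"
      "isomorphic d (usum Us :: ('k, _) pmod) (direct_sum Xs)" "\<BB>' = mset (map (iso_class d) Xs)"
      unfolding is_barcode_def by blast
    obtain u v where dec: "decomposes d (usum Vs) Xs u v"
      by (rule isomorphic_direct_sumE[OF isomorphic_trans[OF isomorphic_sym[OF MV] X(2)]]) (use X(1) in auto)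
    have "count \<BB> c \<le> count \<BB>' c" for c
    proof (cases "c \<in># \<BB>")
      case True
      then obtain U where U: "U \<in> set Vs" "c = iso_class d (usum [U])"
        by (auto simp: \<BB>_def Ws_def)
      have pU: "pmodule d (usum [U] :: ('k, _) pmod)" using V[OF U(1)] by (auto intro!: pmodule_usum)
      have "{i. i < length Vs \<and> map (iso_class d) Ws ! i = c} = {i. i < length Vs \<and> Vs ! i = U}"
        using V U by (auto simp: Ws_def U(2) iso_class_eq_iff[OF pU] usum_single_isomorphic_iff)
      then have "count \<BB> c = card {i. i < length Vs \<and> Vs ! i = U}"
        unfolding \<BB>_def count_mset_card by (simp add: Ws_def)
      also have "\<dots> \<le> card {j. j < length Xs \<and> isomorphic d (Xs ! j) (usum [U])}"
        by (rule decomposition_count_le[OF V _ dec U(1)]) (use X(1) in auto)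
      also have "{j. j < length Xs \<and> isomorphic d (Xs ! j) (usum [U])} =
          {j. j < length Xs \<and> map (iso_class d) Xs ! j = c}"
        by (intro Collect_cong) (simp add: U(2) iso_class_eq_iff[OF pU] cong: conj_cong)
      also have "card \<dots> = count \<BB>' c" unfolding X(3) count_mset_card by simp
      finally show ?thesis .
    qed (simp add: not_in_iff)
    then have "\<BB> \<subseteq># \<BB>'" unfolding subseteq_mset_def by blast
    moreover have "length Xs \<le> length Vs"
      by (rule decomposition_length_le[OF V _ dec]) (use X(1) in \<open>auto simp: indecomposable_def\<close>)
    then have "size \<BB>' \<le> size \<BB>" by (simp add: X(3) \<BB>_def Ws_def)
    ultimately show ?thesis by (metis mset_subset_size leD subset_mset.le_imp_less_or_eq)
  qed
  ultimately have "barcode d (usum Us :: ('k, _) pmod) = \<BB>"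
    unfolding barcode_def by (rule the_equality)
  then show ?thesis by (simp only: \<BB>_def Ws_def Vs_def size_mset length_map)
qed

section \<open>The interleaving distance of finitely generated upsets\<close>

text \<open>Vertices are the upsets of the two modules and edges are inclusions of \<open>\<epsilon>\<close>-translates, so the
  edges of a walk compose.\<close>

lemma interleaving_path:
  fixes Us Vs d
  defines "W \<equiv> case_sum ((!) Us) ((!) Vs)"
  assumes len: "length Vs = length Us"
    and c: "\<And>U. U \<in> set Us \<union> set Vs \<Longrightarrow> U \<subseteq> carrier_vec d"
  shows "(x, y) \<in> ci_graph (interleaving_problem d \<epsilon> Us Vs) ^^ l \<Longrightarrow> p \<in> W x \<Longrightarrow> p \<in> carrier_vec d \<Longrightarrow>
    p + diag d (real l * \<epsilon>) \<in> W y"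
proof (induction l arbitrary: y)
  case 0
  then show ?case by simp
next
  case (Suc l)
  let ?C = "interleaving_problem d \<epsilon> Us Vs"
  have size: "ci_size ?C = length Us" by (simp add: ci_size_def interleaving_problem_def Let_def)
  from Suc.prems(1) obtain z where z: "(x, z) \<in> ci_graph ?C ^^ l" "(z, y) \<in> ci_graph ?C" by auto
  have pz: "p + diag d (real l * \<epsilon>) \<in> W z" by (rule Suc.IH[OF z(1) Suc.prems(2,3)])
  have "\<forall>p\<in>W z. p + diag d \<epsilon> \<in> W y"
    using z(2) unfolding ci_graph_def size W_def
    by (auto simp: interleaving_problem_def Let_def split: if_splits)
  then have "p + diag d (real l * \<epsilon>) + diag d \<epsilon> \<in> W y" using pz by blast
  moreover have "p + diag d (real l * \<epsilon>) + diag d \<epsilon> = p + diag d (real (Suc l) * \<epsilon>)"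
    using Suc.prems(3) by (auto simp: diag_def algebra_simps)
  ultimately show ?case by simp
qed

lemma add_diag_mono:
  assumes "upset d U" "p \<in> carrier_vec d" "p + diag d a \<in> U" "a \<le> b"
  shows "p + diag d b \<in> U"
proof -
  have "p + diag d a \<le> p + diag d b" using assms(2,4) by (auto simp: less_eq_vec_def diag_def)
  moreover have "p + diag d b \<in> carrier_vec d" using assms(2) by simp
  ultimately show ?thesis using assms(1,3) unfolding upset_def by blast
qed

lemma weakening_solvable_imp:
  assumes len: "length Vs = length Us" and up: "\<And>U. U \<in> set Us \<union> set Vs \<Longrightarrow> upset d U" and e: "0 \<le> \<epsilon>"
    and s: "ci_solvable K (weakening c (interleaving_problem d \<epsilon> Us Vs))"
  shows "ci_solvable K (interleaving_problem d (real c * \<epsilon>) Us Vs)"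
proof -
  let ?C = "interleaving_problem d \<epsilon> Us Vs" and ?C' = "interleaving_problem d (real c * \<epsilon>) Us Vs"
  have size: "ci_size ?C = length Us" "ci_size ?C' = length Us" "ci_size (weakening c ?C) = length Us"
    by (simp_all add: ci_size_def interleaving_problem_def weakening_def Let_def)
  have sub: "U \<subseteq> carrier_vec d" if "U \<in> set Us \<union> set Vs" for U
    using up[OF that] by (simp add: upset_def)
  have path: "p + diag d (real c * \<epsilon>) \<in> case_sum ((!) Us) ((!) Vs) y"
    if pu: "path_upto (ci_graph ?C) c x y" and p: "p \<in> case_sum ((!) Us) ((!) Vs) x" "p \<in> carrier_vec d"
      and y: "case_sum ((!) Us) ((!) Vs) y \<in> set Us \<union> set Vs" for p x y
  proof -
    from pu obtain l where l: "l \<le> c" "(x, y) \<in> ci_graph ?C ^^ l" unfolding path_upto_def by blast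
    have "p + diag d (real l * \<epsilon>) \<in> case_sum ((!) Us) ((!) Vs) y"
      by (rule interleaving_path[OF len sub l(2) p])
    then show ?thesis
      by (rule add_diag_mono[OF up[OF y] p(2)]) (use l(1) e in \<open>auto intro: mult_right_mono\<close>)
  qed
  show ?thesis
  proof (rule ci_solvable_mono[OF _ _ _ s])
    fix i j assume i: "i < ci_size (weakening c ?C)" and j: "j < ci_size (weakening c ?C)"
    then have ij: "i < length Us" "j < length Us" by (simp_all add: size)
    show "fst (weakening c ?C) $$ (i, j) = Zero" if z: "fst ?C' $$ (i, j) = Zero"
    proof (rule ccontr)
      assume "\<not> ?thesis"
      then have pu: "path_upto (ci_graph ?C) c (Inl j) (Inr i)"
        using ij by (auto simp: weakening_def Let_def size split: if_splits)
      have "p + diag d (real c * \<epsilon>) \<in> Vs ! i" if "p \<in> Us ! j" for p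
        using path[OF pu, of p] that sub[of "Us ! j"] ij len by auto
      then show False using z ij by (auto simp: interleaving_problem_def Let_def split: if_splits)
    qed
    show "snd (weakening c ?C) $$ (i, j) = Zero" if z: "snd ?C' $$ (i, j) = Zero"
    proof (rule ccontr)
      assume "\<not> ?thesis"
      then have pu: "path_upto (ci_graph ?C) c (Inr j) (Inl i)"
        using ij by (auto simp: weakening_def Let_def size split: if_splits)
      have "p + diag d (real c * \<epsilon>) \<in> Us ! i" if "p \<in> Vs ! j" for p
        using path[OF pu, of p] that sub[of "Vs ! j"] ij len by auto
      then show False using z ij by (auto simp: interleaving_problem_def Let_def split: if_splits)
    qed
  qed (simp add: size)
qed

text \<open>The least nonnegative shift that moves \<open>p\<close> above \<open>q\<close>.\<close>

definition excess :: "nat \<Rightarrow> 'a::linordered_field vec \<Rightarrow> 'a vec \<Rightarrow> 'a" where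
  "excess d p q = Max (set (0 # map (\<lambda>l. q $ l - p $ l) [0..<d]))"

text \<open>The least nonnegative shift that moves the upset generated by \<open>us\<close> into the one generated by \<open>vs\<close>:
  every generator of the former has to get above some generator of the latter.\<close>

definition threshold :: "nat \<Rightarrow> 'a::linordered_field vec list \<Rightarrow> 'a vec list \<Rightarrow> 'a" where
  "threshold d us vs = Max (set (map (\<lambda>p. Min (set (map (excess d p) vs))) us))"

definition thresholds :: "nat \<Rightarrow> 'a::linordered_field vec list list \<Rightarrow> 'a vec list list \<Rightarrow> 'a list" where
  "thresholds d A B = concat (map (\<lambda>a. concat (map (\<lambda>b. [threshold d a b, threshold d b a]) B)) A)"

lemma excess_nonneg: "0 \<le> excess d p q"
  unfolding excess_def by (intro Max_ge) auto

lemma threshold_nonneg: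
  assumes "us \<noteq> []" "vs \<noteq> []"
  shows "0 \<le> threshold d us vs"
proof -
  obtain p where p: "p \<in> set us" using assms(1) by (cases us) auto
  have "0 \<le> Min (set (map (excess d p) vs))" using assms(2) by (auto simp: excess_nonneg)
  also have "\<dots> \<le> threshold d us vs" unfolding threshold_def using p by (intro Max_ge) auto
  finally show ?thesis .
qed

text \<open>The common setting for rational and real machine numbers.\<close>

locale embedded_numbers = bit_size \<beta> for \<beta> :: "'a::linordered_field \<Rightarrow> nat" +
  fixes \<iota> :: "'a \<Rightarrow> real"
  assumes less_iff: "\<iota> a < \<iota> b \<longleftrightarrow> a < b"
    and of_int: "\<iota> (of_int m) = of_int m"
    and add: "\<iota> (a + b) = \<iota> a + \<iota> b"
    and mult: "\<iota> (a * b) = \<iota> a * \<iota> b"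
begin

lemma le_iff: "\<iota> a \<le> \<iota> b \<longleftrightarrow> a \<le> b"
  using less_iff[of b a] by linarith

lemma zero: "\<iota> 0 = 0"
  using of_int[of 0] by simp

lemma diff: "\<iota> (a - b) = \<iota> a - \<iota> b"
  using add[of "a - b" b] by simp

lemma of_nat: "\<iota> (of_nat n) = real n"
  using of_int[of "int n"] by simp

abbreviation gen :: "nat \<Rightarrow> 'a vec list \<Rightarrow> real vec set" where
  "gen d us \<equiv> generated_upset d (map (map_vec \<iota>) us)"

lemma Max_le_real_iff: "finite S \<Longrightarrow> S \<noteq> {} \<Longrightarrow> \<iota> (Max S) \<le> e \<longleftrightarrow> (\<forall>s\<in>S. \<iota> s \<le> e)"
  using le_iff Max_in Max_ge by (meson order_trans)

lemma Min_le_real_iff: "finite S \<Longrightarrow> S \<noteq> {} \<Longrightarrow> \<iota> (Min S) \<le> e \<longleftrightarrow> (\<exists>s\<in>S. \<iota> s \<le> e)"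
  using le_iff Min_in Min_le by (meson order_trans)

lemma excess_le_iff:
  assumes "p \<in> carrier_vec d" "q \<in> carrier_vec d" "0 \<le> e"
  shows "\<iota> (excess d p q) \<le> e \<longleftrightarrow> map_vec \<iota> q \<le> map_vec \<iota> p + diag d e"
proof -
  have "\<iota> (excess d p q) \<le> e \<longleftrightarrow> (\<forall>s\<in>set (0 # map (\<lambda>l. q $ l - p $ l) [0..<d]). \<iota> s \<le> e)"
    unfolding excess_def by (rule Max_le_real_iff) auto
  also have "\<dots> \<longleftrightarrow> (\<forall>l<d. \<iota> (q $ l) \<le> \<iota> (p $ l) + e)"
  proof -
    have "\<iota> (q $ l - p $ l) \<le> e \<longleftrightarrow> \<iota> (q $ l) \<le> \<iota> (p $ l) + e" for l
      unfolding diff by linarith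
    then show ?thesis using assms(3) by (auto simp: zero)
  qed
  also have "\<dots> \<longleftrightarrow> map_vec \<iota> q \<le> map_vec \<iota> p + diag d e"
    using assms(1,2) by (auto simp: less_eq_vec_def diag_def)
  finally show ?thesis .
qed

lemma gen_subset_iff:
  assumes "set us \<subseteq> carrier_vec d" "set vs \<subseteq> carrier_vec d"
  shows "(\<forall>p\<in>gen d us. p + diag d e \<in> gen d vs) \<longleftrightarrow>
    (\<forall>p\<in>set us. \<exists>q\<in>set vs. map_vec \<iota> q \<le> map_vec \<iota> p + diag d e)"
proof
  assume L: "\<forall>p\<in>set us. \<exists>q\<in>set vs. map_vec \<iota> q \<le> map_vec \<iota> p + diag d e"
  show "\<forall>p\<in>gen d us. p + diag d e \<in> gen d vs"
  proof
    fix r assume "r \<in> gen d us"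
    then obtain p where p: "p \<in> set us" "r \<in> carrier_vec d" "map_vec \<iota> p \<le> r"
      by (auto simp: generated_upset_def)
    from L p(1) obtain q where q: "q \<in> set vs" "map_vec \<iota> q \<le> map_vec \<iota> p + diag d e" by blast
    have "map_vec \<iota> p + diag d e \<le> r + diag d e"
      using p assms(1) by (auto simp: less_eq_vec_def diag_def)
    with q(2) have "map_vec \<iota> q \<le> r + diag d e" by (rule order_trans)
    then show "r + diag d e \<in> gen d vs" using q(1) p(2) by (auto simp: generated_upset_def)
  qed
next
  assume R: "\<forall>p\<in>gen d us. p + diag d e \<in> gen d vs"
  show "\<forall>p\<in>set us. \<exists>q\<in>set vs. map_vec \<iota> q \<le> map_vec \<iota> p + diag d e"
  proof
    fix p assume p: "p \<in> set us"
    then have "map_vec \<iota> p \<in> gen d us" using assms(1) by (auto simp: generated_upset_def)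
    then have "map_vec \<iota> p + diag d e \<in> gen d vs" using R by blast
    then show "\<exists>q\<in>set vs. map_vec \<iota> q \<le> map_vec \<iota> p + diag d e" by (auto simp: generated_upset_def)
  qed
qed

lemma threshold_le_iff:
  assumes us: "us \<noteq> []" "set us \<subseteq> carrier_vec d" and vs: "vs \<noteq> []" "set vs \<subseteq> carrier_vec d" and e: "0 \<le> e"
  shows "\<iota> (threshold d us vs) \<le> e \<longleftrightarrow> (\<forall>p\<in>gen d us. p + diag d e \<in> gen d vs)"
proof -
  have "\<iota> (threshold d us vs) \<le> e \<longleftrightarrow> (\<forall>p\<in>set us. \<iota> (Min (set (map (excess d p) vs))) \<le> e)"
    unfolding threshold_def using us(1) by (subst Max_le_real_iff) auto
  also have "\<dots> \<longleftrightarrow> (\<forall>p\<in>set us. \<exists>q\<in>set vs. \<iota> (excess d p q) \<le> e)"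
    using vs(1) by (subst Min_le_real_iff) auto
  also have "\<dots> \<longleftrightarrow> (\<forall>p\<in>set us. \<exists>q\<in>set vs. map_vec \<iota> q \<le> map_vec \<iota> p + diag d e)"
    using us(2) vs(2) excess_le_iff[OF _ _ e] by (meson subsetD)
  also have "\<dots> \<longleftrightarrow> (\<forall>p\<in>gen d us. p + diag d e \<in> gen d vs)"
    by (rule gen_subset_iff[OF us(2) vs(2), symmetric])
  finally show ?thesis .
qed

definition problem_at :: "nat \<Rightarrow> real \<Rightarrow> 'a vec list list \<Rightarrow> 'a vec list list \<Rightarrow> ci_problem" where
  "problem_at d e A B = (let n = length A in
     (mat n n (\<lambda>(j, i). if \<iota> (threshold d (A ! i) (B ! j)) \<le> e then Star else Zero),
      mat n n (\<lambda>(i, j). if \<iota> (threshold d (B ! j) (A ! i)) \<le> e then Star else Zero)))"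

lemma interleaving_problem_eq:
  assumes A: "\<And>a. a \<in> set A \<union> set B \<Longrightarrow> a \<noteq> [] \<and> set a \<subseteq> carrier_vec d"
    and len: "length A = length B" and e: "0 \<le> e"
  shows "interleaving_problem d e (map (gen d) A) (map (gen d) B) = problem_at d e A B"
proof -
  have "(\<forall>p\<in>gen d a. p + diag d e \<in> gen d b) \<longleftrightarrow> \<iota> (threshold d a b) \<le> e"
    if "a \<in> set A \<union> set B" "b \<in> set A \<union> set B" for a b
    using threshold_le_iff[of a d b e] A[OF that(1)] A[OF that(2)] e by blast
  then show ?thesis
    using len unfolding interleaving_problem_def problem_at_def Let_def by (auto intro!: cong_mat)
qed

text \<open>The CI problem does not change between consecutive thresholds. Below all thresholds it consists of
  zeros and, being of positive size, has no solution; above all of them it consists of stars and has one.\<close>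

lemma optimal_threshold:
  assumes A: "\<And>a. a \<in> set A \<union> set B \<Longrightarrow> a \<noteq> []" and len: "length A = length B" and ne: "A \<noteq> []"
  shows "\<exists>x\<in>set (thresholds d A B). ci_solvable TYPE('k::field) (problem_at d (\<iota> x) A B) \<and>
    (\<forall>e. ci_solvable TYPE('k) (problem_at d e A B) \<longrightarrow> \<iota> x \<le> e)"
proof -
  define K where "K = set (thresholds d A B)"
  define n where "n = length A"
  define solv where "solv e = ci_solvable TYPE('k) (problem_at d e A B)" for e
  have n: "0 < n" using ne by (simp add: n_def)
  have size: "ci_size (problem_at d e A B) = n" for e
    by (simp add: ci_size_def problem_at_def Let_def n_def)
  have K: "threshold d (A ! i) (B ! j) \<in> K" "threshold d (B ! j) (A ! i) \<in> K" if "i < n" "j < n" for i j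
    using that len by (force simp: K_def thresholds_def n_def)+
  have fin: "finite K" by (simp add: K_def)
  have below: "\<exists>x\<in>K. \<iota> x \<le> e \<and> solv (\<iota> x)" if s: "solv e" for e
  proof -
    \<comment> \<open>The largest threshold up to \<open>e\<close> gives the same problem as \<open>e\<close>.\<close>
    define L where "L = {x \<in> K. \<iota> x \<le> e}"
    have "L \<noteq> {}"
    proof
      assume "L = {}"
      then have no: "\<not> \<iota> x \<le> e" if "x \<in> K" for x using that by (auto simp: L_def)
      from s obtain P Q :: "'k mat" where PQ: "P \<in> carrier_mat n n" "Q \<in> carrier_mat n n" "P * Q = 1\<^sub>m n"
        "\<forall>i<n. \<forall>j<n. fst (problem_at d e A B) $$ (i, j) = Zero \<longrightarrow> P $$ (i, j) = 0"
        unfolding solv_def ci_solvable_def ci_solution_def Let_def size by blast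
      have "P $$ (0, j) = 0" if "j < n" for j
        using PQ(4) n that no[OF K(1)] by (simp add: problem_at_def Let_def n_def[symmetric])
      then have "(P * Q) $$ (0, 0) = 0" using PQ(1,2) n by (simp add: scalar_prod_def)
      then show False using PQ(3) n by simp
    qed
    moreover have "finite L" using fin by (simp add: L_def)
    ultimately have x: "Max L \<in> L" "\<And>x. x \<in> L \<Longrightarrow> x \<le> Max L" by (rule_tac Max_in, auto)
    have "\<iota> y \<le> \<iota> (Max L) \<longleftrightarrow> \<iota> y \<le> e" if "y \<in> K" for y
      using x that le_iff[of y "Max L"] unfolding L_def by auto
    then have "problem_at d (\<iota> (Max L)) A B = problem_at d e A B"
      using K unfolding problem_at_def Let_def n_def by (auto intro!: cong_mat)
    then show ?thesis using x(1) s unfolding solv_def L_def by auto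
  qed
  have "solv (\<iota> (Max K))"
  proof -
    have "\<iota> y \<le> \<iota> (Max K)" if "y \<in> K" for y using that fin le_iff by simp
    then have star: "fst (problem_at d (\<iota> (Max K)) A B) $$ (i, j) = Star"
      "snd (problem_at d (\<iota> (Max K)) A B) $$ (i, j) = Star" if "i < n" "j < n" for i j
      using that K by (auto simp: problem_at_def Let_def n_def)
    have "ci_solution (problem_at d (\<iota> (Max K)) A B) (1\<^sub>m n :: 'k mat) (1\<^sub>m n)"
      unfolding ci_solution_def Let_def size by (auto simp: star)
    then show ?thesis unfolding solv_def ci_solvable_def by blast
  qed
  then have "{x \<in> K. solv (\<iota> x)} \<noteq> {}" using below by blast
  define x0 where "x0 = Min {x \<in> K. solv (\<iota> x)}"
  have x0: "x0 \<in> K" "solv (\<iota> x0)" "\<And>x. x \<in> K \<Longrightarrow> solv (\<iota> x) \<Longrightarrow> x0 \<le> x"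
    using Min_in[OF _ \<open>{x \<in> K. solv (\<iota> x)} \<noteq> {}\<close>] fin unfolding x0_def by auto
  have "\<iota> x0 \<le> e" if "solv e" for e
    using below[OF that] x0(3) le_iff by (meson order_trans)
  then show ?thesis using x0(1,2) unfolding K_def solv_def by blast
qed

lemma upset_gen: "upset d (gen d us)"
  by (rule upset_generated_upset)

lemma gen_empty_iff: "set us \<subseteq> carrier_vec d \<Longrightarrow> gen d us = {} \<longleftrightarrow> us = []"
proof
  assume us: "set us \<subseteq> carrier_vec d" "gen d us = {}"
  have "map_vec \<iota> a \<in> gen d us" if "a \<in> set us" for a
    using that us(1) by (auto simp: generated_upset_def)
  then show "us = []" using us(2) by (cases us) auto
qed (simp add: generated_upset_def)

lemma upset_sum_gen: "upset_sum d (map (map (map_vec \<iota>)) Us) = usum (map (gen d) Us)"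
  unfolding upset_sum_usum by (simp add: comp_def)

lemma filter_gen:
  assumes "\<And>us. us \<in> set Us \<Longrightarrow> set us \<subseteq> carrier_vec d"
  shows "filter (\<lambda>U. U \<noteq> {}) (map (gen d) Us) = map (gen d) (filter (\<lambda>us. us \<noteq> []) Us)"
  unfolding filter_map comp_def
  by (rule arg_cong[where f = "map _"], rule filter_cong) (use assms gen_empty_iff in auto)

lemma size_barcode_gen:
  assumes "\<And>us. us \<in> set Us \<Longrightarrow> set us \<subseteq> carrier_vec d"
  shows "size (barcode d (upset_sum d (map (map (map_vec \<iota>)) Us) :: ('k::field, _) pmod)) =
    length (filter (\<lambda>us. us \<noteq> []) Us)"
  unfolding upset_sum_gen by (subst size_barcode_usum) (auto simp: upset_gen filter_gen[OF assms])

lemma interleaved_gen_iff: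
  assumes U: "\<And>us. us \<in> set Us \<union> set Vs \<Longrightarrow> set us \<subseteq> carrier_vec d"
  defines "A \<equiv> filter (\<lambda>us. us \<noteq> []) Us" and "B \<equiv> filter (\<lambda>us. us \<noteq> []) Vs"
  assumes len: "length A = length B"
  shows "interleaved d e (upset_sum d (map (map (map_vec \<iota>)) Us) :: ('k::field, _) pmod)
      (upset_sum d (map (map (map_vec \<iota>)) Vs) :: ('k, _) pmod) \<longleftrightarrow>
    0 \<le> e \<and> ci_solvable TYPE('k) (problem_at d e A B)"
proof -
  have iso: "isomorphic d (usum (map (gen d) Us) :: ('k, _) pmod) (usum (map (gen d) A))"
    "isomorphic d (usum (map (gen d) Vs) :: ('k, _) pmod) (usum (map (gen d) B))"
    unfolding A_def B_def using U
    by (subst filter_gen[symmetric]; auto intro!: usum_filter_isomorphic upset_gen)+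
  have AB: "a \<noteq> [] \<and> set a \<subseteq> carrier_vec d" if "a \<in> set A \<union> set B" for a
    using that U by (auto simp: A_def B_def)
  have "interleaved d e (usum (map (gen d) A) :: ('k, _) pmod) (usum (map (gen d) B) :: ('k, _) pmod) \<longleftrightarrow>
      0 \<le> e \<and> ci_solvable TYPE('k) (interleaving_problem d e (map (gen d) A) (map (gen d) B))"
    by (rule interleaved_iff_ci_solvable) (use AB gen_empty_iff len upset_gen in auto)
  then show ?thesis
    unfolding upset_sum_gen interleaved_cong[OF iso]
    using interleaving_problem_eq[OF AB len] by auto
qed

end

section \<open>Approximating the distance with a solver for CI problems\<close>

lemma safe_ebest:
  assumes "safe G D \<eta> l"
  shows "safe G D \<eta> (ebest lo l)"
  unfolding ebest_def safe.simps(10)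
  by (intro conjI assms safe_if_call_free) (simp add: item_def)

abbreviation enc_points :: "'a vec list \<Rightarrow> 'a val" where
  "enc_points us \<equiv> vlist (map enc_vec us)"

text \<open>The expressions \<open>a\<close> and \<open>b\<close> are evaluated below the binders of the names 10 and 11 and must not
  contain them.\<close>

definition ethreshold :: "nat \<Rightarrow> expr \<Rightarrow> expr \<Rightarrow> expr" where
  "ethreshold d a b = emax (emap 10 a (emin (emap 11 b (emax (elist
     (EInt 0 # map (\<lambda>l. EArith Minus (enth l (item 11)) (enth l (item 10))) [0..<d]))))))"

definition enonempty :: "expr \<Rightarrow> expr" where
  "enonempty l = EGather 3 l (EIfPair (item 3) (elist [item 3]) ENil)"

definition ethresholds :: "nat \<Rightarrow> expr" where
  "ethresholds d = EGather 5 (EVar 1) (EGather 6 (EVar 2)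
     (elist [ethreshold d (item 5) (item 6), ethreshold d (item 6) (item 5)]))"

text \<open>A matrix of the CI problem at the current threshold, which is the head of the list named 4. Rows and
  columns run over the lists of upsets named \<open>r\<close> and \<open>c\<close>; the matrix tells which columns move into
  which rows. Exchanging \<open>r\<close> and \<open>c\<close> gives the other matrix of the problem.\<close>

definition estars :: "nat \<Rightarrow> nat \<Rightarrow> nat \<Rightarrow> expr" where
  "estars d r c = emap 7 (EVar r) (emap 8 (EVar c)
     (EIfLess (item 4) (ethreshold d (item 8) (item 7)) (EInt 0) (EInt 1)))"

text \<open>The names 1 and 2 stand for the nonempty upsets of the two modules. The inner list collects the
  thresholds for which the solver claims a solution of the weakening.\<close>

definition eapproximation :: "nat \<Rightarrow> nat \<Rightarrow> expr" where
  "eapproximation d c = ELet 1 (enonempty (EHead (EVar 0))) (ELet 2 (enonempty (ETail (EVar 0)))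
     (EArith Times (EInt (int c)) (emin (EGather 4 (ethresholds d)
       (EIfLess (EInt 0) (ECall (ECons (estars d 2 1) (estars d 1 2))) (elist [item 4]) ENil)))))"

lemma call_free_threshold [simp]:
  "call_free (ethreshold d a b) \<longleftrightarrow> call_free a \<and> call_free b"
  by (auto simp: ethreshold_def)

lemma enc_vec_vlist: "enc_vec p = vlist (map Num (list_of_vec p))"
  unfolding enc_vec_def by (rule enc_list_vlist)

lemma eval_nth_coordinate:
  assumes "p \<in> carrier_vec d" "l < d" "\<eta> x = Pair (enc_vec p) t"
  shows "eval G \<eta> (enth l (item x)) = Num (p $ l)"
proof -
  have "eval G \<eta> (item x) = vlist (map Num (list_of_vec p))"
    unfolding eval_item assms(3) by (simp add: enc_vec_vlist)
  from eval_enth[OF this, of l] show ?thesis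
    using assms(1,2) list_of_vec_index[of p l] by simp
qed

lemma eval_ethreshold:
  assumes a: "eval G \<eta> a = enc_points us" and b: "\<And>v. eval G (\<eta>(10 := v)) b = enc_points vs"
    and us: "us \<noteq> []" "set us \<subseteq> carrier_vec d" and vs: "vs \<noteq> []" "set vs \<subseteq> carrier_vec d"
  shows "eval G \<eta> (ethreshold d a b) = Num (threshold d us vs)"
proof -
  have inner: "eval G (\<eta>(10 := Pair (enc_vec p) t, 11 := Pair (enc_vec q) t')) (emax (elist
     (EInt 0 # map (\<lambda>l. EArith Minus (enth l (item 11)) (enth l (item 10))) [0..<d]))) = Num (excess d p q)"
    if "p \<in> set us" "q \<in> set vs" for p q t t'
  proof -
    let ?\<eta> = "\<eta>(10 := Pair (enc_vec p) t, 11 := Pair (enc_vec q) t')"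
    have "eval G ?\<eta> (enth l (item 11)) = Num (q $ l)" "eval G ?\<eta> (enth l (item 10)) = Num (p $ l)"
      if "l < d" for l
      by (rule eval_nth_coordinate; use that \<open>p \<in> set us\<close> \<open>q \<in> set vs\<close> us vs in auto)+
    then have "eval G ?\<eta> (elist (EInt 0 # map (\<lambda>l. EArith Minus (enth l (item 11)) (enth l (item 10))) [0..<d]))
        = vlist (map Num (0 # map (\<lambda>l. q $ l - p $ l) [0..<d]))"
      unfolding eval_elist by (intro arg_cong[of _ _ vlist]) simp
    from eval_ebest[OF this, of False] show ?thesis by (simp add: excess_def)
  qed
  have "eval G (\<eta>(10 := Pair (enc_vec p) t)) (emin (emap 11 b (emax (elist
     (EInt 0 # map (\<lambda>l. EArith Minus (enth l (item 11)) (enth l (item 10))) [0..<d])))))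
     = Num (Min (set (map (excess d p) vs)))" if "p \<in> set us" for p t
  proof -
    have "eval G (\<eta>(10 := Pair (enc_vec p) t)) (emap 11 b (emax (elist
       (EInt 0 # map (\<lambda>l. EArith Minus (enth l (item 11)) (enth l (item 10))) [0..<d]))))
       = vlist (map (\<lambda>q. Num (excess d p q)) vs)"
      by (rule eval_emap_map[OF b]) (rule inner[OF that])
    then have "eval G (\<eta>(10 := Pair (enc_vec p) t)) (emap 11 b (emax (elist
       (EInt 0 # map (\<lambda>l. EArith Minus (enth l (item 11)) (enth l (item 10))) [0..<d]))))
       = vlist (map Num (map (excess d p) vs))"
      by (simp add: comp_def)
    from eval_ebest[OF this, of True] show ?thesis using vs by simp
  qed
  then have "eval G \<eta> (emap 10 a (emin (emap 11 b (emax (elist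
     (EInt 0 # map (\<lambda>l. EArith Minus (enth l (item 11)) (enth l (item 10))) [0..<d]))))))
     = vlist (map (\<lambda>p. Num (Min (set (map (excess d p) vs)))) us)"
    by (rule eval_emap_map[OF a])
  then have "eval G \<eta> (emap 10 a (emin (emap 11 b (emax (elist
     (EInt 0 # map (\<lambda>l. EArith Minus (enth l (item 11)) (enth l (item 10))) [0..<d]))))))
     = vlist (map Num (map (\<lambda>p. Min (set (map (excess d p) vs))) us))"
    by (simp add: comp_def)
  from eval_ebest[OF this, of False] show ?thesis using us by (simp add: ethreshold_def threshold_def)
qed

lemma eval_enonempty:
  assumes "eval G \<eta> l = vlist (map enc_points Us)"
  shows "eval G \<eta> (enonempty l) = vlist (map enc_points (filter (\<lambda>us. us \<noteq> []) Us))"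
proof -
  have "eval G \<eta> (enonempty l) = vlist (concat (map (\<lambda>us. if us = [] then [] else [enc_points us]) Us))"
    unfolding enonempty_def
  proof (rule eval_gather_map[OF assms])
    fix us :: "'a vec list" and t
    show "eval G (\<eta>(3 := Pair (enc_points us) t)) (EIfPair (item 3) (elist [item 3]) ENil)
      = vlist (if us = [] then [] else [enc_points us])"
      by (subst eval_EIfPair_vlist[of _ _ _ "map enc_vec us"]) auto
  qed
  also have "concat (map (\<lambda>us. if us = [] then [] else [enc_points us]) Us) =
      map enc_points (filter (\<lambda>us. us \<noteq> []) Us)"
    by (induction Us) auto
  finally show ?thesis .
qed

lemma eval_ethresholds:
  assumes A: "\<And>a. a \<in> set A \<union> set B \<Longrightarrow> a \<noteq> [] \<and> set a \<subseteq> carrier_vec d"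
    and "\<eta> 1 = vlist (map enc_points A)" "\<eta> 2 = vlist (map enc_points B)"
  shows "eval G \<eta> (ethresholds d) = vlist (map Num (thresholds d A B))"
proof -
  have inner: "eval G (\<eta>(5 := Pair (enc_points a) t, 6 := Pair (enc_points b) t'))
      (elist [ethreshold d (item 5) (item 6), ethreshold d (item 6) (item 5)]) =
      vlist [Num (threshold d a b), Num (threshold d b a)]" if "a \<in> set A" "b \<in> set B" for a b t t'
  proof -
    let ?\<eta> = "\<eta>(5 := Pair (enc_points a) t, 6 := Pair (enc_points b) t')"
    have "eval G ?\<eta> (ethreshold d (item 5) (item 6)) = Num (threshold d a b)"
      "eval G ?\<eta> (ethreshold d (item 6) (item 5)) = Num (threshold d b a)"
      by (rule eval_ethreshold; use that A in simp)+
    then show ?thesis by simp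
  qed
  have "eval G \<eta> (ethresholds d) =
      vlist (concat (map (\<lambda>a. concat (map (\<lambda>b. [Num (threshold d a b), Num (threshold d b a)]) B)) A))"
    unfolding ethresholds_def
  proof (rule eval_gather_map)
    fix a t assume a: "a \<in> set A"
    show "eval G (\<eta>(5 := Pair (enc_points a) t)) (EGather 6 (EVar 2)
        (elist [ethreshold d (item 5) (item 6), ethreshold d (item 6) (item 5)])) =
        vlist (concat (map (\<lambda>b. [Num (threshold d a b), Num (threshold d b a)]) B))"
      by (rule eval_gather_map) (use assms(3) inner[OF a] in auto)
  qed (use assms(2) in simp)
  then show ?thesis by (simp add: thresholds_def map_concat comp_def)
qed

lemma eval_estars:
  assumes A: "\<And>a. a \<in> set R \<union> set S \<Longrightarrow> a \<noteq> [] \<and> set a \<subseteq> carrier_vec d"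
    and \<eta>: "\<eta> r = vlist (map enc_points R)" "\<eta> s = vlist (map enc_points S)" "\<eta> 4 = Pair (Num x) t"
    and rs: "r \<noteq> 7" "s \<noteq> 7" and len: "length R = n" "length S = n"
  shows "eval G \<eta> (estars d r s) =
    enc_mat (mat n n (\<lambda>(i, j). if threshold d (S ! j) (R ! i) \<le> x then Star else Zero))"
proof -
  have inner: "eval G (\<eta>(7 := Pair (enc_points b) t, 8 := Pair (enc_points a) t'))
      (EIfLess (item 4) (ethreshold d (item 8) (item 7)) (EInt 0) (EInt 1)) =
      enc_entry (if threshold d a b \<le> x then Star else Zero)" if "b \<in> set R" "a \<in> set S" for a b t t'
  proof -
    let ?\<eta> = "\<eta>(7 := Pair (enc_points b) t, 8 := Pair (enc_points a) t')"
    have "eval G ?\<eta> (ethreshold d (item 8) (item 7)) = Num (threshold d a b)"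
      by (rule eval_ethreshold; use that A in simp)
    then show ?thesis using \<eta>(3) by auto
  qed
  have "eval G \<eta> (estars d r s) =
      vlist (map (\<lambda>b. vlist (map (\<lambda>a. enc_entry (if threshold d a b \<le> x then Star else Zero)) S)) R)"
    unfolding estars_def
  proof (rule eval_emap_map)
    fix b t assume b: "b \<in> set R"
    show "eval G (\<eta>(7 := Pair (enc_points b) t)) (emap 8 (EVar s)
        (EIfLess (item 4) (ethreshold d (item 8) (item 7)) (EInt 0) (EInt 1))) =
        vlist (map (\<lambda>a. enc_entry (if threshold d a b \<le> x then Star else Zero)) S)"
      by (rule eval_emap_map[OF _ inner[OF b]]) (use \<eta>(2) rs in auto)
  qed (use \<eta>(1) in simp)
  also have "map (\<lambda>b. vlist (map (\<lambda>a. enc_entry (if threshold d a b \<le> x then Star else Zero)) S)) R =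
      map (enc_list enc_entry) (mat_to_list (mat n n (\<lambda>(i, j). if threshold d (S ! j) (R ! i) \<le> x then Star else Zero)))"
    by (rule nth_equalityI) (auto simp: mat_to_list_def len enc_list_vlist[of enc_entry] intro!: arg_cong[of _ _ vlist] nth_equalityI)
  finally show ?thesis unfolding enc_mat_def enc_list_vlist[of "enc_list enc_entry"] .
qed

lemma interleaving_distance_eqI:
  assumes "interleaved d x M N" "\<And>e. interleaved d e M N \<Longrightarrow> x \<le> e"
  shows "interleaving_distance d M N = ereal x"
  unfolding interleaving_distance_def
  by (rule antisym) (use assms in \<open>auto intro: Inf_lower Inf_greatest\<close>)

context embedded_numbers begin

lemma problem_at_number:
  "problem_at d (\<iota> x) A B = (let n = length A in
     (mat n n (\<lambda>(j, i). if threshold d (A ! i) (B ! j) \<le> x then Star else Zero),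
      mat n n (\<lambda>(i, j). if threshold d (B ! j) (A ! i) \<le> x then Star else Zero)))"
  unfolding problem_at_def le_iff ..

lemma problem_at_in_ci_problems: "problem_at d e A B \<in> ci_problems"
  unfolding problem_at_def Let_def ci_problems_def by (intro UN_I[of "length A"]) auto

theorem distance_approximation_reduction:
  assumes "poly_time_solvable \<beta> (weakening_decision TYPE('k::field) c)"
  shows "poly_time_solvable \<beta> (distance_approximation TYPE('k) d c \<iota>)"
proof (rule poly_time_reduction[OF assms, of _ "eapproximation d c"])
  fix C and v :: "'a val"
  assume "valid_output (weakening_decision TYPE('k) c) C v"
  then show "\<exists>r. v = Num r" by (auto simp: weakening_decision_def)
next
  fix G :: "'a val \<Rightarrow> 'a val" and y
  let ?X = "weakening_decision TYPE('k) c :: ('a, _) problem"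
  let ?Y = "distance_approximation TYPE('k) d c \<iota>"
  assume G: "\<And>C. C \<in> inputs ?X \<Longrightarrow> valid_output ?X C (G (encode ?X C))" and y: "y \<in> inputs ?Y"
  obtain Us Vs where UV: "y = (Us, Vs)" by (cases y)
  let ?M = "upset_sum d (map (map (map_vec \<iota>)) Us) :: ('k, nat \<times> unit) pmod"
  let ?N = "upset_sum d (map (map (map_vec \<iota>)) Vs) :: ('k, nat \<times> unit) pmod"
  define A where "A = filter (\<lambda>us. us \<noteq> []) Us"
  define B where "B = filter (\<lambda>us. us \<noteq> []) Vs"
  have carrier: "set us \<subseteq> carrier_vec d" if "us \<in> set Us \<union> set Vs" for us
    using y that unfolding distance_approximation_def UV Let_def by auto
  have noniso: "\<not> isomorphic d ?M ?N" and size: "size (barcode d ?M) = size (barcode d ?N)"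
    using y unfolding distance_approximation_def UV Let_def by auto
  have len: "length A = length B"
    using size size_barcode_gen[where 'k = 'k, of Us d] size_barcode_gen[where 'k = 'k, of Vs d] carrier unfolding A_def B_def by auto
  have AB: "a \<noteq> [] \<and> set a \<subseteq> carrier_vec d" if "a \<in> set A \<union> set B" for a
    using that carrier by (auto simp: A_def B_def)
  define solv where "solv e = ci_solvable TYPE('k) (problem_at d e A B)" for e
  have inter: "interleaved d e ?M ?N \<longleftrightarrow> 0 \<le> e \<and> solv e" for e
    unfolding solv_def A_def B_def
    by (rule interleaved_gen_iff) (use carrier len in \<open>auto simp: A_def B_def\<close>)
  have iso0: "\<not> solv 0"
    using noniso inter[of 0] isomorphic_iff_interleaved_zero[of d ?M ?N] pmodule_upset_sum by blast
  have "A \<noteq> []"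
  proof
    assume "A = []"
    then have "ci_solution (problem_at d 0 A B) (1\<^sub>m 0 :: 'k mat) (1\<^sub>m 0)"
      by (auto simp: ci_solution_def problem_at_def Let_def ci_size_def)
    then show False using iso0 unfolding solv_def ci_solvable_def by blast
  qed
  then obtain x0 where x0: "x0 \<in> set (thresholds d A B)" "solv (\<iota> x0)" "\<And>e. solv e \<Longrightarrow> \<iota> x0 \<le> e"
    using optimal_threshold[of A B d, where 'k = 'k] AB len unfolding solv_def by blast
  have pos: "0 \<le> x" if "x \<in> set (thresholds d A B)" for x
    using that AB by (auto simp: thresholds_def threshold_nonneg)
  have x0pos: "0 < \<iota> x0"
    using pos[OF x0(1)] iso0 x0(2) le_iff[of 0 x0] zero by (cases "x0 = 0") (auto simp: order_le_less)
  have dist: "interleaving_distance d ?M ?N = ereal (\<iota> x0)"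
    by (rule interleaving_distance_eqI) (use inter x0 x0pos in auto)
  define ans where "ans x = G (encode ?X (problem_at d (\<iota> x) A B))" for x
  have ans: "ans x = Num 0 \<and> \<not> solv (\<iota> x) \<or> ans x = Num 1 \<and> solv (real c * \<iota> x)"
    if "x \<in> set (thresholds d A B)" for x
  proof -
    let ?C = "problem_at d (\<iota> x) A B"
    have x: "0 \<le> \<iota> x" using le_iff[of 0 x] pos[OF that] zero by simp
    have eq: "problem_at d e A B = interleaving_problem d e (map (gen d) A) (map (gen d) B)"
      if "0 \<le> e" for e
      by (rule interleaving_problem_eq[symmetric]) (use AB len that in auto)
    have "ci_solvable TYPE('k) (weakening c ?C) \<Longrightarrow> solv (real c * \<iota> x)"
      unfolding solv_def using x
      by (simp add: eq) (rule weakening_solvable_imp, use len x upset_gen in auto)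
    moreover have "valid_output ?X ?C (ans x)"
      unfolding ans_def by (rule G) (simp add: weakening_decision_def problem_at_in_ci_problems)
    ultimately show ?thesis unfolding weakening_decision_def solv_def by auto
  qed
  define R where "R = filter (\<lambda>x. 0 < num_of (ans x)) (thresholds d A B)"
  have R: "x \<in> set R \<longleftrightarrow> x \<in> set (thresholds d A B) \<and> ans x = Num 1" for x
    using ans[of x] by (auto simp: R_def)
  have x0R: "x0 \<in> set R" using R ans[OF x0(1)] x0(1,2) by blast
  then have m: "Min (set R) \<in> set R" "Min (set R) \<le> x0" by (auto intro: Min_in)
  \<comment> \<open>The least threshold with a positive answer still certifies an interleaving.\<close>
  have lower: "\<iota> x0 \<le> real c * \<iota> (Min (set R))"
    using m(1) R ans x0(3) by fastforce
  have "\<iota> (Min (set R)) \<le> \<iota> x0" using m(2) le_iff by simp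
  then have "real c * \<iota> (Min (set R)) \<le> real c * \<iota> x0" by (rule mult_left_mono) simp
  also have "\<dots> < real (c + 2) * \<iota> x0" using x0pos by simp
  finally have upper: "real c * \<iota> (Min (set R)) < real (c + 2) * \<iota> x0" .
  define \<eta> where "\<eta> = (initial (encode ?Y y))(1 := vlist (map enc_points A), 2 := vlist (map enc_points B))"
  have enc: "encode ?Y y = Pair (vlist (map enc_points Us)) (vlist (map enc_points Vs))"
    by (simp add: distance_approximation_def Let_def UV enc_list_vlist[of enc_vec, abs_def]
      enc_list_vlist[of enc_points])
  let ?e4 = "EIfLess (EInt 0) (ECall (ECons (estars d 2 1) (estars d 1 2))) (elist [item 4]) ENil"
  have ev1: "eval G (initial (encode ?Y y)) (enonempty (EHead (EVar 0))) = vlist (map enc_points A)"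
    unfolding A_def by (rule eval_enonempty) (simp add: initial_def enc)
  have ev2: "eval G ((initial (encode ?Y y))(1 := v)) (enonempty (ETail (EVar 0))) = vlist (map enc_points B)" for v
    unfolding B_def by (rule eval_enonempty) (simp add: initial_def enc)
  have ev3: "eval G \<eta> (ethresholds d) = vlist (map Num (thresholds d A B))"
    by (rule eval_ethresholds[OF AB]) (auto simp: \<eta>_def)
  have arg: "eval G (\<eta>(4 := Pair (Num x) t)) (ECons (estars d 2 1) (estars d 1 2)) =
      encode ?X (problem_at d (\<iota> x) A B)" for x t
  proof -
    have "eval G (\<eta>(4 := Pair (Num x) t)) (estars d 2 1) =
        enc_mat (mat (length A) (length A) (\<lambda>(j, i). if threshold d (A ! i) (B ! j) \<le> x then Star else Zero))"
      by (rule eval_estars[of B A]) (use AB len in \<open>auto simp: \<eta>_def\<close>)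
    moreover have "eval G (\<eta>(4 := Pair (Num x) t)) (estars d 1 2) =
        enc_mat (mat (length A) (length A) (\<lambda>(i, j). if threshold d (B ! j) (A ! i) \<le> x then Star else Zero))"
      by (rule eval_estars[of A B]) (use AB len in \<open>auto simp: \<eta>_def\<close>)
    ultimately show ?thesis by (simp add: weakening_decision_def problem_at_number Let_def)
  qed
  have ev4: "eval G \<eta> (EGather 4 (ethresholds d) ?e4) = vlist (map Num R)"
  proof -
    have "eval G \<eta> (EGather 4 (ethresholds d) ?e4) =
        vlist (concat (map (\<lambda>x. if 0 < num_of (ans x) then [Num x] else []) (thresholds d A B)))"
    proof (rule eval_gather_map[OF ev3])
      fix x t
      show "eval G (\<eta>(4 := Pair (Num x) t)) ?e4 = vlist (if 0 < num_of (ans x) then [Num x] else [])"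
        using arg[of x t] by (simp add: ans_def)
    qed
    also have "concat (map (\<lambda>x. if 0 < num_of (ans x) then [Num x] else []) (thresholds d A B)) = map Num R"
    proof -
      have "concat (map (\<lambda>x. if P x then [Num x] else []) xs) = map Num (filter P xs)" for P and xs :: "'a list"
        by (induction xs) auto
      then show ?thesis unfolding R_def .
    qed
    finally show ?thesis .
  qed
  have "eval G \<eta> (emin (EGather 4 (ethresholds d) ?e4)) = Num (Min (set R))"
  proof -
    have "R \<noteq> []" using x0R by (cases R) simp_all
    from eval_ebest[OF ev4 this, of True] show ?thesis by simp
  qed
  then have ev: "eval G (initial (encode ?Y y)) (eapproximation d c) = Num (of_nat c * Min (set R))"
    unfolding eapproximation_def eval.simps ev1 ev2 \<eta>_def[symmetric] by simp
  have "\<iota> (of_nat c * Min (set R)) = real c * \<iota> (Min (set R))" by (simp add: mult of_nat)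
  then have valid: "valid_output ?Y y (eval G (initial (encode ?Y y)) (eapproximation d c))"
    unfolding ev using lower upper dist by (simp add: distance_approximation_def Let_def UV)
  have "safe G (encode ?X ` inputs ?X) \<eta> (EGather 4 (ethresholds d) ?e4)"
  proof -
    have "safe G (encode ?X ` inputs ?X) (\<eta>(4 := w)) ?e4" if w: "w \<in> set (suffixes (vlist (map Num xs)))" for w xs
    proof -
      from w obtain x t where "w = Pair (Num x) t" by (induction xs) auto
      then have "eval G (\<eta>(4 := w)) (ECons (estars d 2 1) (estars d 1 2)) \<in> encode ?X ` inputs ?X"
        unfolding \<open>w = _\<close> arg by (auto simp: weakening_decision_def problem_at_in_ci_problems)
      moreover have "safe G D (\<eta>(4 := w)) (ECons (estars d 2 1) (estars d 1 2))" for D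
        by (rule safe_if_call_free) (simp add: estars_def)
      ultimately show ?thesis by (simp only: safe.simps safe_if_call_free call_free.simps call_free_macros list.simps ball_simps) simp
    qed
    moreover have "safe G (encode ?X ` inputs ?X) \<eta> (ethresholds d)"
      by (rule safe_if_call_free) (simp add: ethresholds_def)
    ultimately show ?thesis unfolding safe.simps ev3 by blast
  qed
  then have "safe G (encode ?X ` inputs ?X) \<eta> (emin (EGather 4 (ethresholds d) ?e4))"
    by (rule safe_ebest)
  then have safe: "safe G (encode ?X ` inputs ?X) (initial (encode ?Y y)) (eapproximation d c)"
    unfolding eapproximation_def safe.simps ev1 ev2 \<eta>_def[symmetric]
    by - (intro conjI TrueI, (assumption | rule safe_if_call_free, simp add: enonempty_def)+)
  from safe valid show "safe G (encode ?X ` inputs ?X) (initial (encode ?Y y)) (eapproximation d c) \<and>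
      valid_output ?Y y (eval G (initial (encode ?Y y)) (eapproximation d c))" ..
qed

end

section \<open>Encoding directed distances by upsets\<close>

text \<open>The place \<open>z\<close> on the antidiagonal of the first two coordinates, lowered by \<open>h\<close> along the main
  diagonal; \<open>h\<close> is called the depth of the corner below. Places are \<open>K\<close> apart.\<close>

definition corner :: "nat \<Rightarrow> int \<Rightarrow> int \<Rightarrow> int \<Rightarrow> 'a::ring_1 vec" where
  "corner d K z h = vec d (\<lambda>l. of_int ((if l = 0 then K else if l = 1 then - K else 0) * z - h))"

definition raise :: "nat \<Rightarrow> 'a::ring_1 vec \<Rightarrow> 'a vec" where
  "raise d p = vec d (\<lambda>l. p $ l + 1)"

lemma raise_corner: "raise d (corner d K z h) = corner d K z (h - 1)"
  by (auto simp: raise_def corner_def)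

lemma corner_carrier [simp]: "corner d K z h \<in> carrier_vec d"
  by (simp add: corner_def)

fun position :: "nat \<Rightarrow> nat + nat \<Rightarrow> int" where
  "position n (Inl i) = int (n - i)"
| "position n (Inr j) = - int (n - j)"

definition vertices :: "nat \<Rightarrow> (nat + nat) set" where
  "vertices n = Inl ` {..<n} \<union> Inr ` {..<n}"

lemma position_inj: "x \<in> vertices n \<Longrightarrow> y \<in> vertices n \<Longrightarrow> position n x = position n y \<Longrightarrow> x = y"
  by (auto simp: vertices_def)

fun opposite :: "nat \<Rightarrow> nat + nat \<Rightarrow> (nat + nat) list" where
  "opposite n (Inl i) = map Inr [0..<n]"
| "opposite n (Inr j) = map Inl [0..<n]"

text \<open>Corners of depth 0 at all places. Appending an edge to the longest walks that are counted leads to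
  walks that are not counted any more; in \<open>edge_imp_inclusion\<close> these corners take their place.\<close>

definition base_corners :: "nat \<Rightarrow> int \<Rightarrow> nat \<Rightarrow> 'a::ring_1 vec list" where
  "base_corners d K n = concat (map (\<lambda>i. [corner d K (int (n - i)) 0, corner d K (- int (n - i)) 0]) [0..<n])"

definition extend :: "nat \<Rightarrow> ci_problem \<Rightarrow> (nat + nat \<Rightarrow> 'a::ring_1 vec list) \<Rightarrow> nat + nat \<Rightarrow> 'a vec list" where
  "extend d C W x = W x @ concat (map (\<lambda>y. if (y, x) \<in> ci_graph C then map (raise d) (W y) else [])
     (opposite (ci_size C) x))"

text \<open>A walk of length \<open>l \<le> m\<close> from \<open>z\<close> to \<open>x\<close> contributes a corner of depth \<open>K - l\<close> at the place of \<open>z\<close>.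
  Only the greatest depth at each place matters for the generated upset, that is, the length of a
  shortest walk. Leaving the other corners in the list avoids any computation of distances, and the
  lists remain of polynomial length because the number \<open>m\<close> of rounds is a constant of the program.\<close>

fun walk_corners :: "nat \<Rightarrow> int \<Rightarrow> ci_problem \<Rightarrow> nat \<Rightarrow> nat + nat \<Rightarrow> 'a::ring_1 vec list" where
  "walk_corners d K C 0 x = corner d K (position (ci_size C) x) K # base_corners d K (ci_size C)"
| "walk_corners d K C (Suc m) x = extend d C (walk_corners d K C m) x"

lemma ci_graph_vertices:
  "(x, y) \<in> ci_graph C \<Longrightarrow> x \<in> vertices (ci_size C) \<and> y \<in> vertices (ci_size C) \<and> x \<in> set (opposite (ci_size C) y)"
  by (auto simp: ci_graph_def vertices_def)

lemma set_extend: "set (extend d C W x) = set (W x) \<union> (\<Union>y\<in>{y. (y, x) \<in> ci_graph C}. raise d ` set (W y))"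
  using ci_graph_vertices[of _ x C] unfolding extend_def by (auto split: if_splits)

lemma set_base_corners: "set (base_corners d K n) = (\<lambda>z. corner d K (position n z) 0) ` vertices n"
  by (force simp: base_corners_def vertices_def)

lemma walk_cornersD:
  "q \<in> set (walk_corners d K C m x) \<Longrightarrow> x \<in> vertices (ci_size C) \<Longrightarrow>
    \<exists>z\<in>vertices (ci_size C). \<exists>h. q = corner d K (position (ci_size C) z) h \<and>
      (h \<le> 0 \<or> (\<exists>l. (z, x) \<in> ci_graph C ^^ l \<and> h = K - int l))"
proof (induction m arbitrary: x q)
  case 0
  then show ?case by (force simp: set_base_corners)
next
  case (Suc m)
  from Suc.prems(1) consider "q \<in> set (walk_corners d K C m x)"
    | y q' where "(y, x) \<in> ci_graph C" "q' \<in> set (walk_corners d K C m y)" "q = raise d q'"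
    by (auto simp: set_extend)
  then show ?case
  proof cases
    case 1
    then show ?thesis using Suc.IH Suc.prems(2) by blast
  next
    case 2
    then have "y \<in> vertices (ci_size C)" using ci_graph_vertices by blast
    from Suc.IH[OF 2(2) this] obtain z h where z: "z \<in> vertices (ci_size C)"
      "q' = corner d K (position (ci_size C) z) h"
      "h \<le> 0 \<or> (\<exists>l. (z, y) \<in> ci_graph C ^^ l \<and> h = K - int l)" by blast
    have "h - 1 \<le> 0 \<or> (\<exists>l. (z, x) \<in> ci_graph C ^^ l \<and> h - 1 = K - int l)"
      using z(3)
    proof (elim disjE exE conjE)
      fix l assume l: "(z, y) \<in> ci_graph C ^^ l" "h = K - int l"
      then have "(z, x) \<in> ci_graph C ^^ Suc l" using 2(1) by auto
      moreover have "h - 1 = K - int (Suc l)" using l by simp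
      ultimately show ?thesis by blast
    qed simp
    then show ?thesis using z(1,2) 2(3) raise_corner by blast
  qed
qed

lemma walk_corners_mono: "set (walk_corners d K C m x) \<subseteq> set (walk_corners d K C (Suc m) x)"
  by (simp add: set_extend)

lemma walk_cornersI:
  assumes "z \<in> vertices (ci_size C)"
  shows "(z, x) \<in> ci_graph C ^^ l \<Longrightarrow> l \<le> m \<Longrightarrow>
    (corner d K (position (ci_size C) z) (K - int l) :: 'a::ring_1 vec) \<in> set (walk_corners d K C m x)"
proof (induction m arbitrary: l x)
  case 0
  then show ?case by simp
next
  case (Suc m)
  show ?case
  proof (cases "l \<le> m")
    case True
    then show ?thesis using Suc.IH[OF Suc.prems(1)] walk_corners_mono by blast
  next
    case False
    then have l: "l = Suc m" using Suc.prems by simp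
    then obtain y where y: "(z, y) \<in> ci_graph C ^^ m" "(y, x) \<in> ci_graph C" using Suc.prems(1) by auto
    have "(raise d (corner d K (position (ci_size C) z) (K - int m)) :: 'a vec) \<in> set (walk_corners d K C (Suc m) x)"
      using Suc.IH[OF y(1) order_refl] y(2) unfolding walk_corners.simps set_extend by blast
    then show ?thesis by (simp only: raise_corner l of_nat_Suc diff_diff_eq add.commute[of 1])
  qed
qed

lemma walk_corners_base:
  assumes "z \<in> vertices (ci_size C)"
  shows "corner d K (position (ci_size C) z) 0 \<in> set (walk_corners d K C m x)"
proof (induction m)
  case 0
  then show ?case using assms by (auto simp: set_base_corners)
next
  case (Suc m)
  then show ?case using walk_corners_mono by blast
qed

lemma walk_corners_carrier: "set (walk_corners d K C m x) \<subseteq> carrier_vec d"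
proof (induction m arbitrary: x)
  case 0
  show ?case by (auto simp: base_corners_def)
next
  case (Suc m)
  then show ?case by (auto simp: set_extend raise_def)
qed

lemma walk_corners_nonempty: "walk_corners d K C m x \<noteq> []"
  by (induction m arbitrary: x) (auto simp: extend_def)

lemma ci_graph_parity: "(x, y) \<in> ci_graph C ^^ l \<Longrightarrow> isl x = isl y \<longleftrightarrow> even l"
proof (induction l arbitrary: y)
  case (Suc l)
  then obtain z where "(x, z) \<in> ci_graph C ^^ l" "(z, y) \<in> ci_graph C" by auto
  moreover from this(2) have "isl z \<noteq> isl y" by (auto simp: ci_graph_def)
  ultimately show ?case using Suc.IH by auto
qed auto

context embedded_numbers begin

text \<open>At different places the first two coordinates point in opposite directions, so that one of them
  costs at least \<open>K\<close>.\<close>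

lemma corner_le_iff:
  assumes "2 \<le> d" "0 \<le> e" "0 < K"
  shows "map_vec \<iota> (corner d K z' h') \<le> map_vec \<iota> (corner d K z h) + diag d e \<longleftrightarrow>
    real_of_int (K * \<bar>z' - z\<bar>) \<le> real_of_int (h' - h) + e"
proof -
  have "map_vec \<iota> (corner d K z' h') \<le> map_vec \<iota> (corner d K z h) + diag d e \<longleftrightarrow>
    (\<forall>l<d. real_of_int ((if l = 0 then K else if l = 1 then - K else 0) * z' - h') \<le>
      real_of_int ((if l = 0 then K else if l = 1 then - K else 0) * z - h) + e)"
  proof -
    have "map_vec \<iota> (corner d K w g) $ l =
        real_of_int ((if l = 0 then K else if l = 1 then - K else 0) * w - g)" if "l < d" for w g l
      unfolding corner_def using that by (simp only: index_map_vec dim_vec index_vec of_int)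
    moreover have "dim_vec (map_vec \<iota> (corner d K w g)) = d" for w g by (simp add: corner_def)
    ultimately show ?thesis
      unfolding less_eq_vec_def diag_def by (simp only: index_add_vec dim_vec index_vec index_map_vec simp_thms cong: imp_cong)
  qed
  also have "\<dots> \<longleftrightarrow> real_of_int (K * (z' - z)) \<le> real_of_int (h' - h) + e \<and>
      real_of_int (K * (z - z')) \<le> real_of_int (h' - h) + e" (is "?L \<longleftrightarrow> ?R")
  proof
    assume ?L
    from this[rule_format, of 0] this[rule_format, of 1] show ?R
      using assms(1) by (simp add: algebra_simps)
  next
    assume R: ?R
    then have "0 \<le> real_of_int (h' - h) + e" by (simp add: algebra_simps)
    with R show ?L by (auto simp: algebra_simps)
  qed
  also have "\<dots> \<longleftrightarrow> real_of_int (K * \<bar>z' - z\<bar>) \<le> real_of_int (h' - h) + e"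
  proof -
    have two: "X \<le> T \<and> Y \<le> T \<longleftrightarrow> X \<le> T" "Y \<le> T \<and> X \<le> T \<longleftrightarrow> X \<le> T" if "Y \<le> X" for X Y T :: real
      using that by linarith+
    have mono: "real_of_int (K * a) \<le> real_of_int (K * b)" if "a \<le> b" for a b
      unfolding of_int_le_iff using that assms(3) by (intro mult_left_mono) auto
    show ?thesis
    proof (cases "z \<le> z'")
      case True
      then show ?thesis by (subst two(1)[OF mono]) auto
    next
      case False
      then show ?thesis by (subst two(2)[OF mono]) (auto simp: abs_if)
    qed
  qed
  finally show ?thesis .
qed

text \<open>Appending the edge to a walk decreases the depth by 1; corners of depth at most 0 are dominated by the
  corners of depth 0.\<close>

lemma edge_imp_inclusion:
  assumes d: "2 \<le> d" and K: "0 < K" and xy: "(x, y) \<in> ci_graph C"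
  shows "\<forall>p\<in>gen d (walk_corners d (int K) C K x). p + diag d 1 \<in> gen d (walk_corners d (int K) C K y)"
  unfolding gen_subset_iff[OF walk_corners_carrier walk_corners_carrier]
proof
  fix p :: "'a vec" assume p: "p \<in> set (walk_corners d (int K) C K x)"
  have le: "map_vec \<iota> (corner d (int K) z h') \<le> map_vec \<iota> (corner d (int K) z h) + diag d 1"
    if "h \<le> h' + 1" for z h h'
    using that K by (subst corner_le_iff[OF d]) auto
  from walk_cornersD[OF p] ci_graph_vertices[OF xy] obtain z h where z: "z \<in> vertices (ci_size C)"
    "p = corner d (int K) (position (ci_size C) z) h"
    "h \<le> 0 \<or> (\<exists>l. (z, x) \<in> ci_graph C ^^ l \<and> h = int K - int l)" by blast
  show "\<exists>q\<in>set (walk_corners d (int K) C K y). map_vec \<iota> q \<le> map_vec \<iota> p + diag d 1"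
  proof (cases "h \<le> 0")
    case True
    then show ?thesis
      unfolding z(2) by (intro bexI[OF _ walk_corners_base[OF z(1)]] le) simp
  next
    case False
    then obtain l where l: "(z, x) \<in> ci_graph C ^^ l" "h = int K - int l" using z(3) by blast
    then have "(z, y) \<in> ci_graph C ^^ Suc l" "Suc l \<le> K" using xy False by auto
    from walk_cornersI[OF z(1) this] show ?thesis
      unfolding z(2) by (rule bexI[rotated]) (rule le, use l in auto)
  qed
qed

text \<open>The corner of depth \<open>K\<close> that \<open>x\<close> has at its own place must get above a corner of \<open>y\<close>. As the shift is
  less than \<open>K\<close>, this corner lies at the same place and has depth at least \<open>K - e > 0\<close>, hence comes
  from a walk.\<close>

lemma inclusion_imp_walk:
  assumes d: "2 \<le> d" and e: "0 \<le> e" "e < real K" and xy: "x \<in> vertices (ci_size C)" "y \<in> vertices (ci_size C)"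
    and sub: "\<forall>p\<in>gen d (walk_corners d (int K) C K x). p + diag d e \<in> gen d (walk_corners d (int K) C K y)"
  shows "\<exists>l. real l \<le> e \<and> (x, y) \<in> ci_graph C ^^ l"
proof -
  have K: "0 < int K" using e by (cases K) auto
  have "corner d (int K) (position (ci_size C) x) (int K - int 0) \<in> set (walk_corners d (int K) C K x)"
    by (rule walk_cornersI[OF xy(1)]) auto
  with sub obtain q :: "'a vec" where q: "q \<in> set (walk_corners d (int K) C K y)"
    "map_vec \<iota> q \<le> map_vec \<iota> (corner d (int K) (position (ci_size C) x) (int K)) + diag d e"
    unfolding gen_subset_iff[OF walk_corners_carrier walk_corners_carrier] by fastforce
  from walk_cornersD[OF q(1) xy(2)] obtain z h where z: "z \<in> vertices (ci_size C)"
    "q = corner d (int K) (position (ci_size C) z) h"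
    "h \<le> 0 \<or> (\<exists>l. (z, y) \<in> ci_graph C ^^ l \<and> h = int K - int l)" by blast
  let ?\<delta> = "\<bar>position (ci_size C) z - position (ci_size C) x\<bar>"
  have le: "real_of_int (int K * ?\<delta>) \<le> real_of_int (h - int K) + e"
    using q(2) unfolding z(2) corner_le_iff[OF d e(1) K] .
  have "0 \<le> int K * ?\<delta>" using K by simp
  then have "0 \<le> real_of_int (int K * ?\<delta>)" by (simp only: of_int_0_le_iff)
  moreover have hK: "real_of_int (h - int K) = real_of_int h - real K" by simp
  ultimately have h: "real K - e \<le> real_of_int h" using le by linarith
  then have "0 < h" using e(2) by linarith
  then obtain l where l: "(z, y) \<in> ci_graph C ^^ l" "h = int K - int l" using z(3) by auto
  have le': "real l \<le> e" using h l(2) by simp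
  have "real_of_int (int K * ?\<delta>) < real K" using le hK l(2) e(2) by linarith
  then have "real_of_int (int K * ?\<delta>) < real_of_int (int K)" by simp
  then have "int K * ?\<delta> < int K * 1" by (simp only: of_int_less_iff mult_1_right)
  then have "?\<delta> < 1" using K by (simp only: mult_less_cancel_left_pos)
  then have "z = x" using position_inj[OF z(1) xy(1)] by simp
  then show ?thesis using l(1) le' by blast
qed

end

section \<open>Deciding CI problems with a distance approximation\<close>

abbreviation enc_family :: "nat \<Rightarrow> ('v \<Rightarrow> 'a vec list) \<Rightarrow> (nat \<Rightarrow> 'v) \<Rightarrow> 'a val" where
  "enc_family n W f \<equiv> vlist (map (\<lambda>i. enc_points (W (f i))) [0..<n])"

definition eappend :: "expr \<Rightarrow> expr \<Rightarrow> expr" where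
  "eappend a b = EGather 9 (elist [a, b]) (item 9)"

lemma eval_eappend:
  assumes "eval G \<eta> a = vlist xs" "eval G \<eta> b = vlist ys"
  shows "eval G \<eta> (eappend a b) = vlist (xs @ ys)"
proof -
  have "eval G \<eta> (eappend a b) = vlist (concat (map (\<lambda>zs. zs) [xs, ys]))"
    unfolding eappend_def by (rule eval_gather_map[where e = vlist]) (use assms in auto)
  then show ?thesis by simp
qed

text \<open>The entry of \<open>l\<close> at the position of the list named \<open>x\<close>. Both names are bound to final parts of lists
  of the same length, so equal positions are equal lengths.\<close>

definition eselect :: "nat \<Rightarrow> nat \<Rightarrow> expr \<Rightarrow> expr \<Rightarrow> expr" where
  "eselect x y l b = EGather y l (EIfLess (ELen (EVar x)) (ELen (EVar y)) ENil
     (EIfLess (ELen (EVar y)) (ELen (EVar x)) ENil b))"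

lemma eval_eselect:
  fixes xs :: "'a::linordered_field val list"
  assumes l: "eval G \<eta> l = vlist xs" and x: "length (elems (\<eta> x)) = length xs - i" "x \<noteq> y" and i: "i < length xs"
    and b: "\<And>t. eval G (\<eta>(y := Pair (xs ! i) t)) b = vlist R"
  shows "eval G \<eta> (eselect x y l b) = vlist R"
proof -
  have "eval G \<eta> (eselect x y l b) = vlist (concat (map (\<lambda>k. if k = i then R else []) [0..<length xs]))"
    unfolding eselect_def
  proof (rule eval_gather_nth[OF l])
    fix k and t :: "'a val" assume k: "k < length xs" "length (elems t) = length xs - Suc k"
    have len: "Suc (length (elems t)) = length xs - k" using k by simp
    have eq: "length xs - i = length xs - k \<longleftrightarrow> k = i" using k(1) i by auto
    have less: "(of_nat m :: 'a) < of_nat n \<longleftrightarrow> m < n" for m n by (rule of_nat_less_iff)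
    have lx: "eval G (\<eta>(y := Pair (xs ! k) t)) (ELen (EVar x)) = Num (of_nat (length xs - i))"
      using x by simp
    have ly: "eval G (\<eta>(y := Pair (xs ! k) t)) (ELen (EVar y)) = Num (of_nat (length xs - k))"
      using len by simp
    show "eval G (\<eta>(y := Pair (xs ! k) t)) (EIfLess (ELen (EVar x)) (ELen (EVar y)) ENil
        (EIfLess (ELen (EVar y)) (ELen (EVar x)) ENil b)) = vlist (if k = i then R else [])"
    proof (cases "k = i")
      case True
      have "eval G (\<eta>(y := Pair (xs ! k) t)) b = vlist R" using b True by simp
      then show ?thesis unfolding eval.simps(8) lx ly num_of.simps less using True by simp
    next
      case False
      then have "length xs - i < length xs - k \<or> length xs - k < length xs - i" using eq by linarith
      then show ?thesis unfolding eval.simps(8) lx ly num_of.simps less using False by auto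
    qed
  qed
  also have "concat (map (\<lambda>k. if k = i then R else []) [0..<length xs]) = R"
  proof -
    have "concat (map (\<lambda>k. if k = i then R else []) [0..<n]) = (if i < n then R else [])" for n
      by (induction n) auto
    then show ?thesis using i by simp
  qed
  finally show ?thesis .
qed

definition ecorner :: "nat \<Rightarrow> int \<Rightarrow> expr \<Rightarrow> int \<Rightarrow> expr" where
  "ecorner d K z h = elist (map (\<lambda>l. EArith Minus
     (EArith Times (EInt (if l = 0 then K else if l = 1 then - K else 0)) z) (EInt h)) [0..<d])"

lemma eval_ecorner:
  assumes "eval G \<eta> z = Num (of_int w)"
  shows "eval G \<eta> (ecorner d K z h) = enc_vec (corner d K w h)"
  unfolding ecorner_def eval_elist enc_vec_vlist corner_def list_of_vec_vec map_map
  by (rule arg_cong[of _ _ vlist], rule map_cong[OF refl]) (simp add: assms)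

definition eraise :: "nat \<Rightarrow> expr \<Rightarrow> expr" where
  "eraise d l = emap 8 l (elist (map (\<lambda>i. EArith Plus (enth i (item 8)) (EInt 1)) [0..<d]))"

lemma eval_eraise:
  assumes "eval G \<eta> l = enc_points us" "set us \<subseteq> carrier_vec d"
  shows "eval G \<eta> (eraise d l) = enc_points (map (raise d) us)"
proof -
  have "eval G \<eta> (eraise d l) = vlist (map (\<lambda>p. enc_vec (raise d p)) us)"
    unfolding eraise_def
  proof (rule eval_emap_map[OF assms(1)])
    fix p t assume "p \<in> set us"
    then have p: "p \<in> carrier_vec d" using assms(2) by auto
    have "eval G (\<eta>(8 := Pair (enc_vec p) t)) (enth i (item 8)) = Num (p $ i)" if "i < d" for i
      by (rule eval_nth_coordinate[OF p that]) simp
    then show "eval G (\<eta>(8 := Pair (enc_vec p) t))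
        (elist (map (\<lambda>i. EArith Plus (enth i (item 8)) (EInt 1)) [0..<d])) = enc_vec (raise d p)"
      unfolding eval_elist enc_vec_vlist raise_def list_of_vec_vec map_map
      by (intro arg_cong[of _ _ vlist] map_cong) auto
  qed
  then show ?thesis by (simp add: comp_def)
qed

definition eposition :: "nat \<Rightarrow> bool \<Rightarrow> expr" where
  "eposition x left = (if left then ELen (EVar x) else EArith Minus (EInt 0) (ELen (EVar x)))"

definition ebase :: "nat \<Rightarrow> int \<Rightarrow> expr" where
  "ebase d K = EGather 2 (EHead (EVar 0)) (elist [ecorner d K (eposition 2 True) 0, ecorner d K (eposition 2 False) 0])"

definition estart :: "nat \<Rightarrow> int \<Rightarrow> bool \<Rightarrow> expr" where
  "estart d K left = emap 1 (EHead (EVar 0)) (ECons (ecorner d K (eposition 1 left) K) (ebase d K))"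

text \<open>One round for one side of the graph. The entries of row \<open>i\<close> of \<open>table\<close> tell which vertices of the
  other side have an edge to vertex \<open>i\<close> of the own side.\<close>

definition eextend :: "nat \<Rightarrow> expr \<Rightarrow> nat \<Rightarrow> nat \<Rightarrow> expr" where
  "eextend d table own other = emap 5 table (eappend (eselect 5 6 (EVar own) (item 6))
     (EGather 6 (item 5) (EIfLess (EInt 0) (item 6) (eselect 6 7 (EVar other) (eraise d (item 7))) ENil)))"

text \<open>The names 3 and 4 hold the corners of the two sides. Both new lists are computed from the old ones
  before either is replaced.\<close>

fun erounds :: "nat \<Rightarrow> nat \<Rightarrow> expr \<Rightarrow> expr" where
  "erounds d 0 e = e"
| "erounds d (Suc m) e = ELet 12 (eextend d (ETail (EVar 0)) 3 4) (ELet 13 (eextend d (EHead (EVar 0)) 4 3)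
     (ELet 3 (EVar 12) (ELet 4 (EVar 13) (erounds d m e))))"

definition edecision :: "nat \<Rightarrow> nat \<Rightarrow> expr" where
  "edecision d c = EIfPair (EHead (EVar 0))
     (ELet 3 (estart d (int (c + 2)) True) (ELet 4 (estart d (int (c + 2)) False)
       (erounds d (c + 2) (EIfLess (ECall (ECons (EVar 3) (EVar 4))) (EInt (int (c + 2))) (EInt 1) (EInt 0)))))
     (EInt 1)"

lemma call_free_graph_macros:
  "call_free (estart d K left)" "call_free table \<Longrightarrow> call_free (eextend d table own other)"
  by (auto simp: estart_def ebase_def eposition_def ecorner_def eextend_def eappend_def eselect_def eraise_def item_def)

lemma eval_eposition:
  assumes "length (elems (\<eta> x)) = n - i"
  shows "eval G \<eta> (eposition x left) = Num (of_int (position n (if left then Inl i else Inr i)))"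
  using assms by (simp add: eposition_def)

lemma eval_ebase:
  fixes \<eta> :: "nat \<Rightarrow> 'a::linordered_field val"
  assumes "head (\<eta> 0) = vlist xs" "length xs = n"
  shows "eval G \<eta> (ebase d K) = enc_points (base_corners d K n)"
proof -
  have "eval G \<eta> (ebase d K) = vlist (concat (map (\<lambda>i. [enc_vec (corner d K (position n (Inl i)) 0),
      enc_vec (corner d K (position n (Inr i)) 0)]) [0..<length xs]))"
    unfolding ebase_def
  proof (rule eval_gather_nth)
    fix i and t :: "'a val" assume i: "i < length xs" "length (elems t) = length xs - Suc i"
    let ?\<eta> = "\<eta>(2 := Pair (xs ! i) t)"
    have "length (elems (?\<eta> 2)) = n - i" using i assms(2) by simp
    note h = eval_eposition[of ?\<eta>, OF this]
    have "eval G ?\<eta> (ecorner d K (eposition 2 True) 0) = enc_vec (corner d K (position n (Inl i)) 0)"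
      "eval G ?\<eta> (ecorner d K (eposition 2 False) 0) = enc_vec (corner d K (position n (Inr i)) 0)"
      by (rule eval_ecorner, simp only: h if_True if_False)+
    then show "eval G ?\<eta> (elist [ecorner d K (eposition 2 True) 0, ecorner d K (eposition 2 False) 0]) =
        vlist [enc_vec (corner d K (position n (Inl i)) 0), enc_vec (corner d K (position n (Inr i)) 0)]"
      by simp
  qed (use assms in simp)
  then show ?thesis using assms(2) by (simp add: base_corners_def map_concat comp_def)
qed

lemma eval_estart:
  fixes \<eta> :: "nat \<Rightarrow> 'a::linordered_field val"
  assumes "head (\<eta> 0) = vlist xs" "length xs = ci_size C"
  shows "eval G \<eta> (estart d K left) =
    vlist (map (\<lambda>i. enc_points (walk_corners d K C 0 (if left then Inl i else Inr i))) [0..<ci_size C])"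
proof -
  have "eval G \<eta> (estart d K left) =
      vlist (map (\<lambda>i. enc_points (walk_corners d K C 0 (if left then Inl i else Inr i))) [0..<length xs])"
    unfolding estart_def
  proof (rule eval_emap_nth)
    fix i and t :: "'a val" assume i: "i < length xs" "length (elems t) = length xs - Suc i"
    let ?\<eta> = "\<eta>(1 := Pair (xs ! i) t)"
    have "length (elems (?\<eta> 1)) = ci_size C - i" using i assms(2) by simp
    from eval_ecorner[OF eval_eposition[where \<eta> = ?\<eta> and x = 1 and n = "ci_size C" and i = i, OF this]]
    have "eval G ?\<eta> (ecorner d K (eposition 1 left) K) =
        enc_vec (corner d K (position (ci_size C) (if left then Inl i else Inr i)) K)" .
    moreover have "eval G ?\<eta> (ebase d K) = enc_points (base_corners d K (ci_size C))"
      by (rule eval_ebase[OF _ assms(2)]) (use assms(1) in simp)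
    ultimately show "eval G ?\<eta> (ECons (ecorner d K (eposition 1 left) K) (ebase d K)) =
        enc_points (walk_corners d K C 0 (if left then Inl i else Inr i))" by simp
  qed (use assms in simp)
  then show ?thesis unfolding assms(2) .
qed

lemma eval_eextend:
  fixes W :: "nat + nat \<Rightarrow> 'a::linordered_field vec list"
  assumes table: "eval G \<eta> table = vlist (map (\<lambda>i. vlist (map (\<lambda>j. enc_entry (R i j)) [0..<n])) [0..<n])"
    and own: "\<eta> own = enc_family n W f" "own \<noteq> 5" "own \<noteq> 6"
    and other: "\<eta> other = enc_family n W g" "other \<noteq> 5" "other \<noteq> 6" "other \<noteq> 7"
    and R: "\<And>i j. i < n \<Longrightarrow> j < n \<Longrightarrow> R i j = Star \<longleftrightarrow> (g j, f i) \<in> ci_graph C"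
    and opp: "\<And>i. i < n \<Longrightarrow> opposite (ci_size C) (f i) = map g [0..<n]"
    and W: "\<And>x. set (W x) \<subseteq> carrier_vec d"
  shows "eval G \<eta> (eextend d table own other) = enc_family n (extend d C W) f"
proof -
  let ?row = "\<lambda>i. vlist (map (\<lambda>j. enc_entry (R i j)) [0..<n]) :: 'a val"
  have "eval G \<eta> (eextend d table own other) =
      vlist (map (\<lambda>i. enc_points (extend d C W (f i))) [0..<length (map ?row [0..<n])])"
    unfolding eextend_def
  proof (rule eval_emap_nth[OF table])
    fix i and t :: "'a val" assume "i < length (map ?row [0..<n])" "length (elems t) = length (map ?row [0..<n]) - Suc i"
    then have i: "i < n" "length (elems t) = n - Suc i" by simp_all
    let ?\<eta> = "\<eta>(5 := Pair (map ?row [0..<n] ! i) t)"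
    have row: "map ?row [0..<n] ! i = ?row i" using i(1) by simp
    have "eval G ?\<eta> (eselect 5 6 (EVar own) (item 6)) = enc_points (W (f i))"
      by (rule eval_eselect[of _ _ _ "map (\<lambda>i. enc_points (W (f i))) [0..<n]" _ i])
         (use own i in auto)
    moreover have "eval G ?\<eta> (EGather 6 (item 5) (EIfLess (EInt 0) (item 6) (eselect 6 7 (EVar other) (eraise d (item 7))) ENil))
      = vlist (concat (map (\<lambda>j. if (g j, f i) \<in> ci_graph C then map enc_vec (map (raise d) (W (g j))) else [])
          [0..<length (map (\<lambda>j. enc_entry (R i j) :: 'a val) [0..<n])]))"
    proof (rule eval_gather_nth)
      show "eval G ?\<eta> (item 5) = ?row i" using row by simp
      fix j and t' :: "'a val"
      assume "j < length (map (\<lambda>j. enc_entry (R i j) :: 'a val) [0..<n])"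
        "length (elems t') = length (map (\<lambda>j. enc_entry (R i j) :: 'a val) [0..<n]) - Suc j"
      then have j: "j < n" "length (elems t') = n - Suc j" by simp_all
      let ?\<eta>' = "?\<eta>(6 := Pair (map (\<lambda>j. enc_entry (R i j) :: 'a val) [0..<n] ! j) t')"
      have "eval G ?\<eta>' (eselect 6 7 (EVar other) (eraise d (item 7))) = enc_points (map (raise d) (W (g j)))"
      proof (rule eval_eselect[of _ _ _ "map (\<lambda>i. enc_points (W (g i))) [0..<n]" _ j])
        fix t''
        show "eval G (?\<eta>'(7 := Pair (map (\<lambda>i. enc_points (W (g i))) [0..<n] ! j) t'')) (eraise d (item 7)) =
            enc_points (map (raise d) (W (g j)))"
          by (rule eval_eraise[OF _ W]) (use j in simp)
      qed (use other j in auto)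
      moreover have "R i j = Star \<or> R i j = Zero" by (cases "R i j") auto
      ultimately show "eval G ?\<eta>' (EIfLess (EInt 0) (item 6) (eselect 6 7 (EVar other) (eraise d (item 7))) ENil) =
          vlist (if (g j, f i) \<in> ci_graph C then map enc_vec (map (raise d) (W (g j))) else [])"
        using R[OF i(1) j(1)] j(1) by auto
    qed
    ultimately have "eval G ?\<eta> (eappend (eselect 5 6 (EVar own) (item 6))
        (EGather 6 (item 5) (EIfLess (EInt 0) (item 6) (eselect 6 7 (EVar other) (eraise d (item 7))) ENil)))
      = vlist (map enc_vec (W (f i)) @ concat (map (\<lambda>j. if (g j, f i) \<in> ci_graph C then map enc_vec (map (raise d) (W (g j))) else [])
          [0..<length (map (\<lambda>j. enc_entry (R i j) :: 'a val) [0..<n])]))"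
      by (rule eval_eappend)
    also have "\<dots> = enc_points (extend d C W (f i))"
      unfolding extend_def opp[OF i(1)]
      by (simp add: map_concat comp_def if_distrib[of "map _"] cong: if_cong)
    finally show "eval G ?\<eta> (eappend (eselect 5 6 (EVar own) (item 6))
        (EGather 6 (item 5) (EIfLess (EInt 0) (item 6) (eselect 6 7 (EVar other) (eraise d (item 7))) ENil)))
      = enc_points (extend d C W (f i))" .
  qed
  then show ?thesis by simp
qed

lemma enc_mat_vlist:
  "A \<in> carrier_mat n n \<Longrightarrow> enc_mat A = vlist (map (\<lambda>i. vlist (map (\<lambda>j. enc_entry (A $$ (i, j))) [0..<n])) [0..<n])"
  unfolding enc_mat_def enc_list_vlist[of "enc_list enc_entry"]
  by (auto simp: mat_to_list_def enc_list_vlist[of enc_entry] comp_def)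

lemma eval_erounds:
  fixes \<eta> :: "nat \<Rightarrow> 'a::linordered_field val"
  assumes C: "C \<in> ci_problems"
    and "\<eta> 0 = Pair (enc_mat (fst C)) (enc_mat (snd C))"
    and "\<eta> 3 = enc_family (ci_size C) (walk_corners d K C k) Inl"
    and "\<eta> 4 = enc_family (ci_size C) (walk_corners d K C k) Inr"
  shows "\<exists>\<eta>'. \<eta>' 3 = enc_family (ci_size C) (walk_corners d K C (k + m)) Inl \<and>
    \<eta>' 4 = enc_family (ci_size C) (walk_corners d K C (k + m)) Inr \<and>
    eval G \<eta> (erounds d m e) = eval G \<eta>' e \<and> (\<forall>D. safe G D \<eta>' e \<longrightarrow> safe G D \<eta> (erounds d m e))"
  using assms(2-4)
proof (induction m arbitrary: \<eta> k)
  case 0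
  then show ?case by auto
next
  case (Suc m)
  define n where "n = ci_size C"
  have mats: "fst C \<in> carrier_mat n n" "snd C \<in> carrier_mat n n"
    using C by (auto simp: ci_problems_def n_def ci_size_def)
  define u v where "u = enc_family n (walk_corners d K C (Suc k) :: _ \<Rightarrow> 'a vec list) Inl"
    and "v = enc_family n (walk_corners d K C (Suc k) :: _ \<Rightarrow> 'a vec list) Inr"
  have u: "eval G \<eta> (eextend d (ETail (EVar 0)) 3 4) = u"
    unfolding u_def walk_corners.simps
    by (rule eval_eextend[where R = "\<lambda>i j. snd C $$ (i, j)" and f = Inl and g = Inr])
       (use Suc.prems mats in \<open>auto simp: enc_mat_vlist n_def ci_graph_def intro: subsetD[OF walk_corners_carrier]\<close>)
  have v: "eval G (\<eta>(12 := w)) (eextend d (EHead (EVar 0)) 4 3) = v" for w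
    unfolding v_def walk_corners.simps
    by (rule eval_eextend[where R = "\<lambda>i j. fst C $$ (i, j)" and f = Inr and g = Inl])
       (use Suc.prems mats in \<open>auto simp: enc_mat_vlist n_def ci_graph_def intro: subsetD[OF walk_corners_carrier]\<close>)
  define \<eta>1 where "\<eta>1 = \<eta>(12 := u, 13 := v, 3 := u, 4 := v)"
  have ev: "eval G \<eta> (erounds d (Suc m) e) = eval G \<eta>1 (erounds d m e)"
    unfolding erounds.simps eval.simps u v by (simp add: \<eta>1_def)
  have safe: "safe G D \<eta> (erounds d (Suc m) e)" if "safe G D \<eta>1 (erounds d m e)" for D
  proof -
    have "safe G D \<eta>' (eextend d (ETail (EVar 0)) 3 4)" "safe G D \<eta>' (eextend d (EHead (EVar 0)) 4 3)" for \<eta>'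
      by (rule safe_if_call_free, rule call_free_graph_macros, simp)+
    then show ?thesis using that unfolding erounds.simps safe.simps eval.simps u v by (simp add: \<eta>1_def)
  qed
  have "\<exists>\<eta>'. \<eta>' 3 = enc_family (ci_size C) (walk_corners d K C (Suc k + m)) Inl \<and>
    \<eta>' 4 = enc_family (ci_size C) (walk_corners d K C (Suc k + m)) Inr \<and>
    eval G \<eta>1 (erounds d m e) = eval G \<eta>' e \<and> (\<forall>D. safe G D \<eta>' e \<longrightarrow> safe G D \<eta>1 (erounds d m e))"
    by (rule Suc.IH) (use Suc.prems in \<open>auto simp: \<eta>1_def u_def v_def n_def\<close>)
  then show ?case unfolding ev using safe by (metis add_Suc_shift)
qed

context embedded_numbers begin

text \<open>A walk between the two sides has odd length; if it is shorter than \<open>c + 2\<close>, its length is at most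
  \<open>c\<close>, as \<open>c\<close> is odd too. At shift 0 there are no walks between different sides at all.\<close>

lemma walk_interleaving:
  fixes C :: ci_problem and c d :: nat
  defines "n \<equiv> ci_size C"
  defines "W \<equiv> (\<lambda>x. walk_corners d (int (c + 2)) C (c + 2) x :: 'a vec list)"
  defines "Us \<equiv> map (gen d) (map (\<lambda>i. W (Inl i)) [0..<n])" and "Vs \<equiv> map (gen d) (map (\<lambda>i. W (Inr i)) [0..<n])"
  assumes d: "2 \<le> d" and c: "odd c"
  shows "ci_solvable TYPE('k::field) C \<Longrightarrow> interleaved d 1 (usum Us :: ('k, _) pmod) (usum Vs :: ('k, _) pmod)"
    and "interleaved d e (usum Us :: ('k, _) pmod) (usum Vs :: ('k, _) pmod) \<Longrightarrow> e < real (c + 2) \<Longrightarrow>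
      ci_solvable TYPE('k) (weakening c C)"
    and "0 < n \<Longrightarrow> \<not> interleaved d 0 (usum Us :: ('k, _) pmod) (usum Vs :: ('k, _) pmod)"
proof -
  have ne: "gen d (W x) \<noteq> {}" for x
    unfolding W_def gen_empty_iff[OF walk_corners_carrier] by (rule walk_corners_nonempty)
  have iff: "interleaved d e (usum Us :: ('k, _) pmod) (usum Vs :: ('k, _) pmod) \<longleftrightarrow>
      0 \<le> e \<and> ci_solvable TYPE('k) (interleaving_problem d e Us Vs)" for e
    by (rule interleaved_iff_ci_solvable) (use ne in \<open>auto simp: Us_def Vs_def upset_gen\<close>)
  have nth: "Us ! i = gen d (W (Inl i))" "Vs ! i = gen d (W (Inr i))" if "i < n" for i
    using that by (simp_all add: Us_def Vs_def)
  have size: "ci_size (interleaving_problem d e Us Vs) = n" "length Us = n" for e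
    by (simp_all add: ci_size_def interleaving_problem_def Let_def Us_def)
  have fst: "fst (interleaving_problem d e Us Vs) $$ (j, i) = Zero \<longleftrightarrow>
      \<not> (\<forall>p\<in>gen d (W (Inl i)). p + diag d e \<in> gen d (W (Inr j)))" if "i < n" "j < n" for i j e
    using that by (simp add: interleaving_problem_def Let_def size nth)
  have snd: "snd (interleaving_problem d e Us Vs) $$ (i, j) = Zero \<longleftrightarrow>
      \<not> (\<forall>p\<in>gen d (W (Inr j)). p + diag d e \<in> gen d (W (Inl i)))" if "i < n" "j < n" for i j e
    using that by (simp add: interleaving_problem_def Let_def size nth)
  have vert: "Inl i \<in> vertices n" "Inr i \<in> vertices n" if "i < n" for i
    using that by (auto simp: vertices_def)
  have edge: "\<forall>p\<in>gen d (W x). p + diag d 1 \<in> gen d (W y)" if "(x, y) \<in> ci_graph C" for x y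
    unfolding W_def by (rule edge_imp_inclusion[OF d _ that]) simp
  have walk: "\<exists>l. real l \<le> e \<and> (x, y) \<in> ci_graph C ^^ l"
    if "0 \<le> e" "e < real (c + 2)" "x \<in> vertices n" "y \<in> vertices n"
      "\<forall>p\<in>gen d (W x). p + diag d e \<in> gen d (W y)" for x y e
    using that unfolding W_def n_def by (intro inclusion_imp_walk[OF d])
  show "interleaved d 1 (usum Us :: ('k, _) pmod) (usum Vs :: ('k, _) pmod)" if s: "ci_solvable TYPE('k) C"
    unfolding iff
  proof (intro conjI ci_solvable_mono[OF _ _ _ s])
    fix i j assume "i < ci_size C" "j < ci_size C"
    then have ij: "i < n" "j < n" by (simp_all add: n_def)
    show "fst C $$ (i, j) = Zero" if "fst (interleaving_problem d 1 Us Vs) $$ (i, j) = Zero"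
    proof (rule ccontr)
      assume "fst C $$ (i, j) \<noteq> Zero"
      then have "(Inl j, Inr i) \<in> ci_graph C"
        using ij by (cases "fst C $$ (i, j)") (auto simp: ci_graph_def n_def)
      then show False using edge that fst[OF ij(2,1)] by blast
    qed
    show "snd C $$ (i, j) = Zero" if "snd (interleaving_problem d 1 Us Vs) $$ (i, j) = Zero"
    proof (rule ccontr)
      assume "snd C $$ (i, j) \<noteq> Zero"
      then have "(Inr j, Inl i) \<in> ci_graph C"
        using ij by (cases "snd C $$ (i, j)") (auto simp: ci_graph_def n_def)
      then show False using edge that snd[OF ij] by blast
    qed
  qed (simp_all add: size n_def)
  show "ci_solvable TYPE('k) (weakening c C)"
    if int: "interleaved d e (usum Us :: ('k, _) pmod) (usum Vs :: ('k, _) pmod)" and e: "e < real (c + 2)"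
  proof -
    from int have s: "0 \<le> e" "ci_solvable TYPE('k) (interleaving_problem d e Us Vs)" unfolding iff by blast+
    have path: "path_upto (ci_graph C) c x y"
      if "x \<in> vertices n" "y \<in> vertices n" "isl x \<noteq> isl y" "\<forall>p\<in>gen d (W x). p + diag d e \<in> gen d (W y)" for x y
    proof -
      from walk[OF s(1) e that(1,2,4)] obtain l where l: "real l \<le> e" "(x, y) \<in> ci_graph C ^^ l" by blast
      then have "odd l" using ci_graph_parity[OF l(2)] that(3) by blast
      moreover have "l < c + 2" using l(1) e by linarith
      ultimately have "l \<le> c" using c by presburger
      then show ?thesis using l(2) unfolding path_upto_def by blast
    qed
    show ?thesis
    proof (rule ci_solvable_mono[OF _ _ _ s(2)])
      fix i j assume "i < ci_size (interleaving_problem d e Us Vs)" "j < ci_size (interleaving_problem d e Us Vs)"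
      then have ij: "i < n" "j < n" by (simp_all add: size)
      show "fst (interleaving_problem d e Us Vs) $$ (i, j) = Zero" if "fst (weakening c C) $$ (i, j) = Zero"
        using that ij path[OF vert(1)[OF ij(2)] vert(2)[OF ij(1)]]
        unfolding fst[OF ij(2,1)] by (auto simp: weakening_def Let_def n_def split: if_splits)
      show "snd (interleaving_problem d e Us Vs) $$ (i, j) = Zero" if "snd (weakening c C) $$ (i, j) = Zero"
        using that ij path[OF vert(2)[OF ij(2)] vert(1)[OF ij(1)]]
        unfolding snd[OF ij] by (auto simp: weakening_def Let_def n_def split: if_splits)
    qed (simp add: size, simp add: weakening_def Let_def ci_size_def n_def)
  qed
  show "\<not> interleaved d 0 (usum Us :: ('k, _) pmod) (usum Vs :: ('k, _) pmod)" if n: "0 < n"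
  proof
    assume "interleaved d 0 (usum Us :: ('k, _) pmod) (usum Vs :: ('k, _) pmod)"
    then obtain A B :: "'k mat" where AB: "A \<in> carrier_mat n n" "B \<in> carrier_mat n n" "A * B = 1\<^sub>m n"
      "\<forall>i<n. \<forall>j<n. fst (interleaving_problem d 0 Us Vs) $$ (i, j) = Zero \<longrightarrow> A $$ (i, j) = 0"
      unfolding iff ci_solvable_def ci_solution_def Let_def size by blast
    have "A $$ (0, j) = 0" if j: "j < n" for j
    proof -
      have "\<not> (\<forall>p\<in>gen d (W (Inl j)). p + diag d 0 \<in> gen d (W (Inr 0)))"
      proof
        assume "\<forall>p\<in>gen d (W (Inl j)). p + diag d 0 \<in> gen d (W (Inr 0))"
        from walk[OF _ _ vert(1)[OF j] vert(2)[OF n] this] obtain l where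
          "real l \<le> 0" "(Inl j, Inr 0) \<in> ci_graph C ^^ l" by auto
        then show False by auto
      qed
      then show ?thesis using AB(4) n j fst[OF j n] by blast
    qed
    then have "(A * B) $$ (0, 0) = 0" using AB(1,2) n by (simp add: scalar_prod_def)
    then show False using AB(3) n by simp
  qed
qed

text \<open>The problem of size 0 has a solution and is treated separately, since its modules would be zero and
  therefore isomorphic.\<close>

theorem weakening_decision_reduction:
  assumes "poly_time_solvable \<beta> (distance_approximation TYPE('k::field) d c \<iota>)"
    and d: "2 \<le> d" and c: "odd c"
  shows "poly_time_solvable \<beta> (weakening_decision TYPE('k) c)"
proof (rule poly_time_reduction[OF assms(1), of _ "edecision d c"])
  fix y and v :: "'a val"
  assume "valid_output (distance_approximation TYPE('k) d c \<iota>) y v"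
  then show "\<exists>r. v = Num r" by (cases y) (auto simp: distance_approximation_def Let_def)
next
  fix G :: "'a val \<Rightarrow> 'a val" and C
  let ?X = "distance_approximation TYPE('k) d c \<iota>"
  let ?Y = "weakening_decision TYPE('k) c :: ('a, _) problem"
  assume G: "\<And>y. y \<in> inputs ?X \<Longrightarrow> valid_output ?X y (G (encode ?X y))" and "C \<in> inputs ?Y"
  then have C: "C \<in> ci_problems" by (simp add: weakening_decision_def)
  define n where "n = ci_size C"
  have mats: "fst C \<in> carrier_mat n n" "snd C \<in> carrier_mat n n"
    using C by (auto simp: ci_problems_def n_def ci_size_def)
  let ?e = "EIfLess (ECall (ECons (EVar 3) (EVar 4))) (EInt (int (c + 2))) (EInt 1) (EInt 0)"
  define \<eta> where "\<eta> = initial (encode ?Y C)"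
  have enc: "encode ?Y C = Pair (enc_mat (fst C)) (enc_mat (snd C))"
    by (simp add: weakening_decision_def split_beta)
  have \<eta>0: "\<eta> 0 = Pair (enc_mat (fst C)) (enc_mat (snd C))" by (simp add: \<eta>_def initial_def enc)
  have hd: "head (\<eta> 0) = vlist (map (\<lambda>i. vlist (map (\<lambda>j. enc_entry (fst C $$ (i, j))) [0..<n])) [0..<n])"
    by (simp add: \<eta>0 enc_mat_vlist[OF mats(1)])
  show "safe G (encode ?X ` inputs ?X) (initial (encode ?Y C)) (edecision d c) \<and>
      valid_output ?Y C (eval G (initial (encode ?Y C)) (edecision d c))"
  proof (cases "n = 0")
    case True
    have "ci_solution (weakening c C) (1\<^sub>m 0 :: 'k mat) (1\<^sub>m 0)"
      using True by (auto simp: ci_solution_def weakening_def Let_def ci_size_def n_def)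
    then have "ci_solvable TYPE('k) (weakening c C)" unfolding ci_solvable_def by blast
    moreover have "head (initial (encode ?Y C) 0) = Nil" using hd True by (simp add: \<eta>_def)
    ultimately show ?thesis by (simp add: edecision_def weakening_decision_def)
  next
    case False
    then have n: "0 < n" by simp
    define W where "W x = (walk_corners d (int (c + 2)) C (c + 2) x :: 'a vec list)" for x
    define A where "A = map (\<lambda>i. W (Inl i)) [0..<n]"
    define B where "B = map (\<lambda>i. W (Inr i)) [0..<n]"
    let ?M = "upset_sum d (map (map (map_vec \<iota>)) A) :: ('k, nat \<times> unit) pmod"
    let ?N = "upset_sum d (map (map (map_vec \<iota>)) B) :: ('k, nat \<times> unit) pmod"
    have "set (W x) \<subseteq> carrier_vec d" "W x \<noteq> []" for x
      unfolding W_def by (rule walk_corners_carrier, rule walk_corners_nonempty)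
    then have carrier: "set us \<subseteq> carrier_vec d" "us \<noteq> []" if "us \<in> set A \<union> set B" for us
      using that by (auto simp: A_def B_def dest: sym[of "[]"])
    note wi = walk_interleaving[OF d c, where C = C and 'k = 'k, folded n_def W_def, folded A_def B_def,
        folded upset_sum_gen]
    have "filter (\<lambda>us. us \<noteq> []) A = A" "filter (\<lambda>us. us \<noteq> []) B = B"
      using carrier(2) by (auto intro: filter_True)
    then have "size (barcode d ?M) = size (barcode d ?N)"
      using size_barcode_gen[where 'k = 'k, of A d] size_barcode_gen[where 'k = 'k, of B d] carrier(1)
      by (auto simp: A_def B_def)
    moreover have "\<not> isomorphic d ?M ?N"
      using wi(3)[OF n] isomorphic_iff_interleaved_zero[of d ?M ?N] pmodule_upset_sum by blast
    ultimately have AB: "(A, B) \<in> inputs ?X"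
      using carrier(1) by (auto simp: distance_approximation_def Let_def)
    have encX: "encode ?X (A, B) = Pair (vlist (map enc_points A)) (vlist (map enc_points B))"
      by (simp add: distance_approximation_def Let_def enc_list_vlist[of enc_vec, abs_def]
        enc_list_vlist[of enc_points])
    obtain r where r: "G (encode ?X (A, B)) = Num r" "interleaving_distance d ?M ?N \<le> ereal (\<iota> r)"
      "ereal (\<iota> r) < ereal (real (c + 2)) * interleaving_distance d ?M ?N"
      using G[OF AB] by (auto simp: distance_approximation_def Let_def)
    have less: "\<iota> r < real (c + 2) \<longleftrightarrow> r < of_int (int (c + 2))"
      using less_iff[of r "of_int (int (c + 2))"] of_int[of "int (c + 2)"] by simp
    \<comment> \<open>An approximation below \<open>c + 2\<close> witnesses an interleaving below \<open>c + 2\<close>.\<close>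
    have one: "ci_solvable TYPE('k) (weakening c C)" if "\<iota> r < real (c + 2)"
    proof -
      have "interleaving_distance d ?M ?N < ereal (real (c + 2))"
        using r(2) that by (simp add: order_le_less_trans)
      then obtain e where "interleaved d e ?M ?N" "e < real (c + 2)"
        unfolding interleaving_distance_def Inf_less_iff by auto
      then show ?thesis by (rule wi(2))
    qed
    have zero: "\<iota> r < real (c + 2)" if "ci_solvable TYPE('k) C"
    proof -
      have "interleaving_distance d ?M ?N \<le> ereal 1"
        unfolding interleaving_distance_def using wi(1)[OF that] by (intro Inf_lower) blast
      then have "ereal (real (c + 2)) * interleaving_distance d ?M ?N \<le> ereal (real (c + 2)) * ereal 1"
        by (intro ereal_mult_left_mono) auto
      with r(3) have "ereal (\<iota> r) < ereal (real (c + 2)) * ereal 1" by (rule less_le_trans)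
      then show ?thesis by simp
    qed
    have s3: "eval G \<eta> (estart d (int (c + 2)) True) =
        enc_family (ci_size C) (walk_corners d (int (c + 2)) C 0) Inl"
      using eval_estart[of \<eta>, OF hd, of C G d "int (c + 2)" True] by (simp add: n_def)
    have s4: "eval G (\<eta>(3 := w)) (estart d (int (c + 2)) False) =
        enc_family (ci_size C) (walk_corners d (int (c + 2)) C 0) Inr" for w
      using eval_estart[of "\<eta>(3 := w)", of _ C G d "int (c + 2)" False] hd by (simp add: n_def)
    define \<eta>1 where "\<eta>1 = \<eta>(3 := eval G \<eta> (estart d (int (c + 2)) True),
      4 := eval G (\<eta>(3 := eval G \<eta> (estart d (int (c + 2)) True))) (estart d (int (c + 2)) False))"
    have "\<exists>\<eta>'. \<eta>' 3 = enc_family (ci_size C) (walk_corners d (int (c + 2)) C (0 + (c + 2))) Inl \<and>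
      \<eta>' 4 = enc_family (ci_size C) (walk_corners d (int (c + 2)) C (0 + (c + 2))) Inr \<and>
      eval G \<eta>1 (erounds d (c + 2) ?e) = eval G \<eta>' ?e \<and> (\<forall>D. safe G D \<eta>' ?e \<longrightarrow> safe G D \<eta>1 (erounds d (c + 2) ?e))"
    proof (rule eval_erounds[OF C])
      show "\<eta>1 0 = Pair (enc_mat (fst C)) (enc_mat (snd C))" by (simp add: \<eta>1_def \<eta>0)
      have "\<eta>1 3 = eval G \<eta> (estart d (int (c + 2)) True)" by (simp add: \<eta>1_def)
      then show "\<eta>1 3 = enc_family (ci_size C) (walk_corners d (int (c + 2)) C 0) Inl"
        unfolding s3 .
      have "\<eta>1 4 = eval G (\<eta>(3 := eval G \<eta> (estart d (int (c + 2)) True))) (estart d (int (c + 2)) False)"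
        by (simp add: \<eta>1_def)
      then show "\<eta>1 4 = enc_family (ci_size C) (walk_corners d (int (c + 2)) C 0) Inr"
        unfolding s4 .
    qed
    then obtain \<eta>' where \<eta>': "\<eta>' 3 = vlist (map enc_points A)" "\<eta>' 4 = vlist (map enc_points B)"
      "eval G \<eta>1 (erounds d (c + 2) ?e) = eval G \<eta>' ?e"
      "\<And>D. safe G D \<eta>' ?e \<Longrightarrow> safe G D \<eta>1 (erounds d (c + 2) ?e)"
      unfolding add_0 A_def B_def W_def n_def map_map comp_def by blast
    have pair: "\<exists>a b. head (initial (encode ?Y C) 0) = Pair a b"
      using hd n unfolding \<eta>_def[symmetric] by (cases n) (auto simp: upt_conv_Cons simp del: upt_Suc)
    have arg: "eval G \<eta>' (ECons (EVar 3) (EVar 4)) = encode ?X (A, B)" by (simp add: \<eta>' encX)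
    have "eval G (initial (encode ?Y C)) (edecision d c) = eval G \<eta>' ?e"
      using pair unfolding edecision_def \<eta>'(3)[symmetric] \<eta>1_def \<eta>_def by auto
    also have "\<dots> = Num (if r < of_int (int (c + 2)) then 1 else 0)"
      using arg r(1) by simp
    finally have ev: "eval G (initial (encode ?Y C)) (edecision d c) = Num (if r < of_int (int (c + 2)) then 1 else 0)" .
    have "safe G (encode ?X ` inputs ?X) \<eta>' ?e"
      using arg AB by simp
    then have "safe G (encode ?X ` inputs ?X) \<eta>1 (erounds d (c + 2) ?e)" by (rule \<eta>'(4))
    moreover have "safe G D \<eta> (estart d K b)" for D \<eta> K b
      by (rule safe_if_call_free, rule call_free_graph_macros)
    ultimately have "safe G (encode ?X ` inputs ?X) (initial (encode ?Y C)) (edecision d c)"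
      using pair unfolding edecision_def \<eta>1_def \<eta>_def by auto
    moreover have "valid_output ?Y C (Num (if r < of_int (int (c + 2)) then 1 else 0))"
      using one zero less by (auto simp: weakening_decision_def)
    ultimately show ?thesis unfolding ev ..
  qed
qed

end

lemma embedded_numbers_rat: "embedded_numbers rat_bits real_of_rat"
  by (intro embedded_numbers.intro embedded_numbers_axioms.intro bit_size_rat)
     (simp_all add: of_rat_less of_rat_add of_rat_mult)

lemma embedded_numbers_real: "embedded_numbers real_bits (\<lambda>r. r)"
  by (intro embedded_numbers.intro embedded_numbers_axioms.intro bit_size_real) simp_all

theorem theorem6p13:
  fixes c d :: nat
  assumes "1 \<le> c" and "odd c" and "2 \<le> d"
  shows
    "(poly_time_solvable rat_bits (distance_approximation TYPE('k::field) d c real_of_rat) \<longleftrightarrow>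
      poly_time_solvable rat_bits (weakening_decision TYPE('k) c)) \<and>
     (poly_time_solvable real_bits (distance_approximation TYPE('k) d c (\<lambda>r. r)) \<longleftrightarrow>
      poly_time_solvable real_bits (weakening_decision TYPE('k) c))"
proof -
  have eq: "poly_time_solvable \<beta> (distance_approximation TYPE('k) d c \<iota>) \<longleftrightarrow>
      poly_time_solvable \<beta> (weakening_decision TYPE('k) c)"
    if "embedded_numbers \<beta> \<iota>" for \<beta> :: "'a::linordered_field \<Rightarrow> nat" and \<iota>
    using embedded_numbers.distance_approximation_reduction[OF that]
      embedded_numbers.weakening_decision_reduction[OF that _ assms(3,2)] by blast
  show ?thesis using eq[OF embedded_numbers_rat] eq[OF embedded_numbers_real] by blast
qed

end
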